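(* Let $M,N,P,Q$ be distinct points on the conic $\mathcal K$, and let $h\in\mathcal H^\circ$ be the map with $h(\mathbb A)=h(\mathbb B)=M$, $h(\mathbb E)=h(\mathbb F)=N$, $h(\mathbb C)=P$, $h(\mathbb D)=Q$. Let $s=\left\{\begin{array}{ccc}\mathbb A&\mathbb B&\mathbb C\\ \mathbb F&\mathbb E&\mathbb D\end{array}\right\}$. Then $q_s$ induces an isomorphism of the fibre $X_h=\beta^{-1}(h)$ with the pencil of lines through the point $MQ\cap NP$.
   Context: Work over the complex numbers. Let $\mathcal K\subseteq\mathbb P^2$ be a nonsingular conic, let $L=\{\mathbb A,\mathbb B,\mathbb C,\mathbb D,\mathbb E,\mathbb F\}$ be a set of six letters, and let $\mathcal H=\mathcal K^{L}\simeq(\mathbb P^1)^6$ be the variety of all maps $h:L\to\mathcal K$. The type of a partition of $L$ is the list of its block sizes. For a partition $\pi$, the polydiagonal of type $\pi$ is $\Delta_\pi=\{h\in\mathcal H: h(x)=h(y)\text{ whenever }x,y\text{ are in the same block of }\pi\}$. A Pascal symbol is an array $s=\left\{\begin{array}{ccc} x_1&x_2&x_3\\ y_1&y_2&y_3\end{array}\right\}$ with $\{x_1,x_2,x_3,y_1,y_2,y_3\}=L$, considered up to permuting its rows and permuting its columns. For injective $h$, Pascal's theorem says that the three points $h(x_i)h(y_j)\cap h(x_j)h(y_i)$ ($1\le i<j\le 3$) are collinear, where $PQ$ denotes the line joining $P,Q$; the line containing them is the Pascal line. The assignment of the Pascal line to $h$ defines a rational map $p_s:\mathcal H\dashrightarrow(\mathbb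 P^2)^*$ to the space of lines in $\mathbb P^2$. Let $\mathcal H^\circ=\mathcal H\setminus\bigcup_\mu\Delta_\mu$, the union being over all partitions $\mu$ of type $(3,2,1)$ or $(4,1,1)$. For $\pi$ of type $(2,2,1,1)$, $(3,1,1,1)$ or $(2,2,2)$, put $\Delta_\pi^\circ=\mathcal H^\circ\cap\Delta_\pi$. Let $Z\subseteq\mathcal H^\circ$ be the union of all $\Delta^\circ_\pi$ with $\pi$ of type $(2,2,2)$, and $Y\subseteq\mathcal H^\circ$ the union of all $\Delta^\circ_\pi$ with $\pi$ of type $(2,2,1,1)$ or $(3,1,1,1)$. Let $\beta_1:\mathbb X'\to\mathcal H^\circ$ be the blow-up along $Z$, let $Y'\subseteq\mathbb X'$ be the proper transform of $Y$, let $\beta_2:\mathbb X\to\mathbb X'$ be the blow-up along $Y'$, and let $\beta=\beta_1\circ\beta_2:\mathbb X\to\mathcal H^\circ$. For every Pascal symbol $s$, $q_s:\mathbb X\to(\mathbb P^2)^*$ denotes the (unique, existing) regular morphism extending the rational map $p_s\circ\beta$. The pencil of lines through a point $T\in\mathbb P^2$ is the line in $(\mathbb P^2)^*$ consisting of all lines in $\mathbb P^2$ passing through $T$. *)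

theory Defs
  imports Complex_Main "HOL-Library.Multiset" "HOL-Library.Disjoint_Sets"
    "HOL-Combinatorics.Permutations"
begin

section \<open>Varieties as spaces with functions\<close>

text \<open>
  A complex variety is encoded in the classical way (Serre), as a point set with a Zariski topology
  and a sheaf of complex-valued regular functions.  All of this is recorded by one set \<open>R\<close> of
  pairs: \<open>(U, f) \<in> R\<close> means that \<open>U\<close> is open and that the restriction of \<open>f\<close> to \<open>U\<close> is regular
  (values of \<open>f\<close> outside \<open>U\<close> are irrelevant).

  \<open>generated S G\<close> is the coarsest such structure on the point set \<open>S\<close> for which the restriction to
  \<open>S\<close> of every member of \<open>G\<close> is regular: regular functions form sheaves of algebras, the set where
  a regular function does not vanish is open, and its inverse is regular there.
\<close>

type_synonym 'a fspace = "('a set \<times> ('a \<Rightarrow> complex)) set"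

inductive_set generated :: "'a set \<Rightarrow> 'a fspace \<Rightarrow> 'a fspace" for S :: "'a set" and G :: "'a fspace" where
  base: "(U, f) \<in> G \<Longrightarrow> (U \<inter> S, f) \<in> generated S G"
| const: "(S, \<lambda>_. c) \<in> generated S G"
| add: "(U, f) \<in> generated S G \<Longrightarrow> (V, g) \<in> generated S G
    \<Longrightarrow> (U \<inter> V, \<lambda>x. f x + g x) \<in> generated S G"
| mult: "(U, f) \<in> generated S G \<Longrightarrow> (V, g) \<in> generated S G
    \<Longrightarrow> (U \<inter> V, \<lambda>x. f x * g x) \<in> generated S G"
| inverse: "(U, f) \<in> generated S G
    \<Longrightarrow> ({x \<in> U. f x \<noteq> 0}, \<lambda>x. inverse (f x)) \<in> generated S G"
| glue: "(\<And>x. x \<in> U \<Longrightarrow>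
      \<exists>V g. x \<in> V \<and> V \<subseteq> U \<and> (V, g) \<in> generated S G \<and> (\<forall>y\<in>V. f y = g y))
    \<Longrightarrow> (U, f) \<in> generated S G"

definition points :: "'a fspace \<Rightarrow> 'a set" where
  "points R = \<Union> (fst ` R)"

definition open_in :: "'a fspace \<Rightarrow> 'a set \<Rightarrow> bool" where
  "open_in R U \<longleftrightarrow> (U, \<lambda>_. 0) \<in> R"

definition closure_in :: "'a fspace \<Rightarrow> 'a set \<Rightarrow> 'a set" where
  "closure_in R A = {x \<in> points R. \<forall>U. open_in R U \<and> x \<in> U \<longrightarrow> U \<inter> A \<noteq> {}}"

text \<open>\<open>R\<close> is closed under all the rules above, with \<open>S\<close> the set of its points.\<close>

definition function_space :: "'a fspace \<Rightarrow> bool" where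
  "function_space R \<longleftrightarrow> generated (points R) R \<subseteq> R"

lemma generated_subset:
  assumes "(U, f) \<in> generated S G"
  shows "U \<subseteq> S"
  using assms
proof induction
  case (glue U f)
  show ?case
  proof
    fix x assume "x \<in> U"
    from glue[OF this] show "x \<in> S" by (elim exE conjE) (erule subsetD)
  qed
qed auto

lemma points_generated: "points (generated S G) = S"
  using generated_subset generated.const[of S 0 G] unfolding points_def by fastforce

lemma function_space_generated: "function_space (generated S G)"
proof -
  have "(U, f) \<in> generated S G" if "(U, f) \<in> generated S (generated S G)" for U f
    using that
  proof induction
    case (base U f)
    moreover from this have "U \<inter> S = U" using generated_subset[of U f S G] by auto
    ultimately show ?case by simp
  next
    case (glue U f)
    show ?case
    proof (rule generated.glue)
      fix x assume "x \<in> U"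
      from glue[OF this]
      show "\<exists>V g. x \<in> V \<and> V \<subseteq> U \<and> (V, g) \<in> generated S G \<and> (\<forall>y\<in>V. f y = g y)"
        by (elim exE conjE) (intro exI conjI)
    qed
  qed (simp_all add: generated.const generated.add generated.mult generated.inverse)
  then show ?thesis by (auto simp: function_space_def points_generated)
qed

definition morphism :: "'a fspace \<Rightarrow> 'b fspace \<Rightarrow> ('a \<Rightarrow> 'b) \<Rightarrow> bool" where
  "morphism R S \<phi> \<longleftrightarrow> \<phi> ` points R \<subseteq> points S \<and>
     (\<forall>(V, g) \<in> S. ({x \<in> points R. \<phi> x \<in> V}, \<lambda>x. g (\<phi> x)) \<in> R)"

definition isomorphism :: "'a fspace \<Rightarrow> 'b fspace \<Rightarrow> ('a \<Rightarrow> 'b) \<Rightarrow> bool" where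
  "isomorphism R S \<phi> \<longleftrightarrow> bij_betw \<phi> (points R) (points S) \<and>
     morphism R S \<phi> \<and> morphism S R (inv_into (points R) \<phi>)"

text \<open>The induced structure on a subset of the points; for a closed subset this is the reduced one.\<close>

definition induced :: "'a fspace \<Rightarrow> 'a set \<Rightarrow> 'a fspace" where
  "induced R S = generated S R"

definition product :: "'a fspace \<Rightarrow> 'b fspace \<Rightarrow> ('a \<times> 'b) fspace" where
  "product R S = generated (points R \<times> points S)
     ({(U \<times> points S, \<lambda>p. f (fst p)) | U f. (U, f) \<in> R} \<union>
      {(points R \<times> V, \<lambda>p. g (snd p)) | V g. (V, g) \<in> S})"

definition power_space :: "'a fspace \<Rightarrow> ('l::finite \<Rightarrow> 'a) fspace" where
  "power_space R = generated {h. range h \<subseteq> points R}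
     {({h. h x \<in> U}, \<lambda>h. f (h x)) | x U f. (U, f) \<in> R}"


section \<open>Projective space\<close>

text \<open>
  A point of \<open>n\<close>-dimensional projective space is the set of all its homogeneous coordinate
  vectors, these being sequences that vanish beyond index \<open>n\<close>.  The structure is generated by the
  functions \<open>x\<^sub>i / x\<^sub>j\<close> on the affine charts \<open>x\<^sub>j \<noteq> 0\<close>.
\<close>

type_synonym ppoint = "(nat \<Rightarrow> complex) set"

definition hclass :: "(nat \<Rightarrow> complex) \<Rightarrow> ppoint" where
  "hclass v = {\<lambda>i. c * v i | c. c \<noteq> 0}"

definition proj_points :: "nat \<Rightarrow> ppoint set" where
  "proj_points n = {hclass v | v. (\<forall>i>n. v i = 0) \<and> (\<exists>i. v i \<noteq> 0)}"

definition coord_ratio :: "nat \<Rightarrow> nat \<Rightarrow> ppoint \<Rightarrow> complex" where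
  "coord_ratio i j p = (THE c. \<forall>v\<in>p. c = v i / v j)"

definition proj_space :: "nat \<Rightarrow> ppoint fspace" where
  "proj_space n = generated (proj_points n)
     {({p. \<forall>v\<in>p. v j \<noteq> 0}, coord_ratio i j) | i j. i \<le> n \<and> j \<le> n}"


section \<open>Blow-ups\<close>

text \<open>\<open>f 0, \<dots>, f n\<close> generate the ideal sheaf of \<open>Z\<close> over the open set \<open>U\<close>.\<close>

definition ideal_generators ::
    "'a fspace \<Rightarrow> 'a set \<Rightarrow> 'a set \<Rightarrow> nat \<Rightarrow> (nat \<Rightarrow> 'a \<Rightarrow> complex) \<Rightarrow> bool" where
  "ideal_generators R Z U n f \<longleftrightarrow> open_in R U \<and>
     (\<forall>i\<le>n. (U, f i) \<in> R \<and> (\<forall>z \<in> U \<inter> Z. f i z = 0)) \<and>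
     (\<forall>V g x. (V, g) \<in> R \<and> (\<forall>z \<in> V \<inter> Z. g z = 0) \<and> x \<in> V \<inter> U \<longrightarrow>
        (\<exists>W a. x \<in> W \<and> W \<subseteq> V \<inter> U \<and> (\<forall>i\<le>n. (W, a i) \<in> R) \<and>
           (\<forall>y\<in>W. g y = (\<Sum>i\<le>n. a i y * f i y))))"

text \<open>The closure in \<open>U \<times> \<P>\<^sup>n\<close> of the graph of \<open>x \<mapsto> [f\<^sub>0 x : \<dots> : f\<^sub>n x]\<close> on \<open>U - Z\<close>.\<close>

definition graph_closure ::
    "'a fspace \<Rightarrow> 'a set \<Rightarrow> 'a set \<Rightarrow> nat \<Rightarrow> (nat \<Rightarrow> 'a \<Rightarrow> complex) \<Rightarrow> ('a \<times> ppoint) fspace" where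
  "graph_closure R Z U n f =
     (let P = product (induced R U) (proj_space n)
      in induced P (closure_in P {(x, hclass (\<lambda>i. if i \<le> n then f i x else 0)) | x. x \<in> U - Z}))"

text \<open>
  The blow-up of a variety along a reduced closed subset \<open>Z\<close>: locally on the base, it is the
  closure of the graph of the map given by generators of the ideal of \<open>Z\<close>.  The local models do
  not depend on the choice of the generators, up to a unique isomorphism over the base, so this
  determines the blow-up up to a unique isomorphism over \<open>R\<close>.
\<close>

definition blow_up :: "'b fspace \<Rightarrow> ('b \<Rightarrow> 'a) \<Rightarrow> 'a fspace \<Rightarrow> 'a set \<Rightarrow> bool" where
  "blow_up B \<beta> R Z \<longleftrightarrow> function_space B \<and> morphism B R \<beta> \<and>
     (\<forall>x \<in> points R. \<exists>U n f \<psi>. x \<in> U \<and> ideal_generators R Z U n f \<and>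
        isomorphism (induced B {b \<in> points B. \<beta> b \<in> U}) (graph_closure R Z U n f) \<psi> \<and>
        (\<forall>b \<in> points B. \<beta> b \<in> U \<longrightarrow> fst (\<psi> b) = \<beta> b))"

definition proper_transform :: "'b fspace \<Rightarrow> ('b \<Rightarrow> 'a) \<Rightarrow> 'a set \<Rightarrow> 'a set \<Rightarrow> 'b set" where
  "proper_transform B \<beta> Z Y = closure_in B {b \<in> points B. \<beta> b \<in> Y - Z}"


section \<open>Plane projective geometry\<close>

text \<open>
  A line of the plane is identified with the point of the dual plane given by its coefficients, so
  the dual plane is another copy of \<open>proj_space 2\<close>.
\<close>

type_synonym pline = ppoint

definition on_line :: "ppoint \<Rightarrow> pline \<Rightarrow> bool" where
  "on_line p l \<longleftrightarrow> (\<forall>v\<in>p. \<forall>w\<in>l. (\<Sum>i\<le>2. v i * w i) = 0)"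

definition join :: "ppoint \<Rightarrow> ppoint \<Rightarrow> pline" where
  "join p q = (THE l. l \<in> proj_points 2 \<and> on_line p l \<and> on_line q l)"

definition meet :: "pline \<Rightarrow> pline \<Rightarrow> ppoint" where
  "meet l m = (THE p. p \<in> proj_points 2 \<and> on_line p l \<and> on_line p m)"

definition pencil :: "ppoint \<Rightarrow> pline set" where
  "pencil p = {l \<in> proj_points 2. on_line p l}"

text \<open>
  A conic is the zero locus of a quadratic form, here given by a symmetric matrix \<open>a\<close>; it is
  nonsingular if the gradient \<open>2 a v\<close> of the form vanishes at none of its points.
\<close>

definition nonsingular_conic :: "ppoint set \<Rightarrow> bool" where
  "nonsingular_conic K \<longleftrightarrow> (\<exists>a :: nat \<Rightarrow> nat \<Rightarrow> complex.
     (\<forall>i j. a i j = a j i) \<and>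
     K = {p \<in> proj_points 2. \<forall>v\<in>p. (\<Sum>i\<le>2. \<Sum>j\<le>2. a i j * v i * v j) = 0} \<and>
     (\<forall>p\<in>K. \<forall>v\<in>p. \<exists>i\<le>2. 2 * (\<Sum>j\<le>2. a i j * v j) \<noteq> 0))"


section \<open>Hexads on a conic and their Pascal lines\<close>

datatype letter = LA | LB | LC | LD | LE | LF

instance letter :: finite
proof
  have "(UNIV :: letter set) = {LA, LB, LC, LD, LE, LF}"
    using letter.exhaust by blast
  then show "finite (UNIV :: letter set)"
    by (metis finite.emptyI finite.insertI)
qed

type_synonym hexad = "letter \<Rightarrow> ppoint"

definition hexads :: "ppoint set \<Rightarrow> hexad fspace" where
  "hexads K = power_space (induced (proj_space 2) K)"

definition polydiagonal :: "ppoint set \<Rightarrow> letter set set \<Rightarrow> hexad set" where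
  "polydiagonal K \<pi> = {h \<in> points (hexads K). \<forall>b\<in>\<pi>. \<forall>x\<in>b. \<forall>y\<in>b. h x = h y}"

definition partition_has_type :: "letter set set \<Rightarrow> nat multiset \<Rightarrow> bool" where
  "partition_has_type \<pi> t \<longleftrightarrow> partition_on UNIV \<pi> \<and> image_mset card (mset_set \<pi>) = t"

definition polydiagonals :: "ppoint set \<Rightarrow> nat multiset set \<Rightarrow> hexad set" where
  "polydiagonals K T = (\<Union>\<pi> \<in> {\<pi>. \<exists>t\<in>T. partition_has_type \<pi> t}. polydiagonal K \<pi>)"

definition Hcirc_set :: "ppoint set \<Rightarrow> hexad set" where
  "Hcirc_set K = points (hexads K) - polydiagonals K {{#3, 2, 1#}, {#4, 1, 1#}}"

definition Hcirc :: "ppoint set \<Rightarrow> hexad fspace" where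
  "Hcirc K = induced (hexads K) (Hcirc_set K)"

definition Zcentre :: "ppoint set \<Rightarrow> hexad set" where
  "Zcentre K = Hcirc_set K \<inter> polydiagonals K {{#2, 2, 2#}}"

definition Ycentre :: "ppoint set \<Rightarrow> hexad set" where
  "Ycentre K = Hcirc_set K \<inter> polydiagonals K {{#2, 2, 1, 1#}, {#3, 1, 1, 1#}}"

text \<open>
  A Pascal symbol is represented by one of its arrays, given by its two rows; by the two lemmas
  below, the Pascal line does not depend on the choice of the array.
\<close>

definition pascal_array :: "letter list \<Rightarrow> letter list \<Rightarrow> bool" where
  "pascal_array xs ys \<longleftrightarrow> length xs = 3 \<and> length ys = 3 \<and> set xs \<union> set ys = UNIV"

definition pascal_point :: "letter list \<Rightarrow> letter list \<Rightarrow> nat \<Rightarrow> nat \<Rightarrow> hexad \<Rightarrow> ppoint" where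
  "pascal_point xs ys i j h =
     meet (join (h (xs ! i)) (h (ys ! j))) (join (h (xs ! j)) (h (ys ! i)))"

definition pascal_line :: "letter list \<Rightarrow> letter list \<Rightarrow> hexad \<Rightarrow> pline" where
  "pascal_line xs ys h = (THE l. l \<in> proj_points 2 \<and>
     (\<forall>i j. i < j \<and> j < 3 \<longrightarrow> on_line (pascal_point xs ys i j h) l))"

lemma join_commute: "join p q = join q p"
  unfolding join_def by (metis (no_types))

lemma meet_commute: "meet l m = meet m l"
  unfolding meet_def by (metis (no_types))

lemma pascal_line_swap_rows: "pascal_line ys xs = pascal_line xs ys"
  unfolding pascal_line_def pascal_point_def
  by (simp add: join_commute meet_commute)

lemma pascal_line_permute_columns:
  assumes "pascal_array xs ys" and \<sigma>: "\<sigma> permutes {..<3}"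
  shows "pascal_line (map (\<lambda>i. xs ! \<sigma> i) [0..<3]) (map (\<lambda>i. ys ! \<sigma> i) [0..<3]) = pascal_line xs ys"
    (is "pascal_line ?xs ?ys = _")
proof -
  have sym: "pascal_point us vs i j h = pascal_point us vs j i h" for us vs i j h
    unfolding pascal_point_def by (rule meet_commute)
  have ordered: "(\<forall>i j. i < j \<and> j < 3 \<longrightarrow> on_line (pascal_point us vs i j h) l) \<longleftrightarrow>
      (\<forall>i\<in>{..<3}. \<forall>j\<in>{..<3}. i \<noteq> j \<longrightarrow> on_line (pascal_point us vs i j h) l)" for us vs h l
    by (smt (verit) sym lessThan_iff linorder_neq_iff order_less_trans)
  have pt: "pascal_point ?xs ?ys i j h = pascal_point xs ys (\<sigma> i) (\<sigma> j) h"
    if "i \<in> {..<3}" "j \<in> {..<3}" for i j h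
    using that by (simp add: pascal_point_def del: upt_Suc)
  have im: "\<sigma> ` {..<3} = {..<3}" and inj: "inj \<sigma>"
    using permutes_image[OF \<sigma>] permutes_inj[OF \<sigma>] by auto
  have "(\<forall>i\<in>{..<3}. \<forall>j\<in>{..<3}. i \<noteq> j \<longrightarrow> on_line (pascal_point ?xs ?ys i j h) l) \<longleftrightarrow>
      (\<forall>i\<in>\<sigma> ` {..<3}. \<forall>j\<in>\<sigma> ` {..<3}. i \<noteq> j \<longrightarrow> on_line (pascal_point xs ys i j h) l)" for h l
    using inj by (simp add: pt inj_eq del: upt_Suc)
  then show ?thesis
    unfolding pascal_line_def ordered im by (intro ext) simp
qed

text \<open>
  The morphism \<open>q\<close> extends the rational map that sends \<open>x\<close> to the Pascal line of \<open>\<beta> x\<close>, which is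
  defined wherever the hexad \<open>\<beta> x\<close> is injective.
\<close>

definition pascal_extension ::
    "'b fspace \<Rightarrow> ('b \<Rightarrow> hexad) \<Rightarrow> letter list \<Rightarrow> letter list \<Rightarrow> ('b \<Rightarrow> pline) \<Rightarrow> bool" where
  "pascal_extension X \<beta> xs ys q \<longleftrightarrow> morphism X (proj_space 2) q \<and>
     (\<forall>x \<in> points X. inj (\<beta> x) \<longrightarrow> q x = pascal_line xs ys (\<beta> x))"

definition fibre :: "'b fspace \<Rightarrow> ('b \<Rightarrow> 'a) \<Rightarrow> 'a \<Rightarrow> 'b fspace" where
  "fibre X \<beta> y = induced X {x \<in> points X. \<beta> x = y}"

end

theory Submission
  imports Defs
begin

text \<open>
  Write \<open>a, \<dots>, f\<close> for the parameters of the six points on the conic.  The hexad \<open>h\<close> lies off the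
  first centre, and near it the second centre is given by \<open>a = b\<close>, \<open>e = f\<close>; these two functions
  generate its ideal by Hadamard's lemma, so that the fibre over \<open>h\<close> is the projective line with
  coordinates \<open>[a - b : e - f]\<close>.  The Pascal line joins \<open>AE \<inter> BF\<close> to \<open>AD \<inter> CF\<close>.  The latter tends to
  \<open>MQ \<inter> NP\<close>, while the coordinates of the former are a combination of vectors that tend to \<open>N\<close> and
  \<open>M\<close>, with coefficients \<open>a - b\<close> and \<open>e - f\<close>.  Hence at the point \<open>[\<alpha> : \<beta>]\<close> of the fibre, \<open>q\<close> is the
  line that joins \<open>MQ \<inter> NP\<close> to the point \<open>\<alpha> N + \<beta> M\<close> of the line \<open>MN\<close>, which is a linear isomorphism
  onto the pencil.
\<close>

section \<open>Spaces with functions\<close>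

text \<open>The obstacle is that both blow-ups are given only through local models, with unknown
  generators of the ideals and unknown isomorphisms, while no dimension theory, irreducibility or
  completeness is at hand. All information about them is extracted from explicit regular functions
  and from arcs that are continuous in the classical topology. An arc through \<open>h\<close> lifts
  to \<open>X\<close> because the generators of the ideal, restricted to the arc, can be divided by
  the parameter; the lift joins a prescribed point of the fibre to hexads that are injective for all
  but finitely many parameters. This determines \<open>q\<close> on the fibre, although the
  hypothesis on \<open>q\<close> speaks only of injective hexads. The parametrization of the fibre
  by the projective line is only shown to be a surjective morphism; that nothing is collapsed
  follows from the fact that \<open>q\<close> becomes linear and invertible on it. The parameters of
  the six points need a chart of the conic, so a fifth point of the conic, different from M, N, P,
  Q, is placed at infinity.\<close>

context
  fixes R :: "'a fspace"
  assumes R: "function_space R"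
begin

lemma regular_subset: "(U, f) \<in> R \<Longrightarrow> U \<subseteq> points R"
  unfolding points_def by force

lemma generated_points_regular: "(U, f) \<in> generated (points R) R \<Longrightarrow> (U, f) \<in> R"
  using R unfolding function_space_def by blast

lemma regular_generated: "(U, f) \<in> R \<Longrightarrow> (U, f) \<in> generated (points R) R"
  using generated.base[of U f R "points R"] regular_subset[of U f] by (simp add: Int_absorb2)

lemma regular_const: "(points R, \<lambda>_. c) \<in> R"
  by (rule generated_points_regular[OF generated.const])

lemma regular_add: "(U, f) \<in> R \<Longrightarrow> (V, g) \<in> R \<Longrightarrow> (U \<inter> V, \<lambda>x. f x + g x) \<in> R"
  by (rule generated_points_regular[OF generated.add[OF regular_generated regular_generated]])

lemma regular_mult: "(U, f) \<in> R \<Longrightarrow> (V, g) \<in> R \<Longrightarrow> (U \<inter> V, \<lambda>x. f x * g x) \<in> R"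
  by (rule generated_points_regular[OF generated.mult[OF regular_generated regular_generated]])

lemma regular_inverse: "(U, f) \<in> R \<Longrightarrow> ({x \<in> U. f x \<noteq> 0}, \<lambda>x. inverse (f x)) \<in> R"
  by (rule generated_points_regular[OF generated.inverse[OF regular_generated]])

lemma regular_glue:
  assumes "\<And>x. x \<in> U \<Longrightarrow> \<exists>V g. x \<in> V \<and> V \<subseteq> U \<and> (V, g) \<in> R \<and> (\<forall>y\<in>V. f y = g y)"
  shows "(U, f) \<in> R"
proof (rule generated_points_regular[OF generated.glue])
  fix x assume "x \<in> U"
  from assms[OF this] show
    "\<exists>V g. x \<in> V \<and> V \<subseteq> U \<and> (V, g) \<in> generated (points R) R \<and> (\<forall>y\<in>V. f y = g y)"
    using regular_generated by blast
qed

lemma regular_cong: "(U, f) \<in> R \<Longrightarrow> (\<And>x. x \<in> U \<Longrightarrow> g x = f x) \<Longrightarrow> (U, g) \<in> R"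
  by (rule regular_glue) blast

lemma regular_open:
  assumes "(U, f) \<in> R"
  shows "open_in R U"
proof -
  have "U \<inter> points R = U" using regular_subset[OF assms] by blast
  then show ?thesis
    using regular_mult[OF assms regular_const[of 0]] by (simp add: open_in_def)
qed

lemma regular_restrict:
  assumes "(U, f) \<in> R" "open_in R V"
  shows "(U \<inter> V, f) \<in> R"
  using regular_add[OF assms(1) assms(2)[unfolded open_in_def]] by simp

lemma regular_restrict_subset: "(U, f) \<in> R \<Longrightarrow> open_in R V \<Longrightarrow> V \<subseteq> U \<Longrightarrow> (V, f) \<in> R"
  using regular_restrict[of U f V] by (simp add: Int_absorb1)

lemma regular_on_const: "open_in R U \<Longrightarrow> (U, \<lambda>_. c) \<in> R"
  by (rule regular_restrict_subset[OF regular_const]) (auto simp: open_in_def dest: regular_subset)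

lemma regular_on_add: "(U, f) \<in> R \<Longrightarrow> (U, g) \<in> R \<Longrightarrow> (U, \<lambda>x. f x + g x) \<in> R"
  using regular_add[of U f U g] by simp

lemma regular_on_mult: "(U, f) \<in> R \<Longrightarrow> (U, g) \<in> R \<Longrightarrow> (U, \<lambda>x. f x * g x) \<in> R"
  using regular_mult[of U f U g] by simp

lemma regular_on_uminus: "(U, f) \<in> R \<Longrightarrow> (U, \<lambda>x. - f x) \<in> R"
  using regular_on_mult[OF regular_on_const[OF regular_open], of U f f "-1"] by simp

lemma regular_on_diff: "(U, f) \<in> R \<Longrightarrow> (U, g) \<in> R \<Longrightarrow> (U, \<lambda>x. f x - g x) \<in> R"
  using regular_on_add[OF _ regular_on_uminus, of U f g] by simp

lemma regular_on_sum:
  "open_in R U \<Longrightarrow> (\<And>i. i \<in> I \<Longrightarrow> (U, f i) \<in> R) \<Longrightarrow> (U, \<lambda>x. \<Sum>i\<in>I. f i x) \<in> R"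
proof (induction I rule: infinite_finite_induct)
  case (insert i I)
  then show ?case
    using regular_on_add[of U "f i" "\<lambda>x. \<Sum>i\<in>I. f i x"] by simp
qed (simp_all add: regular_on_const)

lemma open_nonzero: "(U, f) \<in> R \<Longrightarrow> open_in R {x \<in> U. f x \<noteq> 0}"
  by (rule regular_open[OF regular_inverse])

lemma regular_on_divide:
  assumes "(U, f) \<in> R" "(U, g) \<in> R" "\<And>x. x \<in> U \<Longrightarrow> g x \<noteq> 0"
  shows "(U, \<lambda>x. f x / g x) \<in> R"
proof -
  have "{x \<in> U. g x \<noteq> 0} = U" using assms(3) by auto
  then show ?thesis
    using regular_on_mult[OF assms(1), of "\<lambda>x. inverse (g x)"] regular_inverse[OF assms(2)]
    by (simp add: divide_inverse)
qed

lemma open_in_subset: "open_in R U \<Longrightarrow> U \<subseteq> points R"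
  unfolding open_in_def by (rule regular_subset)

lemma open_in_points: "open_in R (points R)"
  using regular_const unfolding open_in_def .

lemma open_in_Int: "open_in R U \<Longrightarrow> open_in R V \<Longrightarrow> open_in R (U \<inter> V)"
  unfolding open_in_def using regular_add[of U "\<lambda>_. 0" V "\<lambda>_. 0"] by simp

lemma open_in_local:
  assumes "\<And>x. x \<in> U \<Longrightarrow> \<exists>V. x \<in> V \<and> V \<subseteq> U \<and> open_in R V"
  shows "open_in R U"
  unfolding open_in_def
proof (rule regular_glue)
  fix x assume "x \<in> U"
  from assms[OF this] obtain V where "x \<in> V" "V \<subseteq> U" "(V, \<lambda>_. 0) \<in> R"
    unfolding open_in_def by auto
  then show "\<exists>V g. x \<in> V \<and> V \<subseteq> U \<and> (V, g) \<in> R \<and> (\<forall>y\<in>V. 0 = g y)"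
    by (intro exI[of _ V] exI[of _ "\<lambda>_. 0"]) simp
qed

lemma open_in_Union: "(\<And>U. U \<in> \<U> \<Longrightarrow> open_in R U) \<Longrightarrow> open_in R (\<Union>\<U>)"
  by (rule open_in_local) blast

text \<open>The factor \<open>points R\<close> covers the empty family.\<close>

lemma open_in_INT:
  "finite I \<Longrightarrow> (\<And>i. i \<in> I \<Longrightarrow> open_in R (U i)) \<Longrightarrow> open_in R (points R \<inter> (\<Inter>i\<in>I. U i))"
proof (induction I rule: finite_induct)
  case (insert i I)
  have "open_in R (U i \<inter> (points R \<inter> (\<Inter>i\<in>I. U i)))"
    using insert.prems insert.IH by (simp add: open_in_Int)
  moreover have "U i \<inter> (points R \<inter> (\<Inter>i\<in>I. U i)) = points R \<inter> (\<Inter>i\<in>insert i I. U i)" by auto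
  ultimately show ?case by simp
qed (simp add: open_in_points)

lemma closure_in_superset: "A \<subseteq> points R \<Longrightarrow> A \<subseteq> closure_in R A"
  unfolding closure_in_def by blast

text \<open>Over an open subset the induced structure has no new functions: restrictions to
  \<open>W\<close> are regular on \<open>R\<close>, and every generation rule is available there.
  This moves functions found on a chart back to the whole space.\<close>

lemma regular_induced:
  assumes "open_in R W" "(U, f) \<in> induced R W"
  shows "(U, f) \<in> R"
  using assms(2) unfolding induced_def
proof induction
  case (base U f)
  then show ?case using regular_restrict assms(1) by blast
next
  case (glue U f)
  show ?case
  proof (rule regular_glue)
    fix x assume "x \<in> U"
    from glue[OF this] obtain V g where "x \<in> V" "V \<subseteq> U" "(V, g) \<in> R" "\<forall>y\<in>V. f y = g y"
      by (elim exE conjE)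
    then show "\<exists>V g. x \<in> V \<and> V \<subseteq> U \<and> (V, g) \<in> R \<and> (\<forall>y\<in>V. f y = g y)"
      by (intro exI[of _ V] exI[of _ g]) simp
  qed
qed (use assms(1) in \<open>simp_all add: regular_on_const regular_add regular_mult regular_inverse\<close>)

end

lemma function_space_induced: "function_space (induced R A)"
  unfolding induced_def by (rule function_space_generated)

lemma points_induced: "points (induced R A) = A"
  unfolding induced_def by (rule points_generated)

lemma induced_regular: "(U, f) \<in> R \<Longrightarrow> (U \<inter> A, f) \<in> induced R A"
  unfolding induced_def by (rule generated.base)

section \<open>Morphisms\<close>

lemma morphism_points: "morphism R S \<phi> \<Longrightarrow> x \<in> points R \<Longrightarrow> \<phi> x \<in> points S"
  unfolding morphism_def by blast

lemma morphism_regular: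
  "morphism R S \<phi> \<Longrightarrow> (V, g) \<in> S \<Longrightarrow> ({x \<in> points R. \<phi> x \<in> V}, \<lambda>x. g (\<phi> x)) \<in> R"
  unfolding morphism_def by blast

lemma morphism_open: "morphism R S \<phi> \<Longrightarrow> open_in S V \<Longrightarrow> open_in R {x \<in> points R. \<phi> x \<in> V}"
  using morphism_regular[of R S \<phi> V "\<lambda>_. 0"] unfolding open_in_def by simp

text \<open>Regularity of pullbacks need be tested on generators only, since pulling back commutes
  with every generation rule. All morphisms into projective spaces, products and spaces of hexads
  are obtained in this way.\<close>

lemma morphism_generated:
  assumes R: "function_space R" and S: "\<And>x. x \<in> points R \<Longrightarrow> \<phi> x \<in> S"
    and G: "\<And>V g. (V, g) \<in> G \<Longrightarrow> ({x \<in> points R. \<phi> x \<in> V}, \<lambda>x. g (\<phi> x)) \<in> R"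
  shows "morphism R (generated S G) \<phi>"
  unfolding morphism_def points_generated
proof (intro conjI)
  show "\<phi> ` points R \<subseteq> S" using S by blast
  have "({x \<in> points R. \<phi> x \<in> V}, \<lambda>x. g (\<phi> x)) \<in> R" if "(V, g) \<in> generated S G" for V g
    using that
  proof induction
    case (base U f)
    have "{x \<in> points R. \<phi> x \<in> U \<inter> S} = {x \<in> points R. \<phi> x \<in> U}" using S by auto
    then show ?case using G[OF base] by simp
  next
    case (const c)
    have "{x \<in> points R. \<phi> x \<in> S} = points R" using S by auto
    then show ?case using regular_const[OF R] by simp
  next
    case (add U f V g)
    have "{x \<in> points R. \<phi> x \<in> U \<inter> V} = {x \<in> points R. \<phi> x \<in> U} \<inter> {x \<in> points R. \<phi> x \<in> V}" by auto
    then show ?case using regular_add[OF R add.IH] by simp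
  next
    case (mult U f V g)
    have "{x \<in> points R. \<phi> x \<in> U \<inter> V} = {x \<in> points R. \<phi> x \<in> U} \<inter> {x \<in> points R. \<phi> x \<in> V}" by auto
    then show ?case using regular_mult[OF R mult.IH] by simp
  next
    case (inverse U f)
    have "{x \<in> points R. \<phi> x \<in> {x \<in> U. f x \<noteq> 0}} = {x \<in> {x \<in> points R. \<phi> x \<in> U}. f (\<phi> x) \<noteq> 0}" by auto
    then show ?case using regular_inverse[OF R inverse.IH] by simp
  next
    case (glue U f)
    show ?case
    proof (rule regular_glue[OF R])
      fix x assume "x \<in> {x \<in> points R. \<phi> x \<in> U}"
      then have x: "x \<in> points R" "\<phi> x \<in> U" by auto
      from glue[OF x(2)] obtain V g where "\<phi> x \<in> V" "V \<subseteq> U"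
        "({x \<in> points R. \<phi> x \<in> V}, \<lambda>x. g (\<phi> x)) \<in> R" "\<forall>y\<in>V. f y = g y"
        by (elim exE conjE)
      with x(1) show "\<exists>V g. x \<in> V \<and> V \<subseteq> {x \<in> points R. \<phi> x \<in> U} \<and> (V, g) \<in> R \<and> (\<forall>y\<in>V. f (\<phi> y) = g y)"
        by (intro exI[of _ "{x \<in> points R. \<phi> x \<in> V}"] exI[of _ "\<lambda>x. g (\<phi> x)"]) auto
    qed
  qed
  then show "\<forall>(V, g)\<in>generated S G. ({x \<in> points R. \<phi> x \<in> V}, \<lambda>x. g (\<phi> x)) \<in> R" by blast
qed

lemma morphism_comp:
  assumes "morphism R S \<phi>" "morphism S T \<psi>"
  shows "morphism R T (\<lambda>x. \<psi> (\<phi> x))"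
  unfolding morphism_def
proof (intro conjI)
  show "(\<lambda>x. \<psi> (\<phi> x)) ` points R \<subseteq> points T" using assms unfolding morphism_def by blast
  show "\<forall>(V, g)\<in>T. ({x \<in> points R. \<psi> (\<phi> x) \<in> V}, \<lambda>x. g (\<psi> (\<phi> x))) \<in> R"
  proof safe
    fix V g assume "(V, g) \<in> T"
    from morphism_regular[OF assms(1) morphism_regular[OF assms(2) this]]
    have "({x \<in> points R. \<phi> x \<in> {x \<in> points S. \<psi> x \<in> V}}, \<lambda>x. g (\<psi> (\<phi> x))) \<in> R" .
    moreover have "{x \<in> points R. \<phi> x \<in> {x \<in> points S. \<psi> x \<in> V}} = {x \<in> points R. \<psi> (\<phi> x) \<in> V}"
      using morphism_points[OF assms(1)] by auto
    ultimately show "({x \<in> points R. \<psi> (\<phi> x) \<in> V}, \<lambda>x. g (\<psi> (\<phi> x))) \<in> R" by simp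
  qed
qed

lemma morphism_into_induced:
  assumes "function_space R" "morphism R S \<phi>" "\<And>x. x \<in> points R \<Longrightarrow> \<phi> x \<in> B"
  shows "morphism R (induced S B) \<phi>"
  unfolding induced_def
  by (rule morphism_generated) (use assms morphism_regular in auto)

lemma morphism_inclusion: "A \<subseteq> points R \<Longrightarrow> morphism (induced R A) R (\<lambda>x. x)"
  unfolding morphism_def points_induced
proof (intro conjI; clarify?)
  fix V g assume "(V, g) \<in> R"
  then show "({x \<in> A. x \<in> V}, g) \<in> induced R A"
    using induced_regular[of V g R A] by (simp add: Int_def conj_commute)
qed auto

lemma morphism_restrict:
  "morphism R S \<phi> \<Longrightarrow> A \<subseteq> points R \<Longrightarrow> morphism (induced R A) S \<phi>"
  using morphism_comp[OF morphism_inclusion] by fastforce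

lemma morphism_id:
  assumes "function_space R"
  shows "morphism R R (\<lambda>x. x)"
proof -
  have "{x \<in> points R. x \<in> V} = V" if "(V, g) \<in> R" for V g
    using regular_subset[OF assms that] by blast
  then show ?thesis unfolding morphism_def by auto
qed

lemma morphism_cong:
  assumes "function_space R" "morphism R S \<phi>" "\<And>x. x \<in> points R \<Longrightarrow> \<chi> x = \<phi> x"
  shows "morphism R S \<chi>"
  unfolding morphism_def
proof (intro conjI; clarify?)
  fix x assume "x \<in> points R" then show "\<chi> x \<in> points S"
    using assms morphism_points by metis
next
  fix V g assume "(V, g) \<in> S"
  from morphism_regular[OF assms(2) this]
  have "({x \<in> points R. \<phi> x \<in> V}, \<lambda>x. g (\<phi> x)) \<in> R" .
  moreover have "{x \<in> points R. \<chi> x \<in> V} = {x \<in> points R. \<phi> x \<in> V}" using assms(3) by auto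
  ultimately show "({x \<in> points R. \<chi> x \<in> V}, \<lambda>x. g (\<chi> x)) \<in> R"
    using assms by (auto intro: regular_cong[OF assms(1)])
qed

lemma morphism_const:
  assumes "function_space R" "c \<in> points S"
  shows "morphism R S (\<lambda>_. c)"
  unfolding morphism_def
proof (intro conjI; clarify?)
  fix V g assume "(V, g) \<in> S"
  show "({x \<in> points R. c \<in> V}, \<lambda>x. g c) \<in> R"
  proof (cases "c \<in> V")
    \<comment> \<open>The preimage is empty, and any function is regular on the empty set by vacuous
      gluing.\<close>
    case False then show ?thesis by (auto intro: regular_glue[OF assms(1)])
  qed (simp add: regular_const assms)
qed (use assms in auto)

lemma morphism_product_fst: "morphism (product R S) R fst"
proof -
  have "({p \<in> points R \<times> points S. fst p \<in> U}, \<lambda>x. f (fst x)) \<in> product R S" if "(U, f) \<in> R" for U f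
  proof -
    have "U \<subseteq> points R" using that unfolding points_def by force
    then have "{p \<in> points R \<times> points S. fst p \<in> U} = (U \<times> points S) \<inter> (points R \<times> points S)" by auto
    moreover have "((U \<times> points S) \<inter> (points R \<times> points S), \<lambda>x. f (fst x)) \<in> product R S"
      unfolding product_def by (rule generated.base) (use that in blast)
    ultimately show ?thesis by simp
  qed
  then show ?thesis unfolding morphism_def product_def points_generated by auto
qed

lemma morphism_product_snd: "morphism (product R S) S snd"
proof -
  have "({p \<in> points R \<times> points S. snd p \<in> U}, \<lambda>x. f (snd x)) \<in> product R S" if "(U, f) \<in> S" for U f
  proof -
    have "U \<subseteq> points S" using that unfolding points_def by force
    then have "{p \<in> points R \<times> points S. snd p \<in> U} = (points R \<times> U) \<inter> (points R \<times> points S)" by auto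
    moreover have "((points R \<times> U) \<inter> (points R \<times> points S), \<lambda>x. f (snd x)) \<in> product R S"
      unfolding product_def by (rule generated.base) (use that in blast)
    ultimately show ?thesis by simp
  qed
  then show ?thesis unfolding morphism_def product_def points_generated by auto
qed

lemma function_space_product: "function_space (product R S)"
  unfolding product_def by (rule function_space_generated)

lemma points_product: "points (product R S) = points R \<times> points S"
  unfolding product_def by (rule points_generated)

lemma morphism_Pair:
  assumes T: "function_space T" and "morphism T R \<phi>" "morphism T S \<psi>"
  shows "morphism T (product R S) (\<lambda>x. (\<phi> x, \<psi> x))"
  unfolding product_def
proof (rule morphism_generated[OF T])
  fix x assume "x \<in> points T"
  then show "(\<phi> x, \<psi> x) \<in> points R \<times> points S"
    using morphism_points[OF assms(2)] morphism_points[OF assms(3)] by simp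
next
  fix V g assume "(V, g) \<in> {(U \<times> points S, \<lambda>p. f (fst p)) | U f. (U, f) \<in> R} \<union>
      {(points R \<times> V, \<lambda>p. g (snd p)) | V g. (V, g) \<in> S}"
  then consider U f where "(U, f) \<in> R" "V = U \<times> points S" "g = (\<lambda>p. f (fst p))"
    | U f where "(U, f) \<in> S" "V = points R \<times> U" "g = (\<lambda>p. f (snd p))" by blast
  then show "({x \<in> points T. (\<phi> x, \<psi> x) \<in> V}, \<lambda>x. g (\<phi> x, \<psi> x)) \<in> T"
  proof cases
    case 1
    then have "{x \<in> points T. (\<phi> x, \<psi> x) \<in> V} = {x \<in> points T. \<phi> x \<in> U}"
      using morphism_points[OF assms(3)] by auto
    then show ?thesis using morphism_regular[OF assms(2) 1(1)] 1(3) by simp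
  next
    case 2
    then have "{x \<in> points T. (\<phi> x, \<psi> x) \<in> V} = {x \<in> points T. \<psi> x \<in> U}"
      using morphism_points[OF assms(2)] by auto
    then show ?thesis using morphism_regular[OF assms(3) 2(1)] 2(3) by simp
  qed
qed

text \<open>
  The classical topology, as a space with functions: a morphism from it is a continuous map, and
  such maps detect closures without any knowledge of the Zariski topology of the target.
\<close>

definition continuous_space :: "'a::t2_space set \<Rightarrow> 'a fspace" where
  "continuous_space D = {(U, f). open U \<and> U \<subseteq> D \<and> continuous_on U f}"

lemma points_continuous_space: "open D \<Longrightarrow> points (continuous_space D) = D"
  unfolding points_def continuous_space_def
  by (auto intro!: exI[of _ D] exI[of _ "\<lambda>_. 0"])

text \<open>Continuity is local and survives division where the denominator does not vanish, a set
  that is open as a preimage; the other rules are closure properties of continuous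
  functions.\<close>

lemma function_space_continuous_space:
  assumes "open D"
  shows "function_space (continuous_space D)"
proof -
  have "(U, f) \<in> continuous_space D" if "(U, f) \<in> generated D (continuous_space D)" for U f
    using that
  proof induction
    case (base U f)
    then show ?case using assms unfolding continuous_space_def
      by (auto intro: continuous_on_subset)
  next
    case (inverse U f)
    then have U: "open U" "continuous_on U f" "U \<subseteq> D" unfolding continuous_space_def by auto
    have "open (f -` (- {0}) \<inter> U)"
      using U continuous_on_open_vimage[OF U(1), of f] by blast
    moreover have "f -` (- {0}) \<inter> U = {x \<in> U. f x \<noteq> 0}" by auto
    ultimately show ?case using U unfolding continuous_space_def
      by (auto intro!: continuous_on_inverse intro: continuous_on_subset)
  next
    case (glue U f)
    have loc: "\<exists>V. x \<in> V \<and> V \<subseteq> U \<and> open V \<and> V \<subseteq> D \<and> continuous_on V f" if "x \<in> U" for x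
    proof -
      from glue[OF that] obtain V g where V: "x \<in> V" "V \<subseteq> U" "(V, g) \<in> continuous_space D"
        and eq: "\<forall>y\<in>V. f y = g y" by (elim exE conjE)
      from V(3) have *: "open V" "V \<subseteq> D" "continuous_on V g" unfolding continuous_space_def by auto
      have "continuous_on V f" using continuous_on_cong[of V V f g] eq *(3) by simp
      then show ?thesis using V * by blast
    qed
    have "open U" by (rule Topological_Spaces.openI) (use loc in blast)
    moreover have "isCont f x" if "x \<in> U" for x
      using loc[OF that] continuous_on_eq_continuous_at by blast
    moreover have "U \<subseteq> D" using loc by blast
    ultimately show ?case unfolding continuous_space_def
      by (auto intro: continuous_at_imp_continuous_on)
  qed (use assms in \<open>auto simp: continuous_space_def intro!: continuous_intros intro: continuous_on_subset\<close>)
  then show ?thesis using points_continuous_space[OF assms] unfolding function_space_def by auto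
qed

lemma continuous_space_regular: "open D \<Longrightarrow> continuous_on D f \<Longrightarrow> (D, f) \<in> continuous_space D"
  unfolding continuous_space_def by auto

lemma continuous_space_open: "open_in (continuous_space D) U \<Longrightarrow> open U"
  unfolding open_in_def continuous_space_def by auto

text \<open>Arcs have to be shortened so that some coordinate stays nonzero or the image stays in a
  chart.\<close>

lemma morphism_continuous_space_subset:
  assumes "morphism (continuous_space D) S \<phi>" "open D" "open D'" "D' \<subseteq> D"
  shows "morphism (continuous_space D') S \<phi>"
  unfolding morphism_def
proof (intro conjI; clarify?)
  fix x assume "x \<in> points (continuous_space D')"
  then show "\<phi> x \<in> points S" using assms morphism_points[OF assms(1)]
    by (auto simp: points_continuous_space)
next
  fix V g assume "(V, g) \<in> S"
  from morphism_regular[OF assms(1) this]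
  have "({x \<in> D. \<phi> x \<in> V}, \<lambda>x. g (\<phi> x)) \<in> continuous_space D"
    using assms by (simp add: points_continuous_space)
  moreover have "{x \<in> D'. \<phi> x \<in> V} = {x \<in> D. \<phi> x \<in> V} \<inter> D'" using assms by auto
  ultimately show "({x \<in> points (continuous_space D'). \<phi> x \<in> V}, \<lambda>x. g (\<phi> x)) \<in> continuous_space D'"
    using assms unfolding points_continuous_space[OF assms(3)] unfolding continuous_space_def
    by (auto intro: continuous_on_subset)
qed

section \<open>Projective space\<close>

lemma hclass_self: "v \<in> hclass v"
  unfolding hclass_def by (rule CollectI, rule exI[of _ 1]) auto

lemma hclass_scale: "k \<noteq> 0 \<Longrightarrow> hclass (\<lambda>i. k * v i) = hclass v"
  unfolding hclass_def
proof (intro set_eqI iffI; clarify)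
  fix c :: complex assume "k \<noteq> 0" "c \<noteq> 0"
  then show "\<exists>c'. (\<lambda>i. c * (k * v i)) = (\<lambda>i. c' * v i) \<and> c' \<noteq> 0"
    by (intro exI[of _ "c * k"]) (auto simp: mult.assoc)
next
  fix c :: complex assume "k \<noteq> 0" "c \<noteq> 0"
  then show "\<exists>c'. (\<lambda>i. c * v i) = (\<lambda>i. c' * (k * v i)) \<and> c' \<noteq> 0"
    by (intro exI[of _ "c / k"]) auto
qed

lemma hclass_eq_iff: "hclass v = hclass w \<longleftrightarrow> (\<exists>k. k \<noteq> 0 \<and> v = (\<lambda>i. k * w i))"
proof
  assume "hclass v = hclass w"
  then have "v \<in> hclass w" using hclass_self[of v] by simp
  then show "\<exists>k. k \<noteq> 0 \<and> v = (\<lambda>i. k * w i)" unfolding hclass_def by auto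
next
  assume "\<exists>k. k \<noteq> 0 \<and> v = (\<lambda>i. k * w i)"
  then show "hclass v = hclass w" using hclass_scale by auto
qed

lemma mem_hclassE:
  assumes "x \<in> hclass v"
  obtains c where "c \<noteq> 0" "x = (\<lambda>i. c * v i)"
  using assms unfolding hclass_def by blast

lemma hclass_in_proj_points:
  "(\<And>i. i > n \<Longrightarrow> v i = 0) \<Longrightarrow> v i \<noteq> 0 \<Longrightarrow> hclass v \<in> proj_points n"
  unfolding proj_points_def by blast

lemma proj_pointsE:
  assumes "p \<in> proj_points n"
  obtains v i where "p = hclass v" "\<And>i. i > n \<Longrightarrow> v i = 0" "i \<le> n" "v i \<noteq> 0"
proof -
  obtain v i where "p = hclass v" "\<forall>i>n. v i = 0" "v i \<noteq> 0"
    using assms unfolding proj_points_def by blast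
  then show ?thesis using that[of v i] by (meson not_le)
qed

lemma coord_ratio_hclass: "v j \<noteq> 0 \<Longrightarrow> coord_ratio i j (hclass v) = v i / v j"
  unfolding coord_ratio_def
  by (rule the_equality) (use hclass_self in \<open>auto elim!: mem_hclassE\<close>)

lemma hclass_coord_nonzero: "(\<forall>x\<in>hclass v. x j \<noteq> 0) \<longleftrightarrow> v j \<noteq> 0"
  using hclass_self[of v] by (metis mem_hclassE mult_eq_0_iff)

lemma function_space_proj_space: "function_space (proj_space n)"
  unfolding proj_space_def by (rule function_space_generated)

lemma points_proj_space: "points (proj_space n) = proj_points n"
  unfolding proj_space_def by (rule points_generated)

lemma coord_ratio_regular:
  assumes "i \<le> n" "j \<le> n"
  shows "({p \<in> proj_points n. \<forall>v\<in>p. v j \<noteq> 0}, coord_ratio i j) \<in> proj_space n"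
proof -
  have "({p. \<forall>v\<in>p. v j \<noteq> 0} \<inter> proj_points n, coord_ratio i j) \<in> proj_space n"
    unfolding proj_space_def by (rule generated.base) (use assms in blast)
  then show ?thesis by (simp add: Int_def conj_commute)
qed

lemma morphism_proj_spaceI:
  assumes "function_space R" "\<And>x. x \<in> points R \<Longrightarrow> \<phi> x \<in> proj_points n"
    and "\<And>i j. i \<le> n \<Longrightarrow> j \<le> n \<Longrightarrow>
      ({x \<in> points R. \<forall>v\<in>\<phi> x. v j \<noteq> 0}, \<lambda>x. coord_ratio i j (\<phi> x)) \<in> R"
  shows "morphism R (proj_space n) \<phi>"
  unfolding proj_space_def by (rule morphism_generated) (use assms in auto)

text \<open>On the chart \<open>j\<close> the ratio of coordinates pulls back to a quotient of two
  of the given functions, regular where its denominator does not vanish.\<close>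

lemma morphism_hclass:
  assumes R: "function_space R" and v: "\<And>i. i \<le> n \<Longrightarrow> (points R, \<lambda>x. v x i) \<in> R"
    and "\<And>x i. x \<in> points R \<Longrightarrow> i > n \<Longrightarrow> v x i = 0"
    and "\<And>x. x \<in> points R \<Longrightarrow> \<exists>i. v x i \<noteq> 0"
  shows "morphism R (proj_space n) (\<lambda>x. hclass (v x))"
proof (rule morphism_proj_spaceI[OF R])
  fix x assume "x \<in> points R"
  then show "hclass (v x) \<in> proj_points n" unfolding proj_points_def using assms by blast
next
  fix i j assume ij: "i \<le> n" "j \<le> n"
  let ?U = "{x \<in> points R. v x j \<noteq> 0}"
  have U: "open_in R ?U" using open_nonzero[OF R v[OF ij(2)]] .
  have "(?U, \<lambda>x. v x i / v x j) \<in> R"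
    by (rule regular_on_divide[OF R]) (use regular_restrict_subset[OF R v U] ij in auto)
  then have "(?U, \<lambda>x. coord_ratio i j (hclass (v x))) \<in> R"
    by (rule regular_cong[OF R]) (auto simp: coord_ratio_hclass)
  then show "({x \<in> points R. \<forall>v\<in>hclass (v x). v j \<noteq> 0}, \<lambda>x. coord_ratio i j (hclass (v x))) \<in> R"
    by (simp add: hclass_coord_nonzero)
qed

lemma morphism_local:
  assumes R: "function_space R"
    and loc: "\<And>x. x \<in> points R \<Longrightarrow> \<exists>W. x \<in> W \<and> open_in R W \<and> morphism (induced R W) S \<phi>"
  shows "morphism R S \<phi>"
  unfolding morphism_def
proof (intro conjI; clarify?)
  fix x assume "x \<in> points R"
  then obtain W where "x \<in> W" "morphism (induced R W) S \<phi>" using loc by blast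
  then show "\<phi> x \<in> points S" using morphism_points by (metis points_induced)
next
  fix V g assume Vg: "(V, g) \<in> S"
  show "({x \<in> points R. \<phi> x \<in> V}, \<lambda>x. g (\<phi> x)) \<in> R"
  proof (rule regular_glue[OF R])
    fix x assume x: "x \<in> {x \<in> points R. \<phi> x \<in> V}"
    then obtain W where W: "x \<in> W" "open_in R W" "morphism (induced R W) S \<phi>" using loc by blast
    have "({y \<in> W. \<phi> y \<in> V}, \<lambda>x. g (\<phi> x)) \<in> R"
      using regular_induced[OF R W(2) morphism_regular[OF W(3) Vg]] by (simp add: points_induced)
    then show "\<exists>U f. x \<in> U \<and> U \<subseteq> {x \<in> points R. \<phi> x \<in> V} \<and> (U, f) \<in> R \<and> (\<forall>y\<in>U. g (\<phi> y) = f y)"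
      using x W open_in_subset[OF R W(2)]
      by (intro exI[of _ "{y \<in> W. \<phi> y \<in> V}"] exI[of _ "\<lambda>x. g (\<phi> x)"]) auto
  qed
qed

lemma linear_form_hclass_nonzero:
  fixes n :: nat
  shows "(\<forall>x\<in>hclass v. (\<Sum>j\<le>n. b j * x j) \<noteq> 0) \<longleftrightarrow> (\<Sum>j\<le>n. b j * v j) \<noteq> 0"
proof
  assume v: "(\<Sum>j\<le>n. b j * v j) \<noteq> 0"
  show "\<forall>x\<in>hclass v. (\<Sum>j\<le>n. b j * x j) \<noteq> 0"
  proof
    fix x assume "x \<in> hclass v"
    then obtain c where "c \<noteq> 0" "x = (\<lambda>i. c * v i)" by (rule mem_hclassE)
    moreover have "(\<Sum>j\<le>n. b j * (c * v j)) = c * (\<Sum>j\<le>n. b j * v j)"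
      by (simp add: sum_distrib_left mult.left_commute)
    ultimately show "(\<Sum>j\<le>n. b j * x j) \<noteq> 0" using v by simp
  qed
qed (use hclass_self in blast)

text \<open>Near a point whose \<open>k\<close>-th coordinate is nonzero, the form divided by that
  coordinate is a regular function, and its zeros do not depend on the representative. The
  coefficients \<open>b j\<close> may vary with \<open>x\<close>, which is needed for conditions on
  a product whose coefficients come from the base.\<close>

lemma open_linear_form_nonzero:
  assumes R: "function_space R" and \<phi>: "morphism R (proj_space n) \<phi>"
    and b: "\<And>j. j \<le> n \<Longrightarrow> (W, b j) \<in> R"
  shows "open_in R {x \<in> W. \<forall>v\<in>\<phi> x. (\<Sum>j\<le>n. b j x * v j) \<noteq> 0}" (is "open_in R ?U")
proof (rule open_in_local[OF R])
  fix x assume x: "x \<in> ?U"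
  have W: "open_in R W" "W \<subseteq> points R" using b[of 0] regular_open[OF R] regular_subset[OF R] by blast+
  then have xR: "x \<in> points R" using x by auto
  then have "\<phi> x \<in> proj_points n" using morphism_points[OF \<phi>] by (simp add: points_proj_space)
  then obtain v k where v: "\<phi> x = hclass v" "k \<le> n" "v k \<noteq> 0" by (rule proj_pointsE) blast
  let ?O = "{y \<in> points R. \<phi> y \<in> {p \<in> proj_points n. \<forall>v\<in>p. v k \<noteq> 0}}"
  have reg: "(?O, \<lambda>y. coord_ratio j k (\<phi> y)) \<in> R" if "j \<le> n" for j
    using morphism_regular[OF \<phi> coord_ratio_regular[OF that v(2)]] .
  let ?V = "W \<inter> ?O"
  have V: "open_in R ?V" by (rule open_in_Int[OF R W(1)]) (use regular_open[OF R reg[of 0]] in blast)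
  have "(?V, \<lambda>y. b j y * coord_ratio j k (\<phi> y)) \<in> R" if "j \<le> n" for j
    by (rule regular_mult[OF R b[OF that] reg[OF that]])
  then have "(?V, \<lambda>y. \<Sum>j\<le>n. b j y * coord_ratio j k (\<phi> y)) \<in> R"
    by (intro regular_on_sum[OF R V]) auto
  from open_nonzero[OF R this]
  have "open_in R {y \<in> ?V. (\<Sum>j\<le>n. b j y * coord_ratio j k (\<phi> y)) \<noteq> 0}" .
  moreover have "(\<Sum>j\<le>n. b j y * coord_ratio j k (\<phi> y)) \<noteq> 0 \<longleftrightarrow> (\<forall>v\<in>\<phi> y. (\<Sum>j\<le>n. b j y * v j) \<noteq> 0)"
    if y: "y \<in> ?V" for y
  proof -
    obtain u where u: "\<phi> y = hclass u" using y unfolding proj_points_def by blast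
    then have uk: "u k \<noteq> 0" using y hclass_coord_nonzero[of u k] by auto
    have "(\<Sum>j\<le>n. b j y * coord_ratio j k (\<phi> y)) = (\<Sum>j\<le>n. b j y * u j) / u k"
      by (simp add: u coord_ratio_hclass[where v = u, OF uk] sum_divide_distrib)
    then show ?thesis
      using uk linear_form_hclass_nonzero[where v = u and n = n and b = "\<lambda>j. b j y"] by (simp add: u)
  qed
  then have "{y \<in> ?V. (\<Sum>j\<le>n. b j y * coord_ratio j k (\<phi> y)) \<noteq> 0} = ?U \<inter> ?O" using W(2) by blast
  moreover have "x \<in> ?O" using x v xR \<open>\<phi> x \<in> proj_points n\<close> hclass_coord_nonzero[of v k] by auto
  ultimately show "\<exists>V. x \<in> V \<and> V \<subseteq> ?U \<and> open_in R V" using x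
    by (intro exI[of _ "?U \<inter> ?O"]) auto
qed

lemma hclass_eqI:
  assumes "\<And>i j. v i * w j = v j * w i" "v k \<noteq> 0" "w l \<noteq> 0"
  shows "hclass v = hclass w"
proof -
  have wk: "w k \<noteq> 0"
    using assms(1)[of k l] assms(2,3) by auto
  have "v = (\<lambda>i. (v k / w k) * w i)"
    using assms(1)[of _ k] wk by (auto simp: field_simps)
  then show ?thesis using assms(2) wk by (metis hclass_eq_iff divide_eq_0_iff)
qed

text \<open>This is the separatedness of projective space: where two points differ, some 2 by 2
  minor of their coordinates is nonzero, and for known \<open>w\<close> this minor is a linear form
  in the coordinates of \<open>\<phi> x\<close>.\<close>

lemma open_differs_from_hclass:
  assumes R: "function_space R" and \<phi>: "morphism R (proj_space n) \<phi>"
    and w: "\<And>i. i \<le> n \<Longrightarrow> (W, \<lambda>x. w x i) \<in> R"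
    and w0: "\<And>x i. x \<in> W \<Longrightarrow> i > n \<Longrightarrow> w x i = 0" "\<And>x. x \<in> W \<Longrightarrow> \<exists>i. w x i \<noteq> 0"
  shows "open_in R {x \<in> W. \<phi> x \<noteq> hclass (w x)}"
proof (rule open_in_local[OF R])
  fix x assume x: "x \<in> {x \<in> W. \<phi> x \<noteq> hclass (w x)}"
  have W: "open_in R W" "W \<subseteq> points R" using w[of 0] regular_open[OF R] regular_subset[OF R] by blast+
  then have "\<phi> x \<in> proj_points n" using x morphism_points[OF \<phi>] by (auto simp: points_proj_space)
  then obtain v k where v: "\<phi> x = hclass v" "\<And>i. i > n \<Longrightarrow> v i = 0" "k \<le> n" "v k \<noteq> 0"
    by (rule proj_pointsE) blast
  obtain i j where ij: "v i * w x j \<noteq> v j * w x i"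
    using hclass_eqI[of v "w x" k] v x w0(2)[of x] by (metis (mono_tags, lifting) mem_Collect_eq)
  have "i \<le> n" "j \<le> n" using ij v(2) w0(1)[of x] x by (metis (mono_tags) mem_Collect_eq mult_zero_left mult_zero_right not_le)+
  \<comment> \<open>Coefficients of the minor with indices \<open>i\<close> and \<open>j\<close>, as
    a linear form in the other vector.\<close>
  define b where "b l y = (if l = i then w y j else 0) - (if l = j then w y i else 0)" for l y
  have sum: "(\<Sum>l\<le>n. b l y * u l) = w y j * u i - w y i * u j" for y u
    using \<open>i \<le> n\<close> \<open>j \<le> n\<close>
    by (simp add: b_def left_diff_distrib sum_subtractf if_distrib[of "\<lambda>a. a * _"] cong: if_cong)
  have b: "(W, b l) \<in> R" for l
    unfolding b_def using w[OF \<open>i \<le> n\<close>] w[OF \<open>j \<le> n\<close>]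
    by (cases "l = i"; cases "l = j") (auto intro: regular_on_diff[OF R] regular_on_const[OF R W(1)] regular_on_uminus[OF R])
  let ?V = "{y \<in> W. \<forall>u\<in>\<phi> y. (\<Sum>l\<le>n. b l y * u l) \<noteq> 0}"
  have "open_in R ?V" by (rule open_linear_form_nonzero[OF R \<phi> b])
  moreover have "(\<Sum>l\<le>n. b l x * v l) \<noteq> 0" unfolding sum using ij by (simp add: mult.commute)
  then have "x \<in> ?V"
    using x linear_form_hclass_nonzero[where v = v and n = n and b = "\<lambda>l. b l x"]
    by (simp add: v(1))
  moreover have "?V \<subseteq> {x \<in> W. \<phi> x \<noteq> hclass (w x)}"
  proof safe
    fix y assume "y \<in> W" and ne: "\<forall>u\<in>\<phi> y. (\<Sum>l\<le>n. b l y * u l) \<noteq> 0" and "\<phi> y = hclass (w y)"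
    then have "(\<Sum>l\<le>n. b l y * w y l) \<noteq> 0" using hclass_self[of "w y"] by simp
    then show False unfolding sum by simp
  qed
  ultimately show "\<exists>V. x \<in> V \<and> V \<subseteq> {x \<in> W. \<phi> x \<noteq> hclass (w x)} \<and> open_in R V"
    by (intro exI conjI)
qed

section \<open>Linear maps between projective spaces\<close>

definition linear_map :: "nat \<Rightarrow> nat \<Rightarrow> (nat \<Rightarrow> nat \<Rightarrow> complex) \<Rightarrow> (nat \<Rightarrow> complex) \<Rightarrow> nat \<Rightarrow> complex" where
  "linear_map m n A v = (\<lambda>i. if i \<le> n then \<Sum>j\<le>m. A i j * v j else 0)"

lemma linear_map_scale: "linear_map m n A (\<lambda>i. c * v i) = (\<lambda>i. c * linear_map m n A v i)"
  unfolding linear_map_def by (auto simp: sum_distrib_left mult.left_commute)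

lemma linear_map_hclass: "linear_map m n A ` hclass v = hclass (linear_map m n A v)"
  unfolding hclass_def by (force simp: linear_map_scale)

text \<open>Restricting to a set \<open>S\<close> that avoids the kernel of the matrix admits
  projections from a point. A point of projective space has no global coordinate vector, so the map
  has to be written chart by chart.\<close>

lemma morphism_linear_map:
  assumes S: "S \<subseteq> proj_points m" "\<And>v. hclass v \<in> S \<Longrightarrow> \<exists>i. linear_map m n A v i \<noteq> 0"
  shows "morphism (induced (proj_space m) S) (proj_space n) (\<lambda>p. linear_map m n A ` p)"
proof (rule morphism_local[OF function_space_induced])
  let ?R = "induced (proj_space m) S"
  fix p assume "p \<in> points ?R"
  then have p: "p \<in> S" by (simp add: points_induced)
  then obtain v k where v: "p = hclass v" "k \<le> m" "v k \<noteq> 0" using S by (auto elim!: proj_pointsE)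
  let ?W = "{p \<in> S. \<forall>v\<in>p. v k \<noteq> 0}"
  let ?R' = "induced ?R ?W"
  have WS: "?W = {p \<in> proj_points m. \<forall>v\<in>p. v k \<noteq> 0} \<inter> S" using S by auto
  have reg: "(?W, coord_ratio i k) \<in> ?R" if "i \<le> m" for i
    unfolding WS by (rule induced_regular[OF coord_ratio_regular[OF that v(2)]])
  have W: "open_in ?R ?W" by (rule regular_open[OF function_space_induced reg[of 0]]) simp
  have reg': "(?W, coord_ratio i k) \<in> ?R'" if "i \<le> m" for i
    using induced_regular[OF reg[OF that], of ?W] by simp
  \<comment> \<open>The image of the representative whose \<open>k\<close>-th coordinate is 1; its
    entries are regular on the chart.\<close>
  define u where "u = (\<lambda>q. linear_map m n A (\<lambda>i. if i \<le> m then coord_ratio i k q else 0))"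
  have u: "linear_map m n A ` q = hclass (u q)" "\<exists>i. u q i \<noteq> 0" if q: "q \<in> ?W" for q
  proof -
    from q S obtain x where x: "q = hclass x" "\<And>i. i > m \<Longrightarrow> x i = 0" by (auto elim!: proj_pointsE)
    then have xk: "x k \<noteq> 0" using q hclass_coord_nonzero[of x k] by auto
    have "(\<lambda>i. if i \<le> m then coord_ratio i k q else 0) = (\<lambda>i. (1 / x k) * x i)"
      using x by (auto simp: coord_ratio_hclass[where v = x, OF xk])
    then have uq: "u q = (\<lambda>i. (1 / x k) * linear_map m n A x i)"
      unfolding u_def by (simp only: linear_map_scale)
    then show "linear_map m n A ` q = hclass (u q)"
      using xk hclass_scale[of "1 / x k"] by (simp add: x(1) linear_map_hclass)
    obtain i where "linear_map m n A x i \<noteq> 0" using S(2)[of x] q x(1) by auto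
    then show "\<exists>i. u q i \<noteq> 0" using xk by (intro exI[of _ i]) (simp add: uq)
  qed
  have "morphism ?R' (proj_space n) (\<lambda>q. hclass (u q))"
  proof (rule morphism_hclass[OF function_space_induced])
    fix i assume "i \<le> n"
    then have "(\<lambda>q. u q i) = (\<lambda>q. \<Sum>j\<le>m. A i j * coord_ratio j k q)"
      unfolding u_def linear_map_def by auto
    moreover have "(?W, \<lambda>q. \<Sum>j\<le>m. A i j * coord_ratio j k q) \<in> ?R'"
    proof (rule regular_on_sum[OF function_space_induced])
      show "open_in ?R' ?W" using regular_open[OF function_space_induced reg'[of 0]] by simp
      then show "(?W, \<lambda>q. A i j * coord_ratio j k q) \<in> ?R'" if "j \<in> {..m}" for j
        using that by (intro regular_on_mult[OF function_space_induced] regular_on_const[OF function_space_induced] reg') auto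
    qed
    ultimately show "(points ?R', \<lambda>q. u q i) \<in> ?R'" by (simp add: points_induced)
  qed (use u in \<open>auto simp: points_induced u_def linear_map_def\<close>)
  then have "morphism ?R' (proj_space n) (\<lambda>q. linear_map m n A ` q)"
    by (rule morphism_cong[OF function_space_induced]) (use u in \<open>auto simp: points_induced\<close>)
  moreover have "p \<in> ?W" using p v hclass_coord_nonzero[of v k] by auto
  ultimately show "\<exists>W. p \<in> W \<and> open_in ?R W \<and> morphism (induced ?R W) (proj_space n) (\<lambda>p. linear_map m n A ` p)"
    using W by (intro exI[of _ ?W]) simp
qed

section \<open>Blow-ups\<close>

lemma inv_into_isomorphism:
  assumes "isomorphism R S \<psi>"
  shows "morphism S R (inv_into (points R) \<psi>)"
    "x \<in> points R \<Longrightarrow> inv_into (points R) \<psi> (\<psi> x) = x"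
    "y \<in> points S \<Longrightarrow> \<psi> (inv_into (points R) \<psi> y) = y"
  using assms unfolding isomorphism_def
  by (auto simp: bij_betw_inv_into_left bij_betw_inv_into_right)

lemma points_graph_closure:
  "points (graph_closure R Z U n f) =
    closure_in (product (induced R U) (proj_space n))
      {(x, hclass (\<lambda>i. if i \<le> n then f i x else 0)) | x. x \<in> U - Z}"
  unfolding graph_closure_def by (simp add: Let_def points_induced)

lemma closure_in_subset_points: "closure_in R A \<subseteq> points R"
  unfolding closure_in_def by blast

lemma ideal_generatorsD:
  assumes "ideal_generators R Z U n f" "(V, g) \<in> R" "\<And>z. z \<in> V \<inter> Z \<Longrightarrow> g z = 0" "x \<in> V \<inter> U"
  shows "\<exists>W a. x \<in> W \<and> W \<subseteq> V \<inter> U \<and> (\<forall>i\<le>n. (W, a i) \<in> R) \<and>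
    (\<forall>y\<in>W. g y = (\<Sum>i\<le>n. a i y * f i y))"
proof -
  have "\<forall>V g x. (V, g) \<in> R \<and> (\<forall>z \<in> V \<inter> Z. g z = 0) \<and> x \<in> V \<inter> U \<longrightarrow>
        (\<exists>W a. x \<in> W \<and> W \<subseteq> V \<inter> U \<and> (\<forall>i\<le>n. (W, a i) \<in> R) \<and>
           (\<forall>y\<in>W. g y = (\<Sum>i\<le>n. a i y * f i y)))"
    using assms(1) unfolding ideal_generators_def by (elim conjE)
  from this[rule_format, of V g x] assms(2-4) show ?thesis by simp
qed

lemma blow_upD:
  assumes "blow_up B \<beta> R Z" "x \<in> points R"
  shows "\<exists>U n f \<psi>. x \<in> U \<and> ideal_generators R Z U n f \<and>
    isomorphism (induced B {b \<in> points B. \<beta> b \<in> U}) (graph_closure R Z U n f) \<psi> \<and>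
    (\<forall>b \<in> points B. \<beta> b \<in> U \<longrightarrow> fst (\<psi> b) = \<beta> b)"
  using assms(1) unfolding blow_up_def by (elim conjE) (erule bspec[OF _ assms(2)])

text \<open>On \<open>N\<close> the constant 1 vanishes on the centre vacuously, so near
  \<open>x\<close> it is a combination of the generators, which thus cannot all vanish at
  \<open>x\<close>.\<close>

lemma ideal_generators_nonzero:
  assumes R: "function_space R" and N: "open_in R N" "N \<inter> Z = {}"
    and I: "ideal_generators R Z U n f" and x: "x \<in> U \<inter> N"
  shows "\<exists>i\<le>n. f i x \<noteq> 0"
proof (rule ccontr)
  assume *: "\<not> ?thesis"
  have "\<exists>W a. x \<in> W \<and> W \<subseteq> N \<inter> U \<and> (\<forall>i\<le>n. (W, a i) \<in> R) \<and>
      (\<forall>y\<in>W. 1 = (\<Sum>i\<le>n. a i y * f i y))"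
    by (rule ideal_generatorsD[OF I regular_on_const[OF R N(1)]]) (use N(2) x in auto)
  then obtain W a where "x \<in> W" "\<forall>y\<in>W. 1 = (\<Sum>i\<le>n. a i y * f i y)" by (elim exE conjE)
  then have "1 = (\<Sum>i\<le>n. a i x * f i x)" by simp
  also have "\<dots> = 0" by (rule sum.neutral) (use * in auto)
  finally show False by simp
qed

text \<open>Where the generators have no common zero, their graph is already closed, so that the
  local model is a copy of the base. The isomorphism is expressed by a section \<open>s\<close> that
  is inverse to \<open>\<beta>\<close> on both sides over \<open>V\<close>.\<close>

lemma blow_up_off_centre:
  assumes bu: "blow_up B \<beta> R Z" and R: "function_space R"
    and N: "open_in R N" "N \<inter> Z = {}" "x \<in> N"
  obtains V s where "open_in R V" "x \<in> V" "V \<subseteq> N" "morphism (induced R V) B s"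
    "\<And>y. y \<in> V \<Longrightarrow> \<beta> (s y) = y" "\<And>b. b \<in> points B \<Longrightarrow> \<beta> b \<in> V \<Longrightarrow> s (\<beta> b) = b"
proof -
  obtain U n f \<psi> where U: "x \<in> U" "ideal_generators R Z U n f"
    and iso: "isomorphism (induced B {b \<in> points B. \<beta> b \<in> U}) (graph_closure R Z U n f) \<psi>"
    and fst: "\<forall>b \<in> points B. \<beta> b \<in> U \<longrightarrow> fst (\<psi> b) = \<beta> b"
    using blow_upD[OF bu subsetD[OF open_in_subset[OF R N(1)] N(3)]] by (elim exE conjE)
  let ?B = "{b \<in> points B. \<beta> b \<in> U}"
  let ?G = "graph_closure R Z U n f"
  let ?P = "product (induced R U) (proj_space n)"
  define F where "F = (\<lambda>y i. if i \<le> n then f i y else 0)"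
  define \<Gamma> where "\<Gamma> = {(x, hclass (F x)) | x. x \<in> U - Z}"
  have Uo: "open_in R U" and fU: "\<And>i. i \<le> n \<Longrightarrow> (U, f i) \<in> R"
    using U(2) unfolding ideal_generators_def by auto
  define V where "V = U \<inter> N"
  have V: "open_in R V" "x \<in> V" "V \<subseteq> U" "V \<subseteq> points R"
    unfolding V_def using open_in_Int[OF R Uo N(1)] U(1) N(3) open_in_subset[OF R N(1)] by auto
  have F0: "\<exists>i. F y i \<noteq> 0" if "y \<in> V" for y
    using ideal_generators_nonzero[OF R N(1,2) U(2), of y] that unfolding F_def V_def by auto
  have pG: "points ?G = closure_in ?P \<Gamma>"
    unfolding points_graph_closure \<Gamma>_def F_def ..
  have pP: "points ?P = U \<times> proj_points n"
    by (simp add: points_product points_induced points_proj_space)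
  have gpt: "(y, hclass (F y)) \<in> U \<times> proj_points n" if "y \<in> V" for y
    using F0[OF that] V that by (auto simp: F_def proj_points_def)
  have \<Gamma>G: "(y, hclass (F y)) \<in> points ?G" if "y \<in> V" for y
    using gpt[OF that] that N(2) unfolding pG closure_in_def pP \<Gamma>_def V_def by auto
  have RV: "function_space (induced R V)" by (rule function_space_induced)
  have "morphism (induced R V) (induced R U) (\<lambda>y. y)"
    by (rule morphism_into_induced[OF RV morphism_inclusion]) (use V in \<open>auto simp: points_induced\<close>)
  moreover have "morphism (induced R V) (proj_space n) (\<lambda>y. hclass (F y))"
  proof (rule morphism_hclass[OF RV])
    fix i assume "i \<le> n"
    have "U \<inter> V = V" "(\<lambda>x. F x i) = f i" using V \<open>i \<le> n\<close> by (auto simp: F_def)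
    then show "(points (induced R V), \<lambda>x. F x i) \<in> induced R V"
      using induced_regular[OF fU[OF \<open>i \<le> n\<close>], of V] by (simp add: points_induced)
  qed (use F0 in \<open>auto simp: points_induced F_def\<close>)
  ultimately have "morphism (induced R V) ?P (\<lambda>y. (y, hclass (F y)))"
    by (rule morphism_Pair[OF RV])
  then have graph: "morphism (induced R V) ?G (\<lambda>y. (y, hclass (F y)))"
    unfolding graph_closure_def Let_def
    by (rule morphism_into_induced[OF RV])
      (use \<Gamma>G in \<open>simp add: points_induced pG \<Gamma>_def F_def\<close>)
  define s where "s = (\<lambda>y. inv_into ?B \<psi> (y, hclass (F y)))"
  have inv: "morphism ?G (induced B ?B) (inv_into ?B \<psi>)"
    "\<And>b. b \<in> ?B \<Longrightarrow> inv_into ?B \<psi> (\<psi> b) = b" "\<And>z. z \<in> points ?G \<Longrightarrow> \<psi> (inv_into ?B \<psi> z) = z"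
    using inv_into_isomorphism[OF iso] by (auto simp: points_induced)
  have sm: "morphism (induced R V) (induced B ?B) s"
    unfolding s_def using morphism_comp[OF graph inv(1)] .
  show ?thesis
  proof
    show "open_in R V" "x \<in> V" "V \<subseteq> N" using V unfolding V_def by auto
    show "morphism (induced R V) B s"
      using morphism_comp[OF sm morphism_inclusion] by auto
    show "\<beta> (s y) = y" if y: "y \<in> V" for y
    proof -
      have "s y \<in> ?B" using morphism_points[OF sm] y by (simp add: points_induced)
      moreover have "\<psi> (s y) = (y, hclass (F y))" unfolding s_def by (rule inv(3)[OF \<Gamma>G[OF y]])
      ultimately show ?thesis using fst by (metis (no_types, lifting) fst_conv mem_Collect_eq)
    qed
    show "s (\<beta> b) = b" if b: "b \<in> points B" "\<beta> b \<in> V" for b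
    proof -
      have bB: "b \<in> ?B" using b V by auto
      have "\<psi> b \<in> points ?G"
        using iso bB unfolding isomorphism_def by (auto simp: points_induced dest: bij_betwE)
      moreover have "fst (\<psi> b) = \<beta> b" using fst bB by auto
      ultimately obtain p where p: "\<psi> b = (\<beta> b, p)" "(\<beta> b, p) \<in> closure_in ?P \<Gamma>"
        unfolding pG by (metis prod.collapse)
      have "p = hclass (F (\<beta> b))"
      proof (rule ccontr)
        assume ne: "p \<noteq> hclass (F (\<beta> b))"
        let ?W = "{z \<in> points ?P. fst z \<in> V}"
        have VU: "(V, f i) \<in> induced R U" if "i \<le> n" for i
          using induced_regular[OF regular_restrict_subset[OF R fU[OF that] V(1,3)], of U] V
          by (simp add: Int_absorb2)
        \<comment> \<open>The points over \<open>V\<close> that are off the graph form an open set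
          which misses the graph, hence contains no point of its closure.\<close>
        have "open_in ?P {z \<in> ?W. snd z \<noteq> hclass (F (fst z))}"
        proof (rule open_differs_from_hclass[OF function_space_product morphism_product_snd])
          fix i assume "i \<le> n"
          then show "(?W, \<lambda>z. F (fst z) i) \<in> ?P"
            using morphism_regular[OF morphism_product_fst[where S = "proj_space n"] VU[OF \<open>i \<le> n\<close>]]
            by (simp add: F_def)
        qed (use F0 in \<open>auto simp: F_def\<close>)
        moreover have "(\<beta> b, p) \<in> {z \<in> ?W. snd z \<noteq> hclass (F (fst z))}"
          using p(2) b ne closure_in_subset_points by fastforce
        ultimately have "{z \<in> ?W. snd z \<noteq> hclass (F (fst z))} \<inter> \<Gamma> \<noteq> {}"
          using p(2) unfolding closure_in_def by blast
        then show False unfolding \<Gamma>_def by auto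
      qed
      then have "s (\<beta> b) = inv_into ?B \<psi> (\<psi> b)" unfolding s_def by (simp add: p(1))
      then show ?thesis using inv(2)[OF bB] by simp
    qed
  qed
qed

text \<open>
  Hadamard's lemma: relative to a retraction \<open>\<sigma>\<close>, the functions of the form
  \<open>f \<circ> \<sigma> + g0 * c + g1 * d\<close> near the fixed points of \<open>\<sigma>\<close> are closed under all operations that
  generate regular functions, so it suffices to recognize coordinate functions as being of this form.
\<close>

definition hadamard_space ::
    "'a fspace \<Rightarrow> ('a \<Rightarrow> 'a) \<Rightarrow> ('a \<Rightarrow> complex) \<Rightarrow> ('a \<Rightarrow> complex) \<Rightarrow> 'a fspace" where
  "hadamard_space R \<sigma> g0 g1 = {(U, f). (U, f) \<in> R \<and> (\<forall>x\<in>U. \<sigma> x = x \<longrightarrow>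
     (\<exists>W c d. x \<in> W \<and> W \<subseteq> U \<and> (\<forall>y\<in>W. \<sigma> y \<in> U) \<and> (W, c) \<in> R \<and> (W, d) \<in> R \<and>
        (\<forall>y\<in>W. f y = f (\<sigma> y) + g0 y * c y + g1 y * d y)))}"

lemma hadamard_spaceI:
  assumes "(U, f) \<in> R"
    and "\<And>x. x \<in> U \<Longrightarrow> \<sigma> x = x \<Longrightarrow> 
      \<exists>W c d. x \<in> W \<and> W \<subseteq> U \<and> (\<forall>y\<in>W. \<sigma> y \<in> U) \<and> (W, c) \<in> R \<and> (W, d) \<in> R \<and>
        (\<forall>y\<in>W. f y = f (\<sigma> y) + g0 y * c y + g1 y * d y)"
  shows "(U, f) \<in> hadamard_space R \<sigma> g0 g1"
  using assms unfolding hadamard_space_def by simp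

lemma hadamard_spaceD:
  assumes "(U, f) \<in> hadamard_space R \<sigma> g0 g1"
  shows "(U, f) \<in> R"
    and "x \<in> U \<Longrightarrow> \<sigma> x = x \<Longrightarrow>
      \<exists>W c d. x \<in> W \<and> W \<subseteq> U \<and> (\<forall>y\<in>W. \<sigma> y \<in> U) \<and> (W, c) \<in> R \<and> (W, d) \<in> R \<and>
        (\<forall>y\<in>W. f y = f (\<sigma> y) + g0 y * c y + g1 y * d y)"
  using assms unfolding hadamard_space_def by simp_all

section \<open>Closure of the Hadamard decomposition under the generation rules\<close>

context
  fixes R :: "'a fspace" and \<sigma> :: "'a \<Rightarrow> 'a" and g0 g1 :: "'a \<Rightarrow> complex"
  assumes R: "function_space R" and \<sigma>: "morphism R R \<sigma>"
begin

lemma hadamard_const: "(points R, \<lambda>_. k) \<in> hadamard_space R \<sigma> g0 g1"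
proof (rule hadamard_spaceI[OF regular_const[OF R]])
  fix x assume "x \<in> points R"
  then show "\<exists>W c d. x \<in> W \<and> W \<subseteq> points R \<and> (\<forall>y\<in>W. \<sigma> y \<in> points R) \<and> (W, c) \<in> R \<and> (W, d) \<in> R \<and>
      (\<forall>y\<in>W. k = k + g0 y * c y + g1 y * d y)"
    by (intro exI[of _ "points R"] exI[of _ "\<lambda>_. 0"])
      (use morphism_points[OF \<sigma>] regular_const[OF R] in auto)
qed

lemma points_hadamard_space: "points (hadamard_space R \<sigma> g0 g1) = points R"
  using hadamard_const regular_subset[OF R] hadamard_spaceD(1)
  unfolding points_def by fastforce

lemma hadamard_add:
  assumes "(U, f) \<in> hadamard_space R \<sigma> g0 g1" "(V, g) \<in> hadamard_space R \<sigma> g0 g1"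
  shows "(U \<inter> V, \<lambda>x. f x + g x) \<in> hadamard_space R \<sigma> g0 g1"
proof (rule hadamard_spaceI)
  note regular = assms[THEN hadamard_spaceD(1)]
  show "(U \<inter> V, \<lambda>x. f x + g x) \<in> R" by (rule regular_add[OF R regular])
  fix x assume x: "x \<in> U \<inter> V" "\<sigma> x = x"
  from x hadamard_spaceD(2)[OF assms(1), of x] obtain W1 c1 d1 where 1: "x \<in> W1" "W1 \<subseteq> U"
    "\<forall>y\<in>W1. \<sigma> y \<in> U" "(W1, c1) \<in> R" "(W1, d1) \<in> R"
    "\<forall>y\<in>W1. f y = f (\<sigma> y) + g0 y * c1 y + g1 y * d1 y" by auto
  from x hadamard_spaceD(2)[OF assms(2), of x] obtain W2 c2 d2 where 2: "x \<in> W2" "W2 \<subseteq> V"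
    "\<forall>y\<in>W2. \<sigma> y \<in> V" "(W2, c2) \<in> R" "(W2, d2) \<in> R"
    "\<forall>y\<in>W2. g y = g (\<sigma> y) + g0 y * c2 y + g1 y * d2 y" by auto
  show "\<exists>W c d. x \<in> W \<and> W \<subseteq> U \<inter> V \<and> (\<forall>y\<in>W. \<sigma> y \<in> U \<inter> V) \<and> (W, c) \<in> R \<and> (W, d) \<in> R \<and>
      (\<forall>y\<in>W. f y + g y = f (\<sigma> y) + g (\<sigma> y) + g0 y * c y + g1 y * d y)"
  proof (intro exI conjI)
    show "(W1 \<inter> W2, \<lambda>y. c1 y + c2 y) \<in> R" "(W1 \<inter> W2, \<lambda>y. d1 y + d2 y) \<in> R"
      using regular_add[OF R 1(4) 2(4)] regular_add[OF R 1(5) 2(5)] .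
    show "\<forall>y\<in>W1 \<inter> W2. f y + g y
        = f (\<sigma> y) + g (\<sigma> y) + g0 y * (c1 y + c2 y) + g1 y * (d1 y + d2 y)"
    proof
      fix y assume y: "y \<in> W1 \<inter> W2"
      show "f y + g y = f (\<sigma> y) + g (\<sigma> y) + g0 y * (c1 y + c2 y) + g1 y * (d1 y + d2 y)"
        using 1(6)[rule_format, of y] 2(6)[rule_format, of y] y by (simp add: algebra_simps)
    qed
  qed (use 1 2 in auto)
qed

text \<open>With a bar for composition with \<sigma>, the difference of fg and its bar is f times
  the difference for g, plus the bar of g times the difference for f.\<close>

lemma hadamard_mult:
  assumes "(U, f) \<in> hadamard_space R \<sigma> g0 g1" "(V, g) \<in> hadamard_space R \<sigma> g0 g1"
  shows "(U \<inter> V, \<lambda>x. f x * g x) \<in> hadamard_space R \<sigma> g0 g1"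
proof (rule hadamard_spaceI)
  note regular = assms[THEN hadamard_spaceD(1)]
  show "(U \<inter> V, \<lambda>x. f x * g x) \<in> R" by (rule regular_mult[OF R regular])
  fix x assume x: "x \<in> U \<inter> V" "\<sigma> x = x"
  from x hadamard_spaceD(2)[OF assms(1), of x] obtain W1 c1 d1 where 1: "x \<in> W1" "W1 \<subseteq> U"
    "\<forall>y\<in>W1. \<sigma> y \<in> U" "(W1, c1) \<in> R" "(W1, d1) \<in> R"
    "\<forall>y\<in>W1. f y = f (\<sigma> y) + g0 y * c1 y + g1 y * d1 y" by auto
  from x hadamard_spaceD(2)[OF assms(2), of x] obtain W2 c2 d2 where 2: "x \<in> W2" "W2 \<subseteq> V"
    "\<forall>y\<in>W2. \<sigma> y \<in> V" "(W2, c2) \<in> R" "(W2, d2) \<in> R"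
    "\<forall>y\<in>W2. g y = g (\<sigma> y) + g0 y * c2 y + g1 y * d2 y" by auto
  let ?W = "W1 \<inter> W2"
  have W: "open_in R ?W"
    using open_in_Int[OF R regular_open[OF R 1(4)] regular_open[OF R 2(4)]] .
  note restrict = regular_restrict_subset[OF R _ W]
  have f: "(?W, f) \<in> R" using restrict[OF regular(1)] 1(2) by blast
  have g\<sigma>: "(?W, \<lambda>y. g (\<sigma> y)) \<in> R"
    using restrict[OF morphism_regular[OF \<sigma> regular(2)]] 2(3) open_in_subset[OF R W] by blast
  note c = restrict[OF 1(4)] restrict[OF 2(4)] and d = restrict[OF 1(5)] restrict[OF 2(5)]
  show "\<exists>W c d. x \<in> W \<and> W \<subseteq> U \<inter> V \<and> (\<forall>y\<in>W. \<sigma> y \<in> U \<inter> V) \<and> (W, c) \<in> R \<and> (W, d) \<in> R \<and>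
      (\<forall>y\<in>W. f y * g y = f (\<sigma> y) * g (\<sigma> y) + g0 y * c y + g1 y * d y)"
  proof (intro exI conjI)
    show "(?W, \<lambda>y. f y * c2 y + g (\<sigma> y) * c1 y) \<in> R"
      by (rule regular_on_add[OF R regular_on_mult[OF R f c(2)] regular_on_mult[OF R g\<sigma> c(1)]]) auto
    show "(?W, \<lambda>y. f y * d2 y + g (\<sigma> y) * d1 y) \<in> R"
      by (rule regular_on_add[OF R regular_on_mult[OF R f d(2)] regular_on_mult[OF R g\<sigma> d(1)]]) auto
    show "\<forall>y\<in>?W. f y * g y = f (\<sigma> y) * g (\<sigma> y)
        + g0 y * (f y * c2 y + g (\<sigma> y) * c1 y) + g1 y * (f y * d2 y + g (\<sigma> y) * d1 y)"
    proof
      fix y assume "y \<in> ?W"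
      then have e: "f y = f (\<sigma> y) + g0 y * c1 y + g1 y * d1 y" "g y = g (\<sigma> y) + g0 y * c2 y + g1 y * d2 y"
        using 1(6) 2(6) by auto
      have "f (\<sigma> y) * g (\<sigma> y) + g0 y * (f y * c2 y + g (\<sigma> y) * c1 y) + g1 y * (f y * d2 y + g (\<sigma> y) * d1 y)
          = f y * (g0 y * c2 y + g1 y * d2 y) + g (\<sigma> y) * (f (\<sigma> y) + g0 y * c1 y + g1 y * d1 y)"
        by (simp add: algebra_simps)
      also have "\<dots> = f y * (g (\<sigma> y) + g0 y * c2 y + g1 y * d2 y)"
        unfolding e(1)[symmetric] by (simp add: algebra_simps)
      finally show "f y * g y = f (\<sigma> y) * g (\<sigma> y)
          + g0 y * (f y * c2 y + g (\<sigma> y) * c1 y) + g1 y * (f y * d2 y + g (\<sigma> y) * d1 y)"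
        unfolding e(2)[symmetric] by simp
    qed
  qed (use 1 2 in auto)
qed

text \<open>The difference of the reciprocals is minus the difference for \<open>f\<close> divided
  by the product of \<open>f\<close> and \<open>f\<close> after \<sigma>. The neighbourhood is
  shrunk until this product has no zeros; at the fixed point \<open>x\<close> it is the square of
  \<open>f x\<close>.\<close>

lemma hadamard_inverse:
  assumes "(U, f) \<in> hadamard_space R \<sigma> g0 g1"
  shows "({x \<in> U. f x \<noteq> 0}, \<lambda>x. inverse (f x)) \<in> hadamard_space R \<sigma> g0 g1"
proof (rule hadamard_spaceI)
  note f = hadamard_spaceD(1)[OF assms]
  show "({x \<in> U. f x \<noteq> 0}, \<lambda>x. inverse (f x)) \<in> R" by (rule regular_inverse[OF R f])
  fix x assume x: "x \<in> {x \<in> U. f x \<noteq> 0}" "\<sigma> x = x"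
  from x hadamard_spaceD(2)[OF assms, of x] obtain W1 c d where 1: "x \<in> W1" "W1 \<subseteq> U"
    "\<forall>y\<in>W1. \<sigma> y \<in> U" "(W1, c) \<in> R" "(W1, d) \<in> R"
    "\<forall>y\<in>W1. f y = f (\<sigma> y) + g0 y * c y + g1 y * d y" by auto
  have W1: "open_in R W1" by (rule regular_open[OF R 1(4)])
  have f1: "(W1, f) \<in> R" by (rule regular_restrict_subset[OF R f W1 1(2)])
  have f\<sigma>1: "(W1, \<lambda>y. f (\<sigma> y)) \<in> R"
    by (rule regular_restrict_subset[OF R morphism_regular[OF \<sigma> f] W1])
      (use 1(3) open_in_subset[OF R W1] in blast)
  have h1: "(W1, \<lambda>y. f y * f (\<sigma> y)) \<in> R" by (rule regular_on_mult[OF R f1 f\<sigma>1])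
  let ?W = "{y \<in> W1. f y * f (\<sigma> y) \<noteq> 0}"
  have W: "open_in R ?W" by (rule open_nonzero[OF R h1])
  have "(?W, \<lambda>y. - c y / (f y * f (\<sigma> y))) \<in> R" "(?W, \<lambda>y. - d y / (f y * f (\<sigma> y))) \<in> R"
    by (rule regular_on_divide[OF R regular_on_uminus[OF R regular_restrict_subset[OF R 1(4) W]]
        regular_restrict_subset[OF R h1 W]]; auto)
      (rule regular_on_divide[OF R regular_on_uminus[OF R regular_restrict_subset[OF R 1(5) W]]
        regular_restrict_subset[OF R h1 W]]; auto)
  moreover have "inverse (f y) = inverse (f (\<sigma> y)) + g0 y * (- c y / (f y * f (\<sigma> y)))
        + g1 y * (- d y / (f y * f (\<sigma> y)))" if y: "y \<in> ?W" for y
  proof -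
    have e: "g0 y * c y + g1 y * d y = f y - f (\<sigma> y)" using 1(6)[rule_format, of y] y by simp
    have "g0 y * (- c y / (f y * f (\<sigma> y))) + g1 y * (- d y / (f y * f (\<sigma> y)))
        = - (g0 y * c y + g1 y * d y) / (f y * f (\<sigma> y))"
      by (simp add: add_divide_distrib diff_divide_distrib)
    also have "\<dots> = inverse (f y) - inverse (f (\<sigma> y))"
      unfolding e using y by (simp add: field_simps)
    finally show ?thesis by (simp add: algebra_simps)
  qed
  ultimately show "\<exists>W c d. x \<in> W \<and> W \<subseteq> {x \<in> U. f x \<noteq> 0} \<and> (\<forall>y\<in>W. \<sigma> y \<in> {x \<in> U. f x \<noteq> 0}) \<and>
      (W, c) \<in> R \<and> (W, d) \<in> R \<and>
      (\<forall>y\<in>W. inverse (f y) = inverse (f (\<sigma> y)) + g0 y * c y + g1 y * d y)"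
    using x 1(1-3) by (intro exI[of _ ?W] exI[of _ "\<lambda>y. - c y / (f y * f (\<sigma> y))"]
        exI[of _ "\<lambda>y. - d y / (f y * f (\<sigma> y))"]) auto
qed

lemma function_space_hadamard_space: "function_space (hadamard_space R \<sigma> g0 g1)"
proof -
  let ?H = "hadamard_space R \<sigma> g0 g1"
  have "(U, f) \<in> ?H" if "(U, f) \<in> generated (points R) ?H" for U f
    using that
  proof induction
    case (base U f)
    moreover have "U \<inter> points R = U"
      using regular_subset[OF R hadamard_spaceD(1)[OF base]] by blast
    ultimately show ?case by simp
  next
    case (glue U f)
    have loc: "\<exists>V g. x \<in> V \<and> V \<subseteq> U \<and> (V, g) \<in> ?H \<and> (\<forall>y\<in>V. f y = g y)" if x: "x \<in> U" for x
      using glue[OF x] by (elim exE conjE) (intro exI conjI)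
    show ?case
    proof (rule hadamard_spaceI)
      show "(U, f) \<in> R"
      proof (rule regular_glue[OF R])
        fix x assume "x \<in> U"
        from loc[OF this] show "\<exists>V g. x \<in> V \<and> V \<subseteq> U \<and> (V, g) \<in> R \<and> (\<forall>y\<in>V. f y = g y)"
          by (elim exE conjE) (intro exI conjI, assumption, assumption, erule hadamard_spaceD(1))
      qed
      fix x assume x: "x \<in> U" "\<sigma> x = x"
      from loc[OF x(1)] obtain V g where V: "x \<in> V" "V \<subseteq> U" "(V, g) \<in> ?H"
        and eq: "\<forall>y\<in>V. f y = g y" by (elim exE conjE)
      from hadamard_spaceD(2)[OF V(3,1) x(2)] obtain W c d where W: "x \<in> W" "W \<subseteq> V"
        "\<forall>y\<in>W. \<sigma> y \<in> V" "(W, c) \<in> R" "(W, d) \<in> R"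
        "\<forall>y\<in>W. g y = g (\<sigma> y) + g0 y * c y + g1 y * d y" by auto
      have "\<forall>y\<in>W. f y = f (\<sigma> y) + g0 y * c y + g1 y * d y"
      proof
        fix y assume "y \<in> W"
        \<comment> \<open>The decomposition involves the value at \<open>\<sigma> y\<close> too, and
          the local representative \<open>g\<close> is known to agree with \<open>f\<close> there
          because \<open>\<sigma>\<close> maps \<open>W\<close> into \<open>V\<close>.\<close>
        then have "f y = g y" "f (\<sigma> y) = g (\<sigma> y)" using eq W(2,3) by blast+
        then show "f y = f (\<sigma> y) + g0 y * c y + g1 y * d y" using W(6) \<open>y \<in> W\<close> by simp
      qed
      then show "\<exists>W c d. x \<in> W \<and> W \<subseteq> U \<and> (\<forall>y\<in>W. \<sigma> y \<in> U) \<and> (W, c) \<in> R \<and> (W, d) \<in> R \<and>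
          (\<forall>y\<in>W. f y = f (\<sigma> y) + g0 y * c y + g1 y * d y)"
        using W V(2) by (intro exI[of _ W] exI[of _ c] exI[of _ d]) auto
    qed
  qed (simp_all add: hadamard_const hadamard_add hadamard_mult hadamard_inverse)
  then show ?thesis unfolding function_space_def points_hadamard_space by auto
qed

end

text \<open>Supplies parameters near 0 that avoid 0 and the finitely many values at which an arc is
  degenerate.\<close>

lemma open_avoid_finite:
  fixes x :: "'a::{perfect_space, t1_space}"
  assumes "open U" "x \<in> U" "finite F"
  obtains y where "y \<in> U" "y \<notin> F" "y \<noteq> x"
proof -
  have "open (U - (F - {x}))" using assms by (intro open_Diff finite_imp_closed) auto
  then have "U - (F - {x}) \<noteq> {x}" using not_open_singleton by metis
  moreover have "x \<in> U - (F - {x})" using assms by auto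
  ultimately obtain y where "y \<in> U - (F - {x})" "y \<noteq> x" by blast
  then show ?thesis using that by blast
qed

section \<open>Fibres of a blow-up in two equations\<close>

definition vec2 :: "complex \<Rightarrow> complex \<Rightarrow> nat \<Rightarrow> complex" where
  "vec2 a b = (\<lambda>i. if i = 0 then a else if i = 1 then b else 0)"

lemma proj_points_1E:
  assumes "p \<in> proj_points 1"
  obtains a b where "p = hclass (vec2 a b)" "a \<noteq> 0 \<or> b \<noteq> 0"
proof -
  obtain v i where v: "p = hclass v" "\<And>i. i > 1 \<Longrightarrow> v i = 0" "i \<le> 1" "v i \<noteq> 0"
    using assms by (rule proj_pointsE) blast
  have "v = vec2 (v 0) (v 1)"
    unfolding vec2_def using v(2) by (auto simp: fun_eq_iff)
  moreover have "v 0 \<noteq> 0 \<or> v 1 \<noteq> 0" using v(3,4) by (cases i) auto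
  ultimately show ?thesis using that v(1) by metis
qed

lemma hclass_vec2_in: "a \<noteq> 0 \<or> b \<noteq> 0 \<Longrightarrow> hclass (vec2 a b) \<in> proj_points 1"
  unfolding proj_points_def by (rule CollectI, rule exI[of _ "vec2 a b"]) (auto simp: vec2_def)

definition is_arc ::
    "'a fspace \<Rightarrow> 'a set \<Rightarrow> ('a \<Rightarrow> complex) \<Rightarrow> ('a \<Rightarrow> complex) \<Rightarrow> 'a \<Rightarrow> complex \<Rightarrow> complex
      \<Rightarrow> complex set \<Rightarrow> (complex \<Rightarrow> 'a) \<Rightarrow> bool" where
  "is_arc R N g0 g1 x0 a b D \<gamma> \<longleftrightarrow> open D \<and> 0 \<in> D \<and> morphism (continuous_space D) R \<gamma> \<and> \<gamma> 0 = x0 \<and>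
     (\<forall>t\<in>D. \<gamma> t \<in> N \<and> g0 (\<gamma> t) = t * (a + t) \<and> g1 (\<gamma> t) = t * (b + t))"

lemma sum_atMost_1: "(\<Sum>j\<le>1::nat. f j) = f 0 + f 1"
  by simp

text \<open>
  Arcs through \<open>x0\<close> along which \<open>g0 = t * (a + t)\<close> and \<open>g1 = t * (b + t)\<close> replace the regularity
  of the sequence \<open>g0, g1\<close>: they reach every point \<open>[a : b]\<close> of the exceptional line, while
  \<open>g0\<close> and \<open>g1\<close> do not vanish on them near \<open>x0\<close>, even if \<open>a = 0\<close> or \<open>b = 0\<close>.
\<close>

lemma blow_up_codim2_fibre:
  fixes R :: "'a fspace" and B :: "'b fspace"
  assumes bu: "blow_up B \<beta> R Z" and R: "function_space R"
    and g0: "(N, g0) \<in> R" and g1: "(N, g1) \<in> R" and x0: "x0 \<in> N"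
    and Z: "\<And>x. x \<in> N \<Longrightarrow> x \<in> Z \<longleftrightarrow> g0 x = 0 \<and> g1 x = 0"
    and ideal: "\<And>U f. (U, f) \<in> R \<Longrightarrow> x0 \<in> U \<Longrightarrow> (\<And>z. z \<in> U \<inter> Z \<Longrightarrow> f z = 0) \<Longrightarrow>
      \<exists>W c d. x0 \<in> W \<and> W \<subseteq> U \<and> (W, c) \<in> R \<and> (W, d) \<in> R \<and> (\<forall>y\<in>W. f y = g0 y * c y + g1 y * d y)"
    and arcs: "\<And>a b. \<exists>D \<gamma>. is_arc R N g0 g1 x0 a b D \<gamma>"
  shows "\<exists>e. morphism (proj_space 1) B e \<and> {b \<in> points B. \<beta> b = x0} = e ` proj_points 1 \<and>
    (\<forall>a b D \<gamma>. (a \<noteq> 0 \<or> b \<noteq> 0) \<and> is_arc R N g0 g1 x0 a b D \<gamma> \<longrightarrow>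
      (\<exists>D' \<Gamma>. open D' \<and> 0 \<in> D' \<and> D' \<subseteq> D \<and> morphism (continuous_space D') B \<Gamma> \<and>
        (\<forall>t\<in>D'. \<beta> (\<Gamma> t) = \<gamma> t) \<and> \<Gamma> 0 = e (hclass (vec2 a b))))"
proof -
  have N: "open_in R N" by (rule regular_open[OF R g0])
  have x0R: "x0 \<in> points R" using x0 open_in_subset[OF R N] by blast
  obtain U n f \<psi> where U: "x0 \<in> U" "ideal_generators R Z U n f"
    and iso: "isomorphism (induced B {b \<in> points B. \<beta> b \<in> U}) (graph_closure R Z U n f) \<psi>"
    and fst: "\<forall>b \<in> points B. \<beta> b \<in> U \<longrightarrow> fst (\<psi> b) = \<beta> b"
    using blow_upD[OF bu x0R] by (elim exE conjE)
  let ?B = "{b \<in> points B. \<beta> b \<in> U}"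
  let ?G = "graph_closure R Z U n f"
  let ?P = "product (induced R U) (proj_space n)"
  define F where "F = (\<lambda>y i. if i \<le> n then f i y else 0)"
  define \<Delta> where "\<Delta> = {(x, hclass (F x)) | x. x \<in> U - Z}"
  have Uo: "open_in R U" and fU: "\<And>i. i \<le> n \<Longrightarrow> (U, f i) \<in> R" and fZ: "\<And>i z. i \<le> n \<Longrightarrow> z \<in> U \<inter> Z \<Longrightarrow> f i z = 0"
    using U(2) unfolding ideal_generators_def by auto
  have pG: "points ?G = closure_in ?P \<Delta>"
    unfolding points_graph_closure \<Delta>_def F_def ..
  have pP: "points ?P = U \<times> proj_points n"
    by (simp add: points_product points_induced points_proj_space)
  have fP: "function_space ?P" by (rule function_space_product)

  \<comment> \<open>The unknown generators \<open>f i\<close> and the two given equations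
    \<open>g0\<close>, \<open>g1\<close> are expressed through each other near \<open>x0\<close>;
    the fibre is read off from the coefficient matrices of both expressions at
    \<open>x0\<close>.\<close>
  have "\<forall>i. \<exists>W c d. i \<le> n \<longrightarrow> x0 \<in> W \<and> W \<subseteq> U \<and> (W, c) \<in> R \<and> (W, d) \<in> R \<and>
      (\<forall>y\<in>W. f i y = g0 y * c y + g1 y * d y)"
  proof
    fix i
    show "\<exists>W c d. i \<le> n \<longrightarrow> x0 \<in> W \<and> W \<subseteq> U \<and> (W, c) \<in> R \<and> (W, d) \<in> R \<and>
      (\<forall>y\<in>W. f i y = g0 y * c y + g1 y * d y)"
    proof (cases "i \<le> n")
      case True
      show ?thesis using ideal[OF fU[OF True] U(1) fZ[OF True]] True by simp
    qed simp
  qed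
  then obtain Wf c d where "\<forall>i. i \<le> n \<longrightarrow> x0 \<in> Wf i \<and> Wf i \<subseteq> U \<and> (Wf i, c i) \<in> R \<and> (Wf i, d i) \<in> R \<and>
      (\<forall>y\<in>Wf i. f i y = g0 y * c i y + g1 y * d i y)"
    unfolding choice_iff by (elim exE)
  then have cd: "x0 \<in> Wf i \<and> Wf i \<subseteq> U \<and> (Wf i, c i) \<in> R \<and> (Wf i, d i) \<in> R \<and>
      (\<forall>y\<in>Wf i. f i y = g0 y * c i y + g1 y * d i y)" if "i \<le> n" for i
    using that by simp
  have "\<exists>W a. x0 \<in> W \<and> W \<subseteq> N \<inter> U \<and> (\<forall>i\<le>n. (W, a i) \<in> R) \<and> (\<forall>y\<in>W. g0 y = (\<Sum>i\<le>n. a i y * f i y))"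
    by (rule ideal_generatorsD[OF U(2) g0]) (use Z x0 U(1) in auto)
  then obtain W0 a0 where W0: "x0 \<in> W0" "W0 \<subseteq> N \<inter> U" "\<forall>i\<le>n. (W0, a0 i) \<in> R"
    "\<forall>y\<in>W0. g0 y = (\<Sum>i\<le>n. a0 i y * f i y)" by (elim exE conjE)
  have "\<exists>W a. x0 \<in> W \<and> W \<subseteq> N \<inter> U \<and> (\<forall>i\<le>n. (W, a i) \<in> R) \<and> (\<forall>y\<in>W. g1 y = (\<Sum>i\<le>n. a i y * f i y))"
    by (rule ideal_generatorsD[OF U(2) g1]) (use Z x0 U(1) in auto)
  then obtain W1 a1 where W1: "x0 \<in> W1" "W1 \<subseteq> N \<inter> U" "\<forall>i\<le>n. (W1, a1 i) \<in> R"
    "\<forall>y\<in>W1. g1 y = (\<Sum>i\<le>n. a1 i y * f i y)" by (elim exE conjE)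
  define W where "W = W0 \<inter> W1 \<inter> (points R \<inter> (\<Inter>i\<in>{..n}. Wf i))"
  have W: "open_in R W"
    unfolding W_def
  proof (rule open_in_Int[OF R open_in_Int[OF R] open_in_INT[OF R]])
    show "open_in R W0" using W0(3) regular_open[OF R, of W0 "a0 0"] by simp
    show "open_in R W1" using W1(3) regular_open[OF R, of W1 "a1 0"] by simp
    show "open_in R (Wf i)" if "i \<in> {..n}" for i
      using cd[of i] that regular_open[OF R, of "Wf i" "c i"] by simp
  qed simp
  have x0W: "x0 \<in> W" unfolding W_def using W0(1) W1(1) x0R cd by auto
  have WU: "W \<subseteq> U" "W \<subseteq> N" unfolding W_def using W0(2) by auto
  have WW: "W \<subseteq> W0" "W \<subseteq> W1" "\<And>i. i \<le> n \<Longrightarrow> W \<subseteq> Wf i" unfolding W_def by auto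
  note restrict = regular_restrict_subset[OF R _ W]
  have reg: "(W, c i) \<in> R" "(W, d i) \<in> R" "(W, a0 i) \<in> R" "(W, a1 i) \<in> R" if "i \<le> n" for i
  proof -
    show "(W, c i) \<in> R" by (rule restrict[OF _ WW(3)[OF that]]) (use cd[OF that] in simp)
    show "(W, d i) \<in> R" by (rule restrict[OF _ WW(3)[OF that]]) (use cd[OF that] in simp)
    show "(W, a0 i) \<in> R" by (rule restrict[OF _ WW(1)]) (use W0(3) that in simp)
    show "(W, a1 i) \<in> R" by (rule restrict[OF _ WW(2)]) (use W1(3) that in simp)
  qed
  have f_eq: "f i y = g0 y * c i y + g1 y * d i y" if "y \<in> W" "i \<le> n" for i y
    using cd[OF that(2)] WW(3)[OF that(2)] that(1) by blast
  have g0_eq: "g0 y = (\<Sum>i\<le>n. a0 i y * f i y)" and g1_eq: "g1 y = (\<Sum>i\<le>n. a1 i y * f i y)" if "y \<in> W" for y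
    using W0(4) W1(4) WW(1,2) that by blast+
  \<comment> \<open>The four functions \<open>S a0 c\<close>, \<open>S a0 d\<close>,
    \<open>S a1 c\<close>, \<open>S a1 d\<close> are the entries of the product of the two
    coefficient matrices, a 2 by 2 matrix that fixes the vector of \<open>g0\<close> and
    \<open>g1\<close>.\<close>
  define S where "S = (\<lambda>a c (y::'a). \<Sum>i\<le>n. a i y * c i y :: complex)"
  have Sreg: "(W, S a b) \<in> R" if "\<And>i. i \<le> n \<Longrightarrow> (W, a i) \<in> R" "\<And>i. i \<le> n \<Longrightarrow> (W, b i) \<in> R" for a b
    unfolding S_def by (rule regular_on_sum[OF R W]) (use regular_on_mult[OF R] that in auto)
  have gS: "g0 y = g0 y * S a0 c y + g1 y * S a0 d y" "g1 y = g0 y * S a1 c y + g1 y * S a1 d y"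
    if "y \<in> W" for y
  proof -
    have *: "(\<Sum>i\<le>n. a i y * f i y) = g0 y * S a c y + g1 y * S a d y" for a
      unfolding S_def sum_distrib_left sum.distrib[symmetric]
      by (rule sum.cong) (simp_all add: f_eq that algebra_simps)
    show "g0 y = g0 y * S a0 c y + g1 y * S a0 d y" using g0_eq[OF that] * by simp
    show "g1 y = g0 y * S a1 c y + g1 y * S a1 d y" using g1_eq[OF that] * by simp
  qed

  \<comment> \<open>At \<open>x0\<close> the product matrix is the identity: along the arc with
    direction \<open>a\<close>, \<open>b\<close> the common factor \<open>t\<close> cancels for
    \<open>t \<noteq> 0\<close>, and continuity at 0 shows that the vector with entries
    \<open>a\<close> and \<open>b\<close> is fixed. This is where the independence of the two
    equations enters.\<close>
  have left_inverse: "a = a * S a0 c x0 + b * S a0 d x0 \<and> b = a * S a1 c x0 + b * S a1 d x0" for a b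
  proof -
    obtain D \<gamma> where arc: "is_arc R N g0 g1 x0 a b D \<gamma>" using arcs by blast
    then have D: "open D" "0 \<in> D" "morphism (continuous_space D) R \<gamma>" "\<gamma> 0 = x0"
      "\<And>t. t \<in> D \<Longrightarrow> g0 (\<gamma> t) = t * (a + t) \<and> g1 (\<gamma> t) = t * (b + t)"
      unfolding is_arc_def by auto
    have fs: "function_space (continuous_space D)" by (rule function_space_continuous_space[OF D(1)])
    let ?D = "{t \<in> D. \<gamma> t \<in> W}"
    have rg: "(?D, \<lambda>t. h (\<gamma> t)) \<in> continuous_space D" if "(W, h) \<in> R" for h
      using morphism_regular[OF D(3) that] by (simp add: points_continuous_space[OF D(1)])
    have oD: "open_in (continuous_space D) ?D" using regular_open[OF fs rg[OF reg(1)[of 0]]] by simp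
    have tD: "(?D, \<lambda>t. k + t) \<in> continuous_space D" for k
      using continuous_space_open[OF oD] unfolding continuous_space_def by (auto intro!: continuous_intros)
    have van: "k 0 = 0" if "(?D, k) \<in> continuous_space D" "\<And>t. t \<in> ?D \<Longrightarrow> t \<noteq> 0 \<Longrightarrow> k t = 0" for k
    proof (rule ccontr)
      assume "k 0 \<noteq> 0"
      have "open {t \<in> ?D. k t \<noteq> 0}" using continuous_space_open[OF open_nonzero[OF fs that(1)]] .
      moreover have "0 \<in> {t \<in> ?D. k t \<noteq> 0}" using D(2,4) x0W \<open>k 0 \<noteq> 0\<close> by simp
      ultimately obtain t where "t \<in> {t \<in> ?D. k t \<noteq> 0}" "t \<noteq> 0"
        using open_avoid_finite[of "{t \<in> ?D. k t \<noteq> 0}" 0 "{}"] by auto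
      then show False using that(2) by blast
    qed
    have key: "k = a * S r c x0 + b * S r d x0"
      if r: "\<And>i. i \<le> n \<Longrightarrow> (W, r i) \<in> R"
        and eq: "\<And>t. t \<in> ?D \<Longrightarrow> t * (k + t) = t * (a + t) * S r c (\<gamma> t) + t * (b + t) * S r d (\<gamma> t)" for r k
    proof -
      let ?k = "\<lambda>t. (k + t) - ((a + t) * S r c (\<gamma> t) + (b + t) * S r d (\<gamma> t))"
      have "(?D, ?k) \<in> continuous_space D"
        by (rule regular_on_diff[OF fs tD regular_on_add[OF fs regular_on_mult[OF fs tD rg[OF Sreg[OF r reg(1)]]]
            regular_on_mult[OF fs tD rg[OF Sreg[OF r reg(2)]]]]])
      moreover have "?k t = 0" if "t \<in> ?D" "t \<noteq> 0" for t
      proof -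
        have "t * ?k t = 0" using eq[OF that(1)] by (simp add: algebra_simps)
        then show ?thesis using that(2) by simp
      qed
      ultimately have "?k 0 = 0" by (rule van)
      then show ?thesis using D(4) by simp
    qed
    show ?thesis
    proof
      have "t * (a + t) = t * (a + t) * S a0 c (\<gamma> t) + t * (b + t) * S a0 d (\<gamma> t)" if "t \<in> ?D" for t
        using gS(1)[of "\<gamma> t"] D(5)[of t] that by simp
      then show "a = a * S a0 c x0 + b * S a0 d x0" by (rule key[rotated]) (assumption, rule reg)
      have "t * (b + t) = t * (a + t) * S a1 c (\<gamma> t) + t * (b + t) * S a1 d (\<gamma> t)" if "t \<in> ?D" for t
        using gS(2)[of "\<gamma> t"] D(5)[of t] that by simp
      then show "b = a * S a1 c x0 + b * S a1 d x0" by (rule key[rotated]) (assumption, rule reg)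
    qed
  qed

  \<comment> \<open>The matrix of the inclusion of the exceptional line into the local model; its
    injectivity follows from the left inverse just found.\<close>
  define A where "A = (\<lambda>i (j::nat). if j = 0 then c i x0 else d i x0)"
  have A: "linear_map 1 n A (vec2 a b) = (\<lambda>i. if i \<le> n then a * c i x0 + b * d i x0 else 0)" for a b
    unfolding linear_map_def sum_atMost_1 A_def vec2_def by (auto simp: mult.commute)
  have A_nonzero: "\<exists>i\<le>n. linear_map 1 n A (vec2 a b) i \<noteq> 0" if "a \<noteq> 0 \<or> b \<noteq> 0" for a b
  proof (rule ccontr)
    assume "\<not> ?thesis"
    then have zero: "a * c i x0 + b * d i x0 = 0" if "i \<le> n" for i
      using that unfolding A by auto
    have "a * S r c x0 + b * S r d x0 = 0" for r
    proof -
      have "a * S r c x0 + b * S r d x0 = (\<Sum>i\<le>n. r i x0 * (a * c i x0 + b * d i x0))"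
        unfolding S_def sum_distrib_left sum.distrib[symmetric]
        by (rule sum.cong) (simp_all add: algebra_simps)
      then show ?thesis using zero by simp
    qed
    then show False using left_inverse[of a b] that by metis
  qed

  have lift: "\<exists>D' \<Gamma>. open D' \<and> 0 \<in> D' \<and> D' \<subseteq> D \<and> morphism (continuous_space D') ?G \<Gamma> \<and>
      (\<forall>t\<in>D'. fst (\<Gamma> t) = \<gamma> t) \<and> \<Gamma> 0 = (x0, hclass (linear_map 1 n A (vec2 a b)))"
    if ab: "a \<noteq> 0 \<or> b \<noteq> 0" and arc: "is_arc R N g0 g1 x0 a b D \<gamma>" for a b D \<gamma>
  proof -
    from arc have D: "open D" "0 \<in> D" "morphism (continuous_space D) R \<gamma>" "\<gamma> 0 = x0"
      "\<And>t. t \<in> D \<Longrightarrow> \<gamma> t \<in> N \<and> g0 (\<gamma> t) = t * (a + t) \<and> g1 (\<gamma> t) = t * (b + t)"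
      unfolding is_arc_def by auto
    have fs: "function_space (continuous_space D)" by (rule function_space_continuous_space[OF D(1)])
    \<comment> \<open>The vector of the generators along the arc divided by \<open>t\<close>. It is
      continuous and nonzero at \<open>t = 0\<close>, so its class extends the lift of the arc
      across the centre.\<close>
    define u where "u = (\<lambda>t i. if i \<le> n then (a + t) * c i (\<gamma> t) + (b + t) * d i (\<gamma> t) else 0)"
    have u0: "u 0 = linear_map 1 n A (vec2 a b)" unfolding u_def A D(4) by (simp cong: if_cong)
    obtain i0 where i0: "i0 \<le> n" "u 0 i0 \<noteq> 0" using A_nonzero[OF ab] u0 by auto
    let ?D = "{t \<in> D. \<gamma> t \<in> W}"
    have rg: "(?D, \<lambda>t. h (\<gamma> t)) \<in> continuous_space D" if "(W, h) \<in> R" for h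
      using morphism_regular[OF D(3) that] by (simp add: points_continuous_space[OF D(1)])
    have oD: "open_in (continuous_space D) ?D" using regular_open[OF fs rg[OF reg(1)[of 0]]] by simp
    have tD: "(?D, \<lambda>t. k + t) \<in> continuous_space D" for k
      using continuous_space_open[OF oD] unfolding continuous_space_def by (auto intro!: continuous_intros)
    have ureg: "(?D, \<lambda>t. u t i) \<in> continuous_space D" if "i \<le> n" for i
      unfolding u_def using that
        regular_on_add[OF fs regular_on_mult[OF fs tD rg[OF reg(1)[OF that]]]
          regular_on_mult[OF fs tD rg[OF reg(2)[OF that]]], of a b] by simp
    define D' where "D' = {t \<in> ?D. u t i0 \<noteq> 0}"
    have oD': "open D'" unfolding D'_def using continuous_space_open[OF open_nonzero[OF fs ureg[OF i0(1)]]] .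
    have D': "D' \<subseteq> D" "0 \<in> D'" unfolding D'_def using D(2,4) x0W i0 by auto
    let ?C = "continuous_space D'"
    have fs': "function_space ?C" by (rule function_space_continuous_space[OF oD'])
    have pC: "points ?C = D'" by (rule points_continuous_space[OF oD'])
    have \<gamma>D': "\<gamma> t \<in> W" if "t \<in> D'" for t using that unfolding D'_def by simp
    have "morphism ?C (induced R U) \<gamma>"
      by (rule morphism_into_induced[OF fs' morphism_continuous_space_subset[OF D(3,1) oD' D'(1)]])
        (use \<gamma>D' WU pC in blast)
    moreover have "morphism ?C (proj_space n) (\<lambda>t. hclass (u t))"
    proof (rule morphism_hclass[OF fs'])
      fix i assume "i \<le> n"
      from ureg[OF this] have "continuous_on ?D (\<lambda>t. u t i)" unfolding continuous_space_def by simp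
      then have "continuous_on D' (\<lambda>t. u t i)"
        by (rule continuous_on_subset) (auto simp: D'_def)
      then show "(points ?C, \<lambda>t. u t i) \<in> ?C"
        unfolding pC by (rule continuous_space_regular[OF oD'])
    next
      fix t assume "t \<in> points ?C"
      then have "t \<in> D'" unfolding pC .
      then show "\<exists>i. u t i \<noteq> 0" unfolding D'_def by auto
    qed (simp add: u_def)
    ultimately have \<Gamma>: "morphism ?C ?P (\<lambda>t. (\<gamma> t, hclass (u t)))" by (rule morphism_Pair[OF fs'])
    have off: "(\<gamma> t, hclass (u t)) \<in> \<Delta>" if t: "t \<in> D'" "t \<noteq> 0" for t
    proof -
      have g: "g0 (\<gamma> t) = t * (a + t)" "g1 (\<gamma> t) = t * (b + t)" using D(5) t D' by auto
      \<comment> \<open>Apart from \<open>t = 0\<close> the arc can meet the centre only if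
        \<open>t = - a = - b\<close>, and there \<open>u\<close> vanishes, which \<open>D'\<close>
        excludes.\<close>
      have "\<gamma> t \<notin> Z"
      proof
        assume "\<gamma> t \<in> Z"
        then have "a + t = 0" "b + t = 0" using Z[of "\<gamma> t"] D(5)[of t] g t D'(1) by auto
        then have "u t i0 = 0" unfolding u_def by simp
        then show False using t unfolding D'_def by simp
      qed
      moreover have "F (\<gamma> t) = (\<lambda>i. t * u t i)"
        unfolding F_def u_def using f_eq[OF \<gamma>D'[OF t(1)]] g by (auto simp: algebra_simps)
      then have "hclass (F (\<gamma> t)) = hclass (u t)" using hclass_scale[OF t(2)] by simp
      ultimately show ?thesis unfolding \<Delta>_def using \<gamma>D'[OF t(1)] WU by auto
    qed
    \<comment> \<open>A Zariski neighbourhood of the lifted point pulls back to an open set of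
      parameters, which contains some parameter other than 0, where the lift lies on the
      graph.\<close>
    have cl: "(\<gamma> t, hclass (u t)) \<in> closure_in ?P \<Delta>" if t: "t \<in> D'" for t
      unfolding closure_in_def
    proof (intro CollectI conjI allI impI)
      show "(\<gamma> t, hclass (u t)) \<in> points ?P" using morphism_points[OF \<Gamma>] t pC by simp
      fix O' assume O': "open_in ?P O' \<and> (\<gamma> t, hclass (u t)) \<in> O'"
      have "open {s \<in> points ?C. (\<gamma> s, hclass (u s)) \<in> O'}"
        using continuous_space_open[OF morphism_open[OF \<Gamma>]] O' by blast
      moreover have "t \<in> {s \<in> points ?C. (\<gamma> s, hclass (u s)) \<in> O'}" using t pC O' by simp
      ultimately obtain s where "s \<in> {s \<in> points ?C. (\<gamma> s, hclass (u s)) \<in> O'}" "s \<notin> {0}"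
        by (rule open_avoid_finite[where F = "{0}"]) auto
      then show "O' \<inter> \<Delta> \<noteq> {}" using off pC by auto
    qed
    have "morphism ?C ?G (\<lambda>t. (\<gamma> t, hclass (u t)))"
      unfolding graph_closure_def Let_def
      by (rule morphism_into_induced[OF fs' \<Gamma>])
        (use cl in \<open>simp add: pC \<Delta>_def F_def\<close>)
    then show ?thesis
      using oD' D' D(4) u0
      by (intro exI[of _ D'] exI[of _ "\<lambda>t. (\<gamma> t, hclass (u t))"]) simp
  qed

  have in_G: "(x0, hclass (linear_map 1 n A (vec2 a b))) \<in> points ?G" if "a \<noteq> 0 \<or> b \<noteq> 0" for a b
  proof -
    obtain D \<gamma> where "is_arc R N g0 g1 x0 a b D \<gamma>" using arcs by blast
    from lift[OF that this] obtain D' \<Gamma> where "open D'" "0 \<in> D'" "D' \<subseteq> D"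
      "morphism (continuous_space D') ?G \<Gamma>" "\<forall>t\<in>D'. fst (\<Gamma> t) = \<gamma> t"
      "\<Gamma> 0 = (x0, hclass (linear_map 1 n A (vec2 a b)))" by (elim exE conjE)
    then show ?thesis using morphism_points[of "continuous_space D'" ?G \<Gamma> 0]
      by (simp add: points_continuous_space)
  qed

  have from_G: "\<exists>a b. (a \<noteq> 0 \<or> b \<noteq> 0) \<and> p = hclass (linear_map 1 n A (vec2 a b))"
    if p: "(x0, p) \<in> points ?G" for p
  proof -
    have "p \<in> proj_points n" using p closure_in_subset_points unfolding pG pP[symmetric] by (metis mem_Sigma_iff pP subsetD)
    then obtain v k where v: "p = hclass v" "\<And>i. i > n \<Longrightarrow> v i = 0" "k \<le> n" "v k \<noteq> 0"
      by (rule proj_pointsE) blast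
    \<comment> \<open>On the graph, with the generators themselves as the vector \<open>v\<close>,
      these two sums are \<open>g0\<close> and \<open>g1\<close>, so that \<open>v i\<close> is
      \<open>a\<close> times \<open>c i\<close> plus \<open>b\<close> times \<open>d i\<close>. The
      claim is that this relation persists on the closure.\<close>
    define a where "a = (\<Sum>j\<le>n. a0 j x0 * v j)"
    define b where "b = (\<Sum>j\<le>n. a1 j x0 * v j)"
    have v_eq: "v i = a * c i x0 + b * d i x0" if i: "i \<le> n" for i
    proof (rule ccontr)
      assume ne: "v i \<noteq> a * c i x0 + b * d i x0"
      \<comment> \<open>The failure of that relation in the \<open>i\<close>-th coordinate, as a
        linear form in \<open>v\<close>. Its coefficients are regular functions on the base, so
        being nonzero is an open condition on the product.\<close>
      define l where "l = (\<lambda>j y. (if j = i then 1 else 0) - (c i y * a0 j y + d i y * a1 j y))"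
      have lsum: "(\<Sum>j\<le>n. l j y * w j) = w i - (c i y * (\<Sum>j\<le>n. a0 j y * w j) + d i y * (\<Sum>j\<le>n. a1 j y * w j))" for y w
      proof -
        have "(\<Sum>j\<le>n. l j y * w j) = (\<Sum>j\<le>n. (if j = i then w j else 0)
            - (c i y * (a0 j y * w j) + d i y * (a1 j y * w j)))"
          by (rule sum.cong) (auto simp: l_def algebra_simps)
        also have "\<dots> = w i - (c i y * (\<Sum>j\<le>n. a0 j y * w j) + d i y * (\<Sum>j\<le>n. a1 j y * w j))"
          unfolding sum_subtractf sum.distrib sum_distrib_left[symmetric] using i by simp
        finally show ?thesis .
      qed
      have lreg: "(W, l j) \<in> R" if "j \<le> n" for j
        unfolding l_def
        by (rule regular_on_diff[OF R regular_on_const[OF R W]])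
          (rule regular_on_add[OF R regular_on_mult[OF R reg(1)[OF i] reg(3)[OF that]]
            regular_on_mult[OF R reg(2)[OF i] reg(4)[OF that]]])
      let ?W = "{z \<in> points ?P. fst z \<in> W}"
      have "open_in ?P {z \<in> ?W. \<forall>v\<in>snd z. (\<Sum>j\<le>n. l j (fst z) * v j) \<noteq> 0}" (is "open_in _ ?O")
      proof (rule open_linear_form_nonzero[OF fP morphism_product_snd])
        fix j assume "j \<le> n"
        then have "(W, l j) \<in> induced R U"
          using induced_regular[OF lreg, of j U] WU by (simp add: Int_absorb2)
        then show "(?W, \<lambda>z. l j (fst z)) \<in> ?P"
          by (rule morphism_regular[OF morphism_product_fst])
      qed
      moreover have "(\<Sum>j\<le>n. l j x0 * v j) \<noteq> 0"
        unfolding lsum a_def[symmetric] b_def[symmetric] using ne by (simp add: mult.commute)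
      then have "\<forall>w\<in>p. (\<Sum>j\<le>n. l j x0 * w j) \<noteq> 0"
        unfolding v(1) by (rule iffD2[OF linear_form_hclass_nonzero])
      then have "(x0, p) \<in> ?O"
        using subsetD[OF closure_in_subset_points p[unfolded pG]] x0W by auto
      ultimately have "?O \<inter> \<Delta> \<noteq> {}" using p[unfolded pG] unfolding closure_in_def by blast
      then obtain y where y: "y \<in> W" "\<forall>v\<in>hclass (F y). (\<Sum>j\<le>n. l j y * v j) \<noteq> 0"
        unfolding \<Delta>_def by auto
      have "(\<Sum>j\<le>n. l j y * F y j) \<noteq> 0" using y(2) hclass_self[of "F y"] by simp
      moreover have "(\<Sum>j\<le>n. r j y * F y j) = (\<Sum>j\<le>n. r j y * f j y)" for r
        by (rule sum.cong) (auto simp: F_def)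
      ultimately have "F y i - (c i y * g0 y + d i y * g1 y) \<noteq> 0"
        unfolding lsum using g0_eq[OF y(1)] g1_eq[OF y(1)] by simp
      then show False using f_eq[OF y(1) i] i by (simp add: F_def mult.commute)
    qed
    have "v = linear_map 1 n A (vec2 a b)"
      using v(2) v_eq unfolding A by auto
    moreover have "a \<noteq> 0 \<or> b \<noteq> 0"
      using v(3,4) v_eq[of k] by auto
    ultimately show ?thesis using v(1) by blast
  qed

  \<comment> \<open>Transports the exceptional line of the local model back to the blow-up.\<close>
  define e where "e = (\<lambda>p. inv_into ?B \<psi> (x0, linear_map 1 n A ` p))"
  have inv: "morphism ?G (induced B ?B) (inv_into ?B \<psi>)"
    "\<And>b. b \<in> ?B \<Longrightarrow> inv_into ?B \<psi> (\<psi> b) = b" "\<And>z. z \<in> points ?G \<Longrightarrow> \<psi> (inv_into ?B \<psi> z) = z"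
    using inv_into_isomorphism[OF iso] by (auto simp: points_induced)
  have invB: "morphism ?G B (inv_into ?B \<psi>)"
    using morphism_comp[OF inv(1) morphism_inclusion] by auto
  have inv_\<beta>: "\<beta> (inv_into ?B \<psi> z) = fst z" if "z \<in> points ?G" for z
    using morphism_points[OF inv(1) that] fst inv(3)[OF that] by (simp add: points_induced) metis
  show ?thesis
  proof (rule exI[of _ e], intro conjI allI impI)
    let ?L = "\<lambda>p. linear_map 1 n A ` p"
    have lin: "morphism (induced (proj_space 1) (proj_points 1)) (proj_space n) ?L"
    proof (rule morphism_linear_map)
      fix v assume "hclass v \<in> proj_points 1"
      then obtain a b where ab: "hclass v = hclass (vec2 a b)" "a \<noteq> 0 \<or> b \<noteq> 0" by (rule proj_points_1E)
      from ab(1) obtain k where "k \<noteq> 0" "v = (\<lambda>i. k * vec2 a b i)" unfolding hclass_eq_iff by blast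
      then show "\<exists>i. linear_map 1 n A v i \<noteq> 0"
        using A_nonzero[OF ab(2)] by (auto simp: linear_map_scale)
    qed simp
    have fs1: "function_space (proj_space 1)" by (rule function_space_proj_space)
    have "morphism (proj_space 1) (induced (proj_space 1) (proj_points 1)) (\<lambda>p. p)"
      by (rule morphism_into_induced[OF fs1 morphism_id[OF fs1]]) (simp add: points_proj_space)
    from morphism_comp[OF this lin] have "morphism (proj_space 1) (proj_space n) ?L" .
    moreover have "morphism (proj_space 1) (induced R U) (\<lambda>_. x0)"
      by (rule morphism_const[OF fs1]) (simp add: points_induced U)
    ultimately have "morphism (proj_space 1) ?P (\<lambda>p. (x0, ?L p))"
      by (intro morphism_Pair[OF fs1])
    moreover have LG: "(x0, ?L p) \<in> points ?G" if "p \<in> proj_points 1" for p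
      using proj_points_1E[OF that] in_G linear_map_hclass by metis
    ultimately have "morphism (proj_space 1) ?G (\<lambda>p. (x0, ?L p))"
      unfolding graph_closure_def Let_def
      by (intro morphism_into_induced[OF fs1]) (auto simp: points_proj_space points_induced)
    from morphism_comp[OF this invB] show "morphism (proj_space 1) B e" unfolding e_def .
    show "{b \<in> points B. \<beta> b = x0} = e ` proj_points 1"
    proof (intro equalityI subsetI)
      fix b assume "b \<in> e ` proj_points 1"
      then obtain p where p: "p \<in> proj_points 1" "b = e p" by blast
      show "b \<in> {b \<in> points B. \<beta> b = x0}"
        using morphism_points[OF invB LG[OF p(1)]] inv_\<beta>[OF LG[OF p(1)]]
        by (simp add: p(2) e_def)
    next
      fix b assume b: "b \<in> {b \<in> points B. \<beta> b = x0}"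
      then have bB: "b \<in> ?B" using U(1) by simp
      have "\<psi> b \<in> points ?G"
        using iso bB unfolding isomorphism_def by (auto simp: points_induced dest: bij_betwE)
      moreover have "fst (\<psi> b) = x0" using fst bB b by simp
      ultimately obtain p where p: "\<psi> b = (x0, p)" "(x0, p) \<in> points ?G" by (metis prod.collapse)
      from from_G[OF p(2)] obtain a' b' where ab: "a' \<noteq> 0 \<or> b' \<noteq> 0"
        "p = hclass (linear_map 1 n A (vec2 a' b'))" by blast
      then have "e (hclass (vec2 a' b')) = inv_into ?B \<psi> (\<psi> b)"
        unfolding e_def linear_map_hclass p(1) by simp
      then show "b \<in> e ` proj_points 1"
        using inv(2)[OF bB] hclass_vec2_in[OF ab(1)] by (metis image_eqI)
    qed
    fix a b D \<gamma> assume "(a \<noteq> 0 \<or> b \<noteq> 0) \<and> is_arc R N g0 g1 x0 a b D \<gamma>"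
    then have ab: "a \<noteq> 0 \<or> b \<noteq> 0" and arc: "is_arc R N g0 g1 x0 a b D \<gamma>" by simp_all
    from lift[OF ab arc] obtain D' \<Gamma> where D': "open D'" "0 \<in> D'" "D' \<subseteq> D"
      "morphism (continuous_space D') ?G \<Gamma>" "\<forall>t\<in>D'. fst (\<Gamma> t) = \<gamma> t"
      "\<Gamma> 0 = (x0, hclass (linear_map 1 n A (vec2 a b)))" by (elim exE conjE)
    have "\<beta> (inv_into ?B \<psi> (\<Gamma> t)) = \<gamma> t" if "t \<in> D'" for t
      using inv_\<beta>[OF morphism_points[OF D'(4)]] that D'(1,5) by (simp add: points_continuous_space)
    then have "\<exists>\<Gamma>. open D' \<and> 0 \<in> D' \<and> D' \<subseteq> D \<and> morphism (continuous_space D') B \<Gamma> \<and>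
        (\<forall>t\<in>D'. \<beta> (\<Gamma> t) = \<gamma> t) \<and> \<Gamma> 0 = e (hclass (vec2 a b))"
      using D' morphism_comp[OF D'(4) invB]
      by (intro exI[of _ "\<lambda>t. inv_into ?B \<psi> (\<Gamma> t)"]) (simp add: e_def linear_map_hclass)
    then show "\<exists>D' \<Gamma>. open D' \<and> 0 \<in> D' \<and> D' \<subseteq> D \<and> morphism (continuous_space D') B \<Gamma> \<and>
        (\<forall>t\<in>D'. \<beta> (\<Gamma> t) = \<gamma> t) \<and> \<Gamma> 0 = e (hclass (vec2 a b))" ..
  qed
qed

section \<open>Coordinates of the plane\<close>

lemma sum_atMost_2: "(\<Sum>i\<le>2::nat. f i) = f 0 + f 1 + (f 2 :: complex)"
  by (simp add: numeral_2_eq_2)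

lemma nat_le_2_cases: "i \<le> (2::nat) \<longleftrightarrow> i = 0 \<or> i = 1 \<or> i = 2"
  by auto

definition cvec :: "(nat \<Rightarrow> nat \<Rightarrow> complex) \<Rightarrow> complex \<Rightarrow> complex \<Rightarrow> complex \<Rightarrow> nat \<Rightarrow> complex" where
  "cvec u x y z = (\<lambda>i. x * u 0 i + y * u 1 i + z * u 2 i)"

definition cpt :: "(nat \<Rightarrow> nat \<Rightarrow> complex) \<Rightarrow> complex \<Rightarrow> complex \<Rightarrow> complex \<Rightarrow> ppoint" where
  "cpt u x y z = hclass (cvec u x y z)"

text \<open>The basis \<open>w\<close> is dual to \<open>u\<close> and serves as a frame of the dual
  plane, so that incidence of a point and a line is the standard pairing of their coordinates. With
  both relations assumed the roles of \<open>u\<close> and \<open>w\<close> are interchangeable, and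
  statements about points dualize to statements about lines.\<close>

locale plane_frame =
  fixes u w :: "nat \<Rightarrow> nat \<Rightarrow> complex"
  assumes supp: "\<And>k i. i > 2 \<Longrightarrow> u k i = 0" "\<And>k i. i > 2 \<Longrightarrow> w k i = 0"
    and dual: "\<And>k l. k \<le> 2 \<Longrightarrow> l \<le> 2 \<Longrightarrow> (\<Sum>i\<le>2. u k i * w l i) = (if k = l then 1 else 0)"
    and complete: "\<And>i j. i \<le> 2 \<Longrightarrow> j \<le> 2 \<Longrightarrow> (\<Sum>k\<le>2. u k i * w k j) = (if i = j then 1 else 0)"
begin

lemma dual_frame: "plane_frame w u"
proof
  fix k l :: nat assume "k \<le> 2" "l \<le> 2"
  then show "(\<Sum>i\<le>2. w k i * u l i) = (if k = l then 1 else 0)"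
    using dual[of l k] by (simp add: mult.commute)
next
  fix k l :: nat assume "k \<le> 2" "l \<le> 2"
  then show "(\<Sum>i\<le>2. w i k * u i l) = (if k = l then 1 else 0)"
    using complete[of l k] by (simp add: mult.commute)
qed (simp_all add: supp)

lemma pairing: "(\<Sum>i\<le>2. cvec u x y z i * cvec w a b c i) = x * a + y * b + z * c"
proof -
  have "(\<Sum>i\<le>2. cvec u x y z i * cvec w a b c i) =
      x * a * (\<Sum>i\<le>2. u 0 i * w 0 i) + x * b * (\<Sum>i\<le>2. u 0 i * w 1 i) + x * c * (\<Sum>i\<le>2. u 0 i * w 2 i)
    + y * a * (\<Sum>i\<le>2. u 1 i * w 0 i) + y * b * (\<Sum>i\<le>2. u 1 i * w 1 i) + y * c * (\<Sum>i\<le>2. u 1 i * w 2 i)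
    + z * a * (\<Sum>i\<le>2. u 2 i * w 0 i) + z * b * (\<Sum>i\<le>2. u 2 i * w 1 i) + z * c * (\<Sum>i\<le>2. u 2 i * w 2 i)"
    unfolding sum_distrib_left sum.distrib[symmetric] cvec_def
    by (rule sum.cong) (simp_all add: algebra_simps)
  also have "\<dots> = x * a + y * b + z * c" by (simp add: dual)
  finally show ?thesis .
qed

lemma pairing_basis: "(\<Sum>i\<le>2. w 0 i * cvec u x y z i) = x" "(\<Sum>i\<le>2. w 1 i * cvec u x y z i) = y"
  "(\<Sum>i\<le>2. w 2 i * cvec u x y z i) = z"
  using pairing[of x y z 1 0 0] pairing[of x y z 0 1 0] pairing[of x y z 0 0 1]
  by (simp_all add: cvec_def mult.commute)

lemma cvec_inject: "cvec u x y z = cvec u x' y' z' \<longleftrightarrow> x = x' \<and> y = y' \<and> z = z'"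
  using pairing_basis by metis

lemma cvec_scale: "(\<lambda>i. k * cvec u x y z i) = cvec u (k * x) (k * y) (k * z)"
  unfolding cvec_def by (auto simp: algebra_simps)

lemma cpt_eq_iff:
  "cpt u x y z = cpt u x' y' z' \<longleftrightarrow> (\<exists>k. k \<noteq> 0 \<and> x = k * x' \<and> y = k * y' \<and> z = k * z')"
  unfolding cpt_def hclass_eq_iff cvec_scale cvec_inject ..

lemma cvec_nonzero: "x \<noteq> 0 \<or> y \<noteq> 0 \<or> z \<noteq> 0 \<Longrightarrow> \<exists>i. cvec u x y z i \<noteq> 0"
proof (rule ccontr)
  assume "x \<noteq> 0 \<or> y \<noteq> 0 \<or> z \<noteq> 0" and "\<not> (\<exists>i. cvec u x y z i \<noteq> 0)"
  then show False using pairing_basis[of x y z] by simp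
qed

lemma cvec_supp: "i > 2 \<Longrightarrow> cvec u x y z i = 0"
  unfolding cvec_def by (simp add: supp)

lemma cpt_in: "x \<noteq> 0 \<or> y \<noteq> 0 \<or> z \<noteq> 0 \<Longrightarrow> cpt u x y z \<in> proj_points 2"
  unfolding cpt_def using cvec_nonzero[of x y z] by (auto intro: hclass_in_proj_points cvec_supp)

lemma vector_expansion:
  assumes "\<And>i. i > 2 \<Longrightarrow> v i = 0"
  shows "v = cvec u (\<Sum>i\<le>2. w 0 i * v i) (\<Sum>i\<le>2. w 1 i * v i) (\<Sum>i\<le>2. w 2 i * v i)"
proof
  fix i
  show "v i = cvec u (\<Sum>i\<le>2. w 0 i * v i) (\<Sum>i\<le>2. w 1 i * v i) (\<Sum>i\<le>2. w 2 i * v i) i"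
  proof (cases "i \<le> 2")
    case True
    have "cvec u (\<Sum>i\<le>2. w 0 i * v i) (\<Sum>i\<le>2. w 1 i * v i) (\<Sum>i\<le>2. w 2 i * v i) i
        = (\<Sum>j\<le>2. (\<Sum>k\<le>2. u k i * w k j) * v j)"
      unfolding cvec_def sum_atMost_2 by (simp add: algebra_simps)
    also have "\<dots> = (\<Sum>j\<le>2. if i = j then v j else 0)"
      by (rule sum.cong) (use True in \<open>auto simp: complete\<close>)
    also have "\<dots> = v i" using True by simp
    finally show ?thesis by simp
  qed (simp add: assms cvec_supp)
qed

lemma proj_points_2E:
  assumes "p \<in> proj_points 2"
  obtains x y z where "p = cpt u x y z" "x \<noteq> 0 \<or> y \<noteq> 0 \<or> z \<noteq> 0"
proof -
  obtain v i where v: "p = hclass v" "\<And>i. i > 2 \<Longrightarrow> v i = 0" "v i \<noteq> 0"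
    using assms by (rule proj_pointsE) blast
  let ?x = "\<Sum>i\<le>2. w 0 i * v i" and ?y = "\<Sum>i\<le>2. w 1 i * v i" and ?z = "\<Sum>i\<le>2. w 2 i * v i"
  have *: "v = cvec u ?x ?y ?z" by (rule vector_expansion) (rule v(2))
  have "?x \<noteq> 0 \<or> ?y \<noteq> 0 \<or> ?z \<noteq> 0"
  proof (rule ccontr)
    assume "\<not> ?thesis"
    then have "v i = cvec u 0 0 0 i" using * by metis
    then show False using v(3) by (simp add: cvec_def)
  qed
  then show ?thesis using that[of ?x ?y ?z] * v(1) unfolding cpt_def by metis
qed

lemma on_line_cpt: "on_line (cpt u x y z) (cpt w a b c) \<longleftrightarrow> x * a + y * b + z * c = 0"
proof
  assume "on_line (cpt u x y z) (cpt w a b c)"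
  then have "(\<Sum>i\<le>2. cvec u x y z i * cvec w a b c i) = 0"
    unfolding on_line_def cpt_def using hclass_self by blast
  then show "x * a + y * b + z * c = 0" by (simp add: pairing)
next
  assume *: "x * a + y * b + z * c = 0"
  show "on_line (cpt u x y z) (cpt w a b c)"
    unfolding on_line_def cpt_def
  proof (intro ballI)
    fix v v' assume "v \<in> hclass (cvec u x y z)" "v' \<in> hclass (cvec w a b c)"
    then obtain k k' where "v = (\<lambda>i. k * cvec u x y z i)" "v' = (\<lambda>i. k' * cvec w a b c i)"
      by (auto elim!: mem_hclassE)
    then have "(\<Sum>i\<le>2. v i * v' i) = k * k' * (\<Sum>i\<le>2. cvec u x y z i * cvec w a b c i)"
      by (simp add: sum_distrib_left mult_ac)
    then show "(\<Sum>i\<le>2. v i * v' i) = 0" using * by (simp add: pairing)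
  qed
qed

lemma cpt_eqI:
  assumes "x * y' = x' * y" "x * z' = x' * z" "y * z' = y' * z"
    and "x \<noteq> 0 \<or> y \<noteq> 0 \<or> z \<noteq> 0" "x' \<noteq> 0 \<or> y' \<noteq> 0 \<or> z' \<noteq> 0"
  shows "cpt u x y z = cpt u x' y' z'"
proof -
  have "\<exists>k. k \<noteq> 0 \<and> x = k * x' \<and> y = k * y' \<and> z = k * z'"
  proof -
    consider "x' \<noteq> 0" | "y' \<noteq> 0" | "z' \<noteq> 0" using assms(5) by blast
    then show ?thesis
    proof cases
      case 1
      then have "x \<noteq> 0" using assms(1,2,4) by auto
      then show ?thesis using 1 assms(1,2) by (intro exI[of _ "x / x'"]) (auto simp: field_simps)
    next
      case 2
      then have "y \<noteq> 0" using assms(1,3,4) by auto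
      then show ?thesis using 2 assms(1,3) by (intro exI[of _ "y / y'"]) (auto simp: field_simps)
    next
      case 3
      then have "z \<noteq> 0" using assms(2,3,4) by auto
      then show ?thesis using 3 assms(2,3) by (intro exI[of _ "z / z'"]) (auto simp: field_simps)
    qed
  qed
  then show ?thesis unfolding cpt_eq_iff .
qed

text \<open>
  \<open>on_line\<close> is symmetric, so the following serves both for the line joining two points and, in the
  dual frame, for the point where two lines meet.
\<close>

lemma incident_two_iff:
  fixes x y z x' y' z' :: complex
  defines "a \<equiv> y * z' - z * y'" and "b \<equiv> z * x' - x * z'" and "c \<equiv> x * y' - y * x'"
  assumes ne: "a \<noteq> 0 \<or> b \<noteq> 0 \<or> c \<noteq> 0"
  shows "l \<in> proj_points 2 \<and> on_line (cpt u x y z) l \<and> on_line (cpt u x' y' z') l \<longleftrightarrow> l = cpt w a b c"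
proof
  interpret d: plane_frame w u by (rule dual_frame)
  assume l: "l \<in> proj_points 2 \<and> on_line (cpt u x y z) l \<and> on_line (cpt u x' y' z') l"
  then obtain a' b' c' where abc: "l = cpt w a' b' c'" "a' \<noteq> 0 \<or> b' \<noteq> 0 \<or> c' \<noteq> 0"
    using d.proj_points_2E by metis
  with l have e: "x * a' + y * b' + z * c' = 0" "x' * a' + y' * b' + z' * c' = 0"
    by (simp_all add: on_line_cpt)
  show "l = cpt w a b c"
    unfolding abc(1)
  proof (rule d.cpt_eqI[OF _ _ _ abc(2) ne])
    show "a' * b = a * b'" unfolding a_def b_def using e by algebra
    show "a' * c = a * c'" unfolding a_def c_def using e by algebra
    show "b' * c = b * c'" unfolding b_def c_def using e by algebra
  qed
next
  interpret d: plane_frame w u by (rule dual_frame)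
  assume "l = cpt w a b c"
  then show "l \<in> proj_points 2 \<and> on_line (cpt u x y z) l \<and> on_line (cpt u x' y' z') l"
    using d.cpt_in[OF ne] by (simp add: on_line_cpt a_def b_def c_def algebra_simps)
qed

lemma join_cpt:
  fixes x y z x' y' z' :: complex
  assumes "y * z' - z * y' \<noteq> 0 \<or> z * x' - x * z' \<noteq> 0 \<or> x * y' - y * x' \<noteq> 0"
  shows "join (cpt u x y z) (cpt u x' y' z') = cpt w (y * z' - z * y') (z * x' - x * z') (x * y' - y * x')"
  unfolding join_def incident_two_iff[OF assms] by simp

lemma meet_cpt:
  fixes a b c a' b' c' :: complex
  assumes "b * c' - c * b' \<noteq> 0 \<or> c * a' - a * c' \<noteq> 0 \<or> a * b' - b * a' \<noteq> 0"
  shows "meet (cpt w a b c) (cpt w a' b' c') = cpt u (b * c' - c * b') (c * a' - a * c') (a * b' - b * a')"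
proof -
  interpret d: plane_frame w u by (rule dual_frame)
  have sym: "on_line p l \<longleftrightarrow> on_line l p" for p l
  proof -
    have "(\<Sum>i\<le>2. v i * v' i) = (\<Sum>i\<le>2. v' i * v i)" for v v' :: "nat \<Rightarrow> complex"
      by (rule sum.cong) simp_all
    then show ?thesis unfolding on_line_def by metis
  qed
  show ?thesis
    unfolding meet_def using d.incident_two_iff[OF assms] by (simp add: sym)
qed

end

section \<open>Dual frames and the parametrization of a conic\<close>

definition cross3 :: "(nat \<Rightarrow> complex) \<Rightarrow> (nat \<Rightarrow> complex) \<Rightarrow> nat \<Rightarrow> complex" where
  "cross3 x y = (\<lambda>i. if i = 0 then x 1 * y 2 - x 2 * y 1 else if i = 1 then x 2 * y 0 - x 0 * y 2
     else if i = 2 then x 0 * y 1 - x 1 * y 0 else 0)"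

text \<open>Cramer's rule: the dual basis consists of the cross products of the basis vectors
  divided by the determinant.\<close>

lemma plane_frame_exists:
  fixes u :: "nat \<Rightarrow> nat \<Rightarrow> complex"
  assumes supp: "\<And>k i. i > 2 \<Longrightarrow> u k i = 0"
    and det: "(\<Sum>i\<le>2. u 0 i * cross3 (u 1) (u 2) i) \<noteq> 0" (is "?d \<noteq> 0")
  shows "\<exists>w. plane_frame u w"
proof -
  define \<delta> where "\<delta> = ?d"
  define W where "W = (\<lambda>(k::nat) i. if k = 0 then cross3 (u 1) (u 2) i
    else if k = 1 then cross3 (u 2) (u 0) i else cross3 (u 0) (u 1) i)"
  have \<delta>: "\<delta> = u 0 0 * (u 1 1 * u 2 2 - u 1 2 * u 2 1) + u 0 1 * (u 1 2 * u 2 0 - u 1 0 * u 2 2)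
      + u 0 2 * (u 1 0 * u 2 1 - u 1 1 * u 2 0)"
    unfolding \<delta>_def sum_atMost_2 cross3_def by simp
  have \<delta>0: "\<delta> \<noteq> 0" using det unfolding \<delta>_def .
  have "plane_frame u (\<lambda>k i. W k i / \<delta>)"
  proof
    show "u k i = 0" if "i > 2" for k i by (rule supp[OF that])
    show "W k i / \<delta> = 0" if "i > 2" for k i using that by (auto simp: W_def cross3_def)
    show "(\<Sum>i\<le>2. u k i * (W l i / \<delta>)) = (if k = l then 1 else 0)" if "k \<le> 2" "l \<le> 2" for k l
    proof -
      have "(\<Sum>i\<le>2. u k i * W l i) = (if k = l then \<delta> else 0)"
        using that unfolding nat_le_2_cases \<delta> W_def sum_atMost_2
        by (elim disjE; simp add: cross3_def; simp add: algebra_simps)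
      then show ?thesis using \<delta>0 by (simp add: sum_divide_distrib[symmetric])
    qed
    show "(\<Sum>k\<le>2. u k i * (W k j / \<delta>)) = (if i = j then 1 else 0)" if "i \<le> 2" "j \<le> 2" for i j
    proof -
      have "(\<Sum>k\<le>2. u k i * W k j) = (if i = j then \<delta> else 0)"
        using that unfolding nat_le_2_cases \<delta> W_def sum_atMost_2
        by (elim disjE; simp add: cross3_def; simp add: algebra_simps)
      then show ?thesis using \<delta>0 by (simp add: sum_divide_distrib[symmetric])
    qed
  qed
  then show ?thesis by blast
qed

definition conic_point :: "(nat \<Rightarrow> nat \<Rightarrow> complex) \<Rightarrow> complex \<Rightarrow> ppoint" where
  "conic_point u t = cpt u 1 t (t\<^sup>2)"

definition bilinear :: "(nat \<Rightarrow> nat \<Rightarrow> complex) \<Rightarrow> (nat \<Rightarrow> complex) \<Rightarrow> (nat \<Rightarrow> complex) \<Rightarrow> complex" where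
  "bilinear a x y = (\<Sum>i\<le>2. \<Sum>j\<le>2. a i j * x i * y j)"

text \<open>The coefficients of the polar line of \<open>x\<close>, which are half the gradient of
  the quadratic form.\<close>

definition polar :: "(nat \<Rightarrow> nat \<Rightarrow> complex) \<Rightarrow> (nat \<Rightarrow> complex) \<Rightarrow> nat \<Rightarrow> complex" where
  "polar a x i = (\<Sum>j\<le>2. a i j * x j)"

lemma bilinear_polar: "bilinear a x y = x 0 * polar a y 0 + x 1 * polar a y 1 + x 2 * polar a y 2"
  unfolding bilinear_def polar_def sum_atMost_2 by (simp add: algebra_simps)

lemma bilinear_commute:
  assumes "\<And>i j. a i j = a j i"
  shows "bilinear a x y = bilinear a y x"
  unfolding bilinear_def sum_atMost_2
  using assms[of 0 1] assms[of 0 2] assms[of 1 2] by (simp add: algebra_simps)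

lemma bilinear_cvec: "bilinear a (cvec u x y z) v = x * bilinear a (u 0) v + y * bilinear a (u 1) v + z * bilinear a (u 2) v"
  unfolding bilinear_polar cvec_def by (simp add: algebra_simps)

lemma bilinear_scale: "bilinear a (\<lambda>i. k * x i) (\<lambda>i. k * x i) = k\<^sup>2 * bilinear a x x"
  unfolding bilinear_polar polar_def sum_atMost_2 by (simp add: algebra_simps power2_eq_square)

lemma cross3_components: "cross3 x y 0 = x 1 * y 2 - x 2 * y 1" "cross3 x y 1 = x 2 * y 0 - x 0 * y 2"
  "cross3 x y 2 = x 0 * y 1 - x 1 * y 0"
  by (simp_all add: cross3_def)

text \<open>Vectors orthogonal to \<open>r\<close> and \<open>s\<close> are proportional to their
  cross product; stated by minors, the relation also makes sense when one of the vectors is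
  zero.\<close>

lemma orthogonal_parallel_cross3:
  assumes "r 0 * x 0 + r 1 * x 1 + r 2 * x 2 = 0" "s 0 * x 0 + s 1 * x 1 + s 2 * x 2 = 0"
    and "i \<le> 2" "j \<le> 2"
  shows "x i * cross3 r s j = x j * cross3 r s i"
proof -
  have "x 0 * cross3 r s 1 = x 1 * cross3 r s 0" "x 0 * cross3 r s 2 = x 2 * cross3 r s 0"
    "x 1 * cross3 r s 2 = x 2 * cross3 r s 1"
    unfolding cross3_components using assms(1,2) by algebra+
  then show ?thesis using assms(3,4) unfolding nat_le_2_cases by (elim disjE; simp only:)
qed

text \<open>The form is homogeneous of degree 2, so one representative decides membership in the
  conic.\<close>

lemma nonsingular_conicD:
  assumes "nonsingular_conic K"
  shows "\<exists>a. (\<forall>i j. a i j = a j i) \<and>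
    (\<forall>v. hclass v \<in> proj_points 2 \<longrightarrow> hclass v \<in> K \<longleftrightarrow> bilinear a v v = 0) \<and>
    (\<forall>v. hclass v \<in> K \<longrightarrow> polar a v 0 \<noteq> 0 \<or> polar a v 1 \<noteq> 0 \<or> polar a v 2 \<noteq> 0)"
proof -
  from assms obtain a :: "nat \<Rightarrow> nat \<Rightarrow> complex" where a: "\<forall>i j. a i j = a j i"
    "K = {p \<in> proj_points 2. \<forall>v\<in>p. bilinear a v v = 0}"
    "\<forall>p\<in>K. \<forall>v\<in>p. \<exists>i\<le>2. 2 * polar a v i \<noteq> 0"
    unfolding nonsingular_conic_def bilinear_def polar_def by blast
  have "hclass v \<in> K \<longleftrightarrow> bilinear a v v = 0" if "hclass v \<in> proj_points 2" for v
  proof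
    assume "hclass v \<in> K"
    then show "bilinear a v v = 0" using a(2) hclass_self by blast
  next
    assume "bilinear a v v = 0"
    then have "bilinear a x x = 0" if "x \<in> hclass v" for x
      using mem_hclassE[OF that] bilinear_scale[of a _ v] by (metis mult_zero_right)
    then show "hclass v \<in> K" using a(2) that by blast
  qed
  moreover have "polar a v 0 \<noteq> 0 \<or> polar a v 1 \<noteq> 0 \<or> polar a v 2 \<noteq> 0" if "hclass v \<in> K" for v
  proof -
    have "\<exists>i\<le>2. 2 * polar a v i \<noteq> 0" using bspec[OF bspec[OF a(3) that] hclass_self] .
    then obtain i where "i \<le> 2" "polar a v i \<noteq> 0" by auto
    then show ?thesis unfolding nat_le_2_cases by auto
  qed
  ultimately show ?thesis using a(1) by (intro exI[of _ a]) auto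
qed

text \<open>With \<open>p\<close> the pole of the line RS, the quadratic form in the basis
  \<open>s\<close>, \<open>p\<close>, \<open>r\<close> has no terms other than y squared and xz.
  Rescaling \<open>s\<close> turns it into a multiple of y squared minus xz, whose zeros are the
  points (1, t, t squared) together with \<open>R\<close> at infinity.\<close>

lemma conic_parametrization:
  assumes K: "nonsingular_conic K" and "R \<in> K" "S \<in> K" "R \<noteq> S"
  obtains u w where "plane_frame u w" "K = insert R (range (conic_point u))" "R = cpt u 0 0 1"
proof -
  obtain a where a: "\<forall>i j. a i j = a j i"
    "\<forall>v. hclass v \<in> proj_points 2 \<longrightarrow> hclass v \<in> K \<longleftrightarrow> bilinear a v v = 0"
    "\<forall>v. hclass v \<in> K \<longrightarrow> polar a v 0 \<noteq> 0 \<or> polar a v 1 \<noteq> 0 \<or> polar a v 2 \<noteq> 0"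
    using nonsingular_conicD[OF K] by (elim exE conjE)
  have sym: "a i j = a j i" for i j using a(1) by simp
  have mem: "hclass v \<in> K \<longleftrightarrow> bilinear a v v = 0" if "hclass v \<in> proj_points 2" for v
    using a(2) that by simp
  have grad: "polar a v 0 \<noteq> 0 \<or> polar a v 1 \<noteq> 0 \<or> polar a v 2 \<noteq> 0" if "hclass v \<in> K" for v
    using a(3) that by simp
  have sub: "K \<subseteq> proj_points 2" using K unfolding nonsingular_conic_def by auto
  note comm = bilinear_commute[of a, OF sym]
  obtain r where r: "R = hclass r" "\<And>i. i > 2 \<Longrightarrow> r i = 0"
    using proj_pointsE[OF subsetD[OF sub assms(2)]] by metis
  obtain s i1 where s: "S = hclass s" "\<And>i. i > 2 \<Longrightarrow> s i = 0" "s i1 \<noteq> 0"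
    using proj_pointsE[OF subsetD[OF sub assms(3)]] by metis
  have rr: "bilinear a r r = 0" and ss: "bilinear a s s = 0"
    using mem[of r] mem[of s] assms(2,3) sub r(1) s(1) by auto
  have grad': "polar a v 0 \<noteq> 0 \<or> polar a v 1 \<noteq> 0 \<or> polar a v 2 \<noteq> 0"
    if "\<And>i. i > 2 \<Longrightarrow> v i = 0" "v i \<noteq> 0" "bilinear a v v = 0" for v i
  proof -
    have "hclass v \<in> proj_points 2" by (rule hclass_in_proj_points) (fact that)+
    then show ?thesis using grad mem that(3) by simp
  qed
  let ?k = "cross3 r s"
  have "\<exists>l\<le>2. ?k l \<noteq> 0"
  proof (rule ccontr)
    assume "\<not> ?thesis"
    then have k: "?k 0 = 0" "?k 1 = 0" "?k 2 = 0" by auto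
    have "r i * s j = r j * s i" for i j
    proof (cases "i \<le> 2 \<and> j \<le> 2")
      case True
      then show ?thesis using k unfolding cross3_def nat_le_2_cases by (elim conjE disjE) (simp_all add: mult.commute)
    next
      case False
      then show ?thesis using r(2) s(2) by (metis mult_zero_left mult_zero_right not_le)
    qed
    moreover obtain i0 where "r i0 \<noteq> 0"
      using grad[of r] assms(2) r(1) unfolding polar_def sum_atMost_2 by fastforce
    ultimately have "hclass r = hclass s" using s(3) by (intro hclass_eqI)
    then show False using assms(4) r s by simp
  qed
  then obtain l where l: "l \<le> 2" "?k l \<noteq> 0" by blast
  define b where "b = bilinear a r s"
  let ?pr = "polar a r" and ?ps = "polar a s"
  have eqs: "r 0 * ?pr 0 + r 1 * ?pr 1 + r 2 * ?pr 2 = 0" "s 0 * ?ps 0 + s 1 * ?ps 1 + s 2 * ?ps 2 = 0"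
    "r 0 * ?ps 0 + r 1 * ?ps 1 + r 2 * ?ps 2 = b" "s 0 * ?pr 0 + s 1 * ?pr 1 + s 2 * ?pr 2 = b"
    using rr ss comm[of s r] unfolding b_def bilinear_polar by auto
  \<comment> \<open>If \<open>b = 0\<close>, then both polars are multiples of the cross product of
    \<open>r\<close> and \<open>s\<close>, so a combination \<open>v\<close> of \<open>r\<close> and
    \<open>s\<close> has zero polar. Such a \<open>v\<close> lies on the conic, and nonsingularity
    forces \<open>v = 0\<close>; independence of \<open>r\<close> and \<open>s\<close> then makes
    the polar of \<open>r\<close> vanish, which is excluded.\<close>
  have "b \<noteq> 0"
  proof
    assume b0: "b = 0"
    have par: "?pr i * ?k j = ?pr j * ?k i" "?ps i * ?k j = ?ps j * ?k i" if "i \<le> 2" "j \<le> 2" for i j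
      using orthogonal_parallel_cross3[OF _ _ that] eqs unfolding b0 by blast+
    define v where "v = (\<lambda>i. ?ps l * r i - ?pr l * s i)"
    have pv: "polar a v i = ?ps l * ?pr i - ?pr l * ?ps i" for i
      unfolding polar_def v_def sum_atMost_2 by (simp add: algebra_simps)
    have pv0: "polar a v i = 0" if "i \<le> 2" for i
    proof -
      have "?k l * polar a v i = 0"
        unfolding pv using par[OF that l(1)] by algebra
      then show ?thesis using l(2) by simp
    qed
    have "bilinear a v v = 0" unfolding bilinear_polar using pv0 by simp
    moreover have "v i = 0" if "i > 2" for i using r(2) s(2) that unfolding v_def by simp
    ultimately have "v i = 0" for i using grad'[of v i] pv0 by auto
    then have v0: "v 0 = 0" "v 1 = 0" "v 2 = 0" by auto
    have "?pr l * ?k 0 = 0" "?pr l * ?k 1 = 0" "?pr l * ?k 2 = 0"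
      using v0 unfolding cross3_components v_def by algebra+
    then have "?pr l = 0" using l unfolding nat_le_2_cases by auto
    then have "?pr i = 0" if "i \<le> 2" for i using par(1)[OF that l(1)] l(2) by simp
    then show False using grad[of r] assms(2) r(1) by simp
  qed
  \<comment> \<open>The intersection of the tangents at \<open>R\<close> and \<open>S\<close>, that
    is, the pole of the line joining them.\<close>
  define p where "p = cross3 ?pr ?ps"
  have p_supp: "p i = 0" if "i > 2" for i using that unfolding p_def cross3_def by auto
  have p_eqs: "bilinear a p r = 0" "bilinear a p s = 0"
    unfolding bilinear_polar p_def cross3_components by algebra+
  \<comment> \<open>The determinant of \<open>s\<close>, \<open>p\<close>, \<open>r\<close>. By the
    triple product formula the cross product of \<open>p\<close> and \<open>r\<close> is
    \<open>- b\<close> times the polar of \<open>r\<close>, which pairs with \<open>s\<close> to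
    give another factor \<open>b\<close>.\<close>
  have det: "s 0 * (p 1 * r 2 - p 2 * r 1) + s 1 * (p 2 * r 0 - p 0 * r 2) + s 2 * (p 0 * r 1 - p 1 * r 0) = - b\<^sup>2"
    unfolding p_def cross3_components using eqs by algebra
  define c where "c = bilinear a p p"
  \<comment> \<open>If \<open>c = 0\<close>, then the polar of \<open>p\<close> is orthogonal to the
    basis \<open>s\<close>, \<open>p\<close>, \<open>r\<close> and hence zero, although
    \<open>p\<close> is nonzero and lies on the conic.\<close>
  have "c \<noteq> 0"
  proof
    assume c0: "c = 0"
    let ?x = "polar a p"
    have x: "s 0 * ?x 0 + s 1 * ?x 1 + s 2 * ?x 2 = 0" "r 0 * ?x 0 + r 1 * ?x 1 + r 2 * ?x 2 = 0"
      "p 0 * ?x 0 + p 1 * ?x 1 + p 2 * ?x 2 = 0"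
      using c0 p_eqs comm[of p s] comm[of p r] unfolding c_def bilinear_polar by simp_all
    have "b\<^sup>2 * ?x 0 = 0" "b\<^sup>2 * ?x 1 = 0" "b\<^sup>2 * ?x 2 = 0"
      using x det by algebra+
    then have x0: "?x 0 = 0" "?x 1 = 0" "?x 2 = 0" using \<open>b \<noteq> 0\<close> by simp_all
    have "\<exists>i. p i \<noteq> 0"
    proof (rule ccontr)
      assume "\<not> (\<exists>i. p i \<noteq> 0)"
      then show False using det \<open>b \<noteq> 0\<close> by simp
    qed
    then show False using grad'[of p] p_supp x0 c0 unfolding c_def by blast
  qed
  \<comment> \<open>Scaling \<open>s\<close> by \<open>m\<close> changes the coefficient
    \<open>2 * b\<close> of xz into \<open>- c\<close>, the opposite of the coefficient of y
    squared.\<close>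
  define m where "m = - c / (2 * b)"
  have m: "2 * b * m = - c" "m \<noteq> 0" using \<open>b \<noteq> 0\<close> \<open>c \<noteq> 0\<close> unfolding m_def by simp_all
  define u where "u = (\<lambda>k::nat. if k = 0 then (\<lambda>i. m * s i) else if k = 1 then p else if k = 2 then r else (\<lambda>_. 0))"
  have u: "u 0 = (\<lambda>i. m * s i)" "u 1 = p" "u 2 = r" unfolding u_def by simp_all
  have "\<exists>w. plane_frame u w"
  proof (rule plane_frame_exists)
    show "u k i = 0" if "i > 2" for k i using that s(2) r(2) p_supp unfolding u_def by simp
    have "(\<Sum>i\<le>2. u 0 i * cross3 (u 1) (u 2) i) = m * (- b\<^sup>2)"
      unfolding u sum_atMost_2 cross3_components using det by algebra
    then show "(\<Sum>i\<le>2. u 0 i * cross3 (u 1) (u 2) i) \<noteq> 0" using m(2) \<open>b \<noteq> 0\<close> by simp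
  qed
  then obtain w where uw: "plane_frame u w" by blast
  then interpret plane_frame u w .
  have form: "bilinear a (cvec u x y z) (cvec u x y z) = c * (y\<^sup>2 - x * z)" for x y z
  proof -
    have [simp]: "bilinear a (\<lambda>i. m * s i) v = m * bilinear a s v" for v
      unfolding bilinear_polar by (simp add: algebra_simps)
    have [simp]: "bilinear a v (\<lambda>i. m * s i) = m * bilinear a v s" for v
      using comm[of v] by simp
    have "bilinear a v (cvec u x y z) = x * m * bilinear a v s + y * bilinear a v p + z * bilinear a v r" for v
      unfolding comm[of v] bilinear_cvec u by simp
    then have "bilinear a (cvec u x y z) (cvec u x y z) = y\<^sup>2 * c + x * z * (2 * b * m)"
      unfolding bilinear_cvec u
      using rr ss p_eqs comm[of s p] comm[of r p] comm[of s r]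
      by (simp add: b_def[symmetric] c_def[symmetric] algebra_simps power2_eq_square)
    then show ?thesis unfolding m(1) by (simp add: algebra_simps)
  qed
  have inK: "cpt u x y z \<in> K \<longleftrightarrow> y\<^sup>2 = x * z" if "x \<noteq> 0 \<or> y \<noteq> 0 \<or> z \<noteq> 0" for x y z
    using mem[of "cvec u x y z"] cpt_in[OF that] form \<open>c \<noteq> 0\<close> unfolding cpt_def by simp
  have R: "R = cpt u 0 0 1" unfolding cpt_def cvec_def u r(1) by simp
  have "K = insert R (range (conic_point u))"
  proof (intro equalityI subsetI)
    fix q assume q: "q \<in> K"
    then obtain x y z where xyz: "q = cpt u x y z" "x \<noteq> 0 \<or> y \<noteq> 0 \<or> z \<noteq> 0"
      using proj_points_2E[OF subsetD[OF sub]] by metis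
    with q have e: "y\<^sup>2 = x * z" using inK by simp
    show "q \<in> insert R (range (conic_point u))"
    proof (cases "x = 0")
      case True
      then have "q = R" unfolding xyz(1) R cpt_eq_iff using e xyz(2) by (intro exI[of _ z]) auto
      then show ?thesis by simp
    next
      case False
      then have "q = conic_point u (y / x)"
        unfolding xyz(1) conic_point_def cpt_eq_iff using e
        by (intro exI[of _ x]) (auto simp: power_divide power2_eq_square)
      then show ?thesis by simp
    qed
  next
    fix q assume "q \<in> insert R (range (conic_point u))"
    then show "q \<in> K" using assms(2) inK unfolding conic_point_def by auto
  qed
  then show ?thesis using that[OF uw _ R] by blast
qed

section \<open>Chords of the conic\<close>

context plane_frame
begin

lemma conic_point_inject: "conic_point u s = conic_point u t \<longleftrightarrow> s = t"
  unfolding conic_point_def cpt_eq_iff by auto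

lemma conic_point_in: "conic_point u t \<in> proj_points 2"
  unfolding conic_point_def by (rule cpt_in) simp

text \<open>A line with coordinates (a, b, c) meets the conic at the roots of a + bX + c times X
  squared, so the chord corresponds to the monic polynomial with roots \<open>s\<close> and
  \<open>t\<close>. The cross product of the two points has the additional factor
  \<open>t - s\<close>.\<close>

lemma join_conic_points:
  assumes "s \<noteq> t"
  shows "join (conic_point u s) (conic_point u t) = cpt w (s * t) (- (s + t)) 1"
proof -
  have ne: "s * t\<^sup>2 - s\<^sup>2 * t \<noteq> 0 \<or> s\<^sup>2 * 1 - 1 * t\<^sup>2 \<noteq> 0 \<or> 1 * t - s * 1 \<noteq> 0" using assms by auto
  interpret d: plane_frame w u by (rule dual_frame)
  show ?thesis
    unfolding conic_point_def join_cpt[OF ne] d.cpt_eq_iff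
    using assms by (intro exI[of _ "t - s"]) (auto simp: algebra_simps power2_eq_square)
qed

lemma meet_chords:
  assumes "s * t \<noteq> s' * t' \<or> s + t \<noteq> s' + t'"
  shows "meet (cpt w (s * t) (- (s + t)) 1) (cpt w (s' * t') (- (s' + t')) 1) =
    cpt u (s' + t' - (s + t)) (s' * t' - s * t) ((s + t) * (s' * t') - s * t * (s' + t'))"
  using assms by (subst meet_cpt) (auto simp: algebra_simps)

end

section \<open>The Pascal line in coordinates\<close>

definition vec3 :: "complex \<Rightarrow> complex \<Rightarrow> complex \<Rightarrow> nat \<Rightarrow> complex" where
  "vec3 x y z = (\<lambda>i. if i = 0 then x else if i = 1 then y else z)"

lemma vec3_components: "vec3 x y z 0 = x" "vec3 x y z 1 = y" "vec3 x y z 2 = z"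
  by (simp_all add: vec3_def)

text \<open>The cross product of two chords in the coordinates of \<open>join_conic_points\<close>.
  It is polynomial in the four parameters and so keeps its meaning when ends of chords coincide in
  the limit.\<close>

definition chord_meet :: "complex \<Rightarrow> complex \<Rightarrow> complex \<Rightarrow> complex \<Rightarrow> nat \<Rightarrow> complex" where
  "chord_meet s t s' t' =
    vec3 (s' + t' - (s + t)) (s' * t' - s * t) ((s + t) * (s' * t') - s * t * (s' + t'))"

text \<open>
  The Pascal points \<open>AE \<inter> BF\<close> and \<open>AD \<inter> CF\<close> have the coordinates \<open>chord_meet a e b f\<close> and
  \<open>chord_meet a d c f\<close>.  The former is
  \<open>(b - a) * (1, f, f * (a + e) - a * e) + (f - e) * (1, a, a\<^sup>2)\<close>, so that the line joining the two
  points is a combination, with coefficients \<open>b - a\<close> and \<open>f - e\<close>, of two lines that stay distinct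
  when \<open>a = b\<close> and \<open>e = f\<close>.
\<close>

definition pascal_coords ::
    "complex \<Rightarrow> complex \<Rightarrow> complex \<Rightarrow> complex \<Rightarrow> complex \<Rightarrow> complex \<Rightarrow> complex \<Rightarrow> nat \<Rightarrow> complex" where
  "pascal_coords k k' a c d e f = cross3
    (vec3 (k + k') (k * f + k' * a) (k * (f * (a + e) - a * e) + k' * a\<^sup>2)) (chord_meet a d c f)"

lemma pascal_coords_eq:
  "cross3 (chord_meet a e b f) (chord_meet a d c f) = pascal_coords (b - a) (f - e) a c d e f"
proof -
  have "chord_meet a e b f = vec3 ((b - a) + (f - e)) ((b - a) * f + (f - e) * a)
      ((b - a) * (f * (a + e) - a * e) + (f - e) * a\<^sup>2)"
    unfolding chord_meet_def by (simp add: algebra_simps power2_eq_square)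
  then show ?thesis unfolding pascal_coords_def by simp
qed

lemma pascal_coords_scale: "pascal_coords (s * k) (s * k') a c d e f i = s * pascal_coords k k' a c d e f i"
  unfolding pascal_coords_def cross3_def vec3_def by (simp add: algebra_simps)

text \<open>If sums and products agreed, both pairs would be the roots of one quadratic polynomial,
  and \<open>s\<close> would be among \<open>s'\<close>, \<open>t'\<close>.\<close>

lemma chord_neq:
  assumes "s \<noteq> s'" "s \<noteq> t'"
  shows "s * t \<noteq> s' * t' \<or> s + t \<noteq> s' + (t' :: complex)"
proof (rule ccontr)
  assume "\<not> ?thesis"
  then have "(s - s') * (s - t') = 0" by algebra
  then show False using assms by simp
qed

context plane_frame
begin

lemma meet_conic_chords:
  assumes "s \<noteq> t" "s' \<noteq> t'" "s \<noteq> s'" "s \<noteq> t'"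
  shows "meet (join (conic_point u s) (conic_point u t)) (join (conic_point u s') (conic_point u t')) =
    cpt u (chord_meet s t s' t' 0) (chord_meet s t s' t' 1) (chord_meet s t s' t' 2)"
  unfolding join_conic_points[OF assms(1)] join_conic_points[OF assms(2)]
    meet_chords[OF chord_neq[OF assms(3,4)]] chord_meet_def vec3_components ..

text \<open>A nonzero vector \<open>l\<close> means that the first two Pascal points are distinct,
  so they already determine the line.\<close>

lemma pascal_line_conic:
  assumes h: "h LA = conic_point u a" "h LB = conic_point u b" "h LC = conic_point u c"
    "h LD = conic_point u d" "h LE = conic_point u e" "h LF = conic_point u f"
    and dist: "distinct [a, b, c, d, e, f]"
  defines "l \<equiv> pascal_coords (b - a) (f - e) a c d e f"
  assumes l: "l 0 \<noteq> 0 \<or> l 1 \<noteq> 0 \<or> l 2 \<noteq> 0"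
  shows "pascal_line [LA, LB, LC] [LF, LE, LD] h = cpt w (l 0) (l 1) (l 2)"
proof -
  define x where "x = chord_meet a e b f"
  define y where "y = chord_meet a d c f"
  define z where "z = chord_meet b d c e"
  have l_eq: "l = cross3 x y" unfolding l_def x_def y_def pascal_coords_eq ..
  let ?P = "\<lambda>i j. pascal_point [LA, LB, LC] [LF, LE, LD] i j h"
  have pts: "?P 0 1 = cpt u (x 0) (x 1) (x 2)" "?P 0 2 = cpt u (y 0) (y 1) (y 2)"
    "?P 1 2 = cpt u (z 0) (z 1) (z 2)"
    unfolding pascal_point_def x_def y_def z_def using dist
    by (simp_all add: h meet_conic_chords numeral_2_eq_2)
  have "(\<forall>i j. i < j \<and> j < 3 \<longrightarrow> on_line (?P i j) m) \<longleftrightarrow>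
      on_line (?P 0 1) m \<and> on_line (?P 0 2) m \<and> on_line (?P 1 2) m" for m
  proof -
    have "i < j \<and> j < 3 \<longleftrightarrow> (i = 0 \<and> j = 1) \<or> (i = 0 \<and> j = 2) \<or> (i = 1 \<and> j = 2)" for i j :: nat by auto
    then show ?thesis by auto
  qed
  \<comment> \<open>Pascal's theorem: with the conic parametrized, collinearity is a polynomial
    identity in the six parameters.\<close>
  moreover have "on_line (cpt u (z 0) (z 1) (z 2)) (cpt w (l 0) (l 1) (l 2))"
    unfolding on_line_cpt l_eq cross3_components x_def y_def z_def chord_meet_def vec3_components
    by algebra
  moreover have "m \<in> proj_points 2 \<and> on_line (cpt u (x 0) (x 1) (x 2)) m \<and> on_line (cpt u (y 0) (y 1) (y 2)) m
      \<longleftrightarrow> m = cpt w (l 0) (l 1) (l 2)" for m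
    unfolding l_eq cross3_components
    by (rule incident_two_iff) (use l in \<open>simp only: l_eq cross3_components\<close>)
  ultimately have "m \<in> proj_points 2 \<and> (\<forall>i j. i < j \<and> j < 3 \<longrightarrow> on_line (?P i j) m) \<longleftrightarrow>
      m = cpt w (l 0) (l 1) (l 2)" for m
    unfolding pts by blast
  then show ?thesis unfolding pascal_line_def by simp
qed

end

section \<open>Hexads\<close>

text \<open>The only coincidences allowed are those of the hexad in question. In affine coordinates
  this is an open condition, and it leaves a single stratum of the centres to be considered.\<close>

definition separated :: "hexad \<Rightarrow> bool" where
  "separated h \<longleftrightarrow> (\<forall>x y. h x = h y \<longrightarrow> x = y \<or> {x, y} = {LA, LB} \<or> {x, y} = {LE, LF})"

lemma polydiagonalD:
  assumes "h \<in> polydiagonal K \<pi>" "b \<in> \<pi>" "x \<in> b" "y \<in> b"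
  shows "h x = h y"
proof -
  have "\<forall>b\<in>\<pi>. \<forall>x\<in>b. \<forall>y\<in>b. h x = h y"
    using assms(1) unfolding polydiagonal_def mem_Collect_eq by (rule conjunct2)
  from this[THEN bspec, THEN bspec, THEN bspec, OF assms(2-4)] show ?thesis .
qed

text \<open>A third letter in the block would have to form an allowed pair with each of the other
  two, but the two allowed pairs are disjoint.\<close>

lemma separated_block:
  assumes h: "separated h" "h \<in> polydiagonal K \<pi>" and b: "b \<in> \<pi>" "card b \<ge> 2"
  shows "b = {LA, LB} \<or> b = {LE, LF}"
proof -
  have eq: "h x = h y" if "x \<in> b" "y \<in> b" for x y
    by (rule polydiagonalD[OF h(2) b(1) that])
  have "finite b" by simp
  then obtain x y where xy: "x \<in> b" "y \<in> b" "x \<noteq> y"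
    using b(2) by (metis One_nat_def Suc_1 card_le_Suc0_iff_eq not_less_eq_eq)
  have 1: "{x, y} = {LA, LB} \<or> {x, y} = {LE, LF}"
    using h(1) eq[OF xy(1,2)] xy(3) unfolding separated_def by blast
  have "z \<in> {x, y}" if "z \<in> b" for z
  proof (rule ccontr)
    assume z: "z \<notin> {x, y}"
    then have "{z, x} = {LA, LB} \<or> {z, x} = {LE, LF}"
      using h(1) eq[OF that xy(1)] unfolding separated_def by blast
    then show False using 1 z xy(3) by (auto simp: doubleton_eq_iff)
  qed
  then have "b = {x, y}" using xy by blast
  then show ?thesis using 1 by simp
qed

lemma count_partition_type:
  assumes "partition_has_type \<pi> t"
  shows "count t k = card {b \<in> \<pi>. card b = k}"
proof -
  have fin: "finite \<pi>" by simp
  have "count t k = (\<Sum>b | b \<in># mset_set \<pi> \<and> k = card b. count (mset_set \<pi>) b)"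
    using assms unfolding partition_has_type_def by (metis count_image_mset')
  also have "\<dots> = (\<Sum>b \<in> {b \<in> \<pi>. card b = k}. 1)"
    using fin by (intro sum.cong) auto
  finally show ?thesis by simp
qed

text \<open>Only {A, B} and {E, F} can be blocks with more than one letter. The types excluded from
  the base contain a 3 or a 4, the first centre needs three blocks of size 2, and of the two types
  of the second centre only the one with two 2s can occur; these counts decide all the
  cases.\<close>

lemma separated_type:
  assumes h: "separated h" "h \<in> polydiagonal K \<pi>" and t: "partition_has_type \<pi> t"
  shows "k \<ge> 3 \<Longrightarrow> count t k = 0" "count t 2 \<le> 2" "count t 2 = 2 \<Longrightarrow> h LA = h LB \<and> h LE = h LF"
proof -
  let ?B = "{b \<in> \<pi>. card b = 2}"
  have sub: "?B \<subseteq> {{LA, LB}, {LE, LF}}"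
  proof
    fix b assume "b \<in> ?B"
    then show "b \<in> {{LA, LB}, {LE, LF}}" using separated_block[OF h, of b] by simp
  qed
  show "count t k = 0" if k: "k \<ge> 3"
  proof -
    have "card b \<noteq> k" if "b \<in> \<pi>" for b
    proof
      assume "card b = k"
      with separated_block[OF h that] k have "b = {LA, LB} \<or> b = {LE, LF}" by simp
      then show False using \<open>card b = k\<close> k by auto
    qed
    then have "{b \<in> \<pi>. card b = k} = {}" by blast
    then show ?thesis by (simp add: count_partition_type[OF t])
  qed
  have two: "card {{LA, LB}, {LE, LF}} = 2" by (simp add: doubleton_eq_iff)
  then show "count t 2 \<le> 2"
    using card_mono[OF _ sub] by (simp add: count_partition_type[OF t])
  assume "count t 2 = 2"
  then have "card ?B = card {{LA, LB}, {LE, LF}}"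
    unfolding two using count_partition_type[OF t, of 2] by simp
  then have "?B = {{LA, LB}, {LE, LF}}" using card_subset_eq[OF _ sub] by simp
  then have "{LA, LB} \<in> ?B \<and> {LE, LF} \<in> ?B" by (rule ssubst) simp
  then have blocks: "{LA, LB} \<in> \<pi>" "{LE, LF} \<in> \<pi>" by simp_all
  from polydiagonalD[OF h(2) blocks(1), of LA LB] polydiagonalD[OF h(2) blocks(2), of LE LF]
  show "h LA = h LB \<and> h LE = h LF" by simp
qed

lemma points_hexads: "points (hexads K) = {h. range h \<subseteq> K}"
  unfolding hexads_def power_space_def points_generated points_induced ..

lemma separated_Hcirc:
  assumes "separated h" "range h \<subseteq> K"
  shows "h \<in> Hcirc_set K"
proof -
  have "h \<notin> polydiagonal K \<pi>" if "partition_has_type \<pi> t" "t \<in> {{#3, 2, 1#}, {#4, 1, 1#}}" for \<pi> t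
    using separated_type(1)[OF assms(1) _ that(1), of K 3] separated_type(1)[OF assms(1) _ that(1), of K 4] that(2)
    by auto
  then show ?thesis
    using assms(2) unfolding Hcirc_set_def points_hexads polydiagonals_def by blast
qed

lemma separated_not_Zcentre:
  assumes "separated h"
  shows "h \<notin> Zcentre K"
proof -
  have "h \<notin> polydiagonal K \<pi>" if "partition_has_type \<pi> {#2, 2, 2#}" for \<pi>
    using separated_type(2)[OF assms _ that, of K] by auto
  then show ?thesis unfolding Zcentre_def polydiagonals_def by blast
qed

text \<open>Among all strata of the second centre only the one with blocks AB, EF, C, D meets the
  separated hexads.\<close>

lemma separated_Ycentre:
  assumes "separated h" "range h \<subseteq> K"
  shows "h \<in> Ycentre K \<longleftrightarrow> h LA = h LB \<and> h LE = h LF"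
proof
  assume "h \<in> Ycentre K"
  then obtain \<pi> t where t: "partition_has_type \<pi> t" "t = {#2, 2, 1, 1#} \<or> t = {#3, 1, 1, 1#}"
    and h: "h \<in> polydiagonal K \<pi>" unfolding Ycentre_def polydiagonals_def by blast
  have "t \<noteq> {#3, 1, 1, 1#}" using separated_type(1)[OF assms(1) h t(1), of 3] by auto
  then show "h LA = h LB \<and> h LE = h LF"
    using separated_type(3)[OF assms(1) h t(1)] t(2) by auto
next
  assume eq: "h LA = h LB \<and> h LE = h LF"
  let ?\<pi> = "{{LA, LB}, {LE, LF}, {LC}, {LD}}"
  have "partition_on UNIV ?\<pi>"
    unfolding partition_on_def disjoint_def using letter.exhaust by auto
  moreover have "image_mset card (mset_set ?\<pi>) = {#2, 2, 1, 1#}"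
    by (simp add: doubleton_eq_iff numeral_2_eq_2)
  ultimately have "partition_has_type ?\<pi> {#2, 2, 1, 1#}" unfolding partition_has_type_def by blast
  moreover have "h \<in> polydiagonal K ?\<pi>"
    using eq assms(2) unfolding polydiagonal_def points_hexads by auto
  ultimately show "h \<in> Ycentre K"
    using separated_Hcirc[OF assms] unfolding Ycentre_def polydiagonals_def by blast
qed

lemma points_Hcirc: "points (Hcirc K) = Hcirc_set K"
  unfolding Hcirc_def by (rule points_induced)

lemma function_space_Hcirc: "function_space (Hcirc K)"
  unfolding Hcirc_def by (rule function_space_induced)

lemma range_Hcirc: "h \<in> Hcirc_set K \<Longrightarrow> range h \<subseteq> K"
  unfolding Hcirc_set_def points_hexads by blast

lemma morphism_evaluation:
  assumes "K \<subseteq> proj_points 2"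
  shows "morphism (Hcirc K) (proj_space 2) (\<lambda>h. h x)"
proof -
  have "morphism (hexads K) (induced (proj_space 2) K) (\<lambda>h. h x)"
    unfolding morphism_def points_hexads points_induced
  proof (intro conjI; clarify?)
    fix V g assume "(V, g) \<in> induced (proj_space 2) K"
    then have "({h. h x \<in> V} \<inter> {h. range h \<subseteq> K}, \<lambda>h. g (h x)) \<in> hexads K"
      unfolding hexads_def power_space_def points_induced by (intro generated.base) blast
    then show "({h \<in> {h. range h \<subseteq> K}. h x \<in> V}, \<lambda>h. g (h x)) \<in> hexads K"
      by (simp add: Int_def conj_commute)
  qed auto
  moreover have "morphism (induced (proj_space 2) K) (proj_space 2) (\<lambda>p. p)"
    by (rule morphism_inclusion) (simp add: points_proj_space assms)
  ultimately have "morphism (hexads K) (proj_space 2) (\<lambda>h. h x)" by (rule morphism_comp)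
  then show ?thesis
    unfolding Hcirc_def by (rule morphism_restrict) (auto simp: points_hexads Hcirc_set_def)
qed

text \<open>The universal property of the power: the structure on hexads is generated by functions
  of single letters.\<close>

lemma morphism_into_Hcirc:
  fixes \<phi> :: "'a \<Rightarrow> hexad"
  assumes R: "function_space R" and \<phi>: "\<And>x. morphism R (proj_space 2) (\<lambda>r. \<phi> r x)"
    and H: "\<And>r. r \<in> points R \<Longrightarrow> \<phi> r \<in> Hcirc_set K"
  shows "morphism R (Hcirc K) \<phi>"
  unfolding Hcirc_def
proof (rule morphism_into_induced[OF R _ H])
  have K: "\<phi> r x \<in> K" if "r \<in> points R" for r and x :: letter
    using range_Hcirc[OF H[OF that]] by blast
  show "morphism R (hexads K) \<phi>"
    unfolding hexads_def power_space_def points_induced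
  proof (rule morphism_generated[OF R])
    show "\<phi> r \<in> {h. range h \<subseteq> K}" if "r \<in> points R" for r
      using K[OF that] by blast
    fix V :: "hexad set" and g assume "(V, g) \<in> {({h. h x \<in> U}, \<lambda>h. f (h x)) | x U f. (U, f) \<in> induced (proj_space 2) K}"
    then obtain x U f where "V = {h. h x \<in> U}" "g = (\<lambda>h. f (h x))" "(U, f) \<in> induced (proj_space 2) K" by blast
    moreover have "morphism R (induced (proj_space 2) K) (\<lambda>r. \<phi> r x)"
      by (rule morphism_into_induced[OF R \<phi>]) (use K in blast)
    ultimately show "({r \<in> points R. \<phi> r \<in> V}, \<lambda>r. g (\<phi> r)) \<in> R"
      using morphism_regular by fastforce
  qed
qed

lemma (in plane_frame) morphism_conic_point:
  assumes R: "function_space R" and t: "(points R, t) \<in> R"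
  shows "morphism R (proj_space 2) (\<lambda>r. conic_point u (t r))"
  unfolding conic_point_def cpt_def
proof (rule morphism_hclass[OF R])
  fix i
  note const = regular_on_const[OF R open_in_points[OF R]]
  have "(points R, \<lambda>r. u 0 i + t r * u 1 i + (t r * t r) * u 2 i) \<in> R"
    by (rule regular_on_add[OF R regular_on_add[OF R const regular_on_mult[OF R t const]]
        regular_on_mult[OF R regular_on_mult[OF R t t] const]])
  then show "(points R, \<lambda>r. cvec u 1 (t r) ((t r)\<^sup>2) i) \<in> R"
    unfolding cvec_def power2_eq_square by simp
next
  fix r show "\<exists>i. cvec u 1 (t r) ((t r)\<^sup>2) i \<noteq> 0" by (rule cvec_nonzero) simp
qed (rule cvec_supp)

section \<open>Affine coordinates on the variety of hexads\<close>

text \<open>Precomposition with this map is the retraction onto the stratum A = B, E = F to which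
  Hadamard's lemma is applied.\<close>

definition fold_letter :: "letter \<Rightarrow> letter" where
  "fold_letter x = (if x = LB then LA else if x = LF then LE else x)"

lemma separated_fold:
  assumes "separated h"
  shows "separated (\<lambda>x. h (fold_letter x))"
  unfolding separated_def
proof (intro allI impI)
  fix x y assume "h (fold_letter x) = h (fold_letter y)"
  then have "fold_letter x = fold_letter y \<or> {fold_letter x, fold_letter y} = {LA, LB} \<or>
      {fold_letter x, fold_letter y} = {LE, LF}"
    using assms unfolding separated_def by blast
  \<comment> \<open>The values avoid B and F, so neither allowed pair can arise and the two folded
    letters are equal.\<close>
  moreover have "fold_letter z \<noteq> LB" "fold_letter z \<noteq> LF" for z
    unfolding fold_letter_def by auto
  ultimately have "fold_letter x = fold_letter y" by (metis doubleton_eq_iff)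
  then show "x = y \<or> {x, y} = {LA, LB} \<or> {x, y} = {LE, LF}"
    unfolding fold_letter_def by (auto split: if_splits)
qed

lemma fold_fixed:
  assumes "h LA = h LB" "h LE = h LF"
  shows "(\<lambda>x. h (fold_letter x)) = h"
  using assms by (auto simp: fold_letter_def)

text \<open>Turns separatedness into a finite conjunction of inequalities, from which its openness
  is read off.\<close>

definition separated_pairs :: "(letter \<times> letter) set" where
  "separated_pairs = {(x, y). x \<noteq> y \<and> {x, y} \<noteq> {LA, LB} \<and> {x, y} \<noteq> {LE, LF}}"

lemma separated_iff: "separated h \<longleftrightarrow> (\<forall>z\<in>separated_pairs. h (fst z) \<noteq> h (snd z))"
  unfolding separated_def separated_pairs_def by auto

text \<open>The point \<open>R\<close> has parameter infinity; hexads that avoid it have six finite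
  parameters as affine coordinates.\<close>

locale parametrized_conic = plane_frame u w for u w +
  fixes K :: "ppoint set" and R :: ppoint
  assumes K_eq: "K = insert R (range (conic_point u))" and R_eq: "R = cpt u 0 0 1"
begin

definition param :: "ppoint \<Rightarrow> complex" where
  "param p = (THE t. p = conic_point u t)"

lemma param_conic_point: "param (conic_point u t) = t"
  unfolding param_def conic_point_inject by (rule the_equality) auto

lemma conic_point_neq_R: "conic_point u t \<noteq> R"
  unfolding R_eq conic_point_def cpt_eq_iff by auto

lemma conic_point_param: "p \<in> K \<Longrightarrow> p \<noteq> R \<Longrightarrow> conic_point u (param p) = p"
  unfolding K_eq by (auto simp: param_conic_point)

lemma K_subset: "K \<subseteq> proj_points 2"
  unfolding K_eq R_eq using conic_point_in cpt_in[of 0 0 1] by auto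

text \<open>The line \<open>w 0\<close> is the tangent at \<open>R\<close> and meets the conic
  nowhere else, so omitting \<open>R\<close> is the nonvanishing of a linear form.\<close>

lemma off_R_iff:
  assumes "p \<in> K"
  shows "p \<noteq> R \<longleftrightarrow> (\<forall>v\<in>p. (\<Sum>j\<le>2. w 0 j * v j) \<noteq> 0)"
proof (cases "p = R")
  case True
  then have "cvec u 0 0 1 \<in> p" unfolding R_eq cpt_def using hclass_self by simp
  then show ?thesis using True pairing_basis(1)[of 0 0 1] by blast
next
  case False
  then obtain t where p: "p = hclass (cvec u 1 t (t\<^sup>2))"
    using assms unfolding K_eq conic_point_def cpt_def by blast
  show ?thesis
    unfolding p linear_form_hclass_nonzero using False p by (simp add: pairing_basis)
qed

definition affine_hexads :: "hexad set" where
  "affine_hexads = {h \<in> Hcirc_set K. \<forall>x. h x \<noteq> R}"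

lemma open_affine_hexads: "open_in (Hcirc K) affine_hexads"
proof -
  have K: "h x \<in> K" if "h \<in> Hcirc_set K" for h x
    using range_Hcirc[OF that] by blast
  let ?U = "\<lambda>x. {h \<in> points (Hcirc K). \<forall>v\<in>h x. (\<Sum>j\<le>2. w 0 j * v j) \<noteq> 0}"
  have "open_in (Hcirc K) (points (Hcirc K) \<inter> (\<Inter>x\<in>UNIV. ?U x))"
    by (rule open_in_INT[OF function_space_Hcirc])
      (auto intro!: open_linear_form_nonzero[OF function_space_Hcirc morphism_evaluation[OF K_subset]]
        regular_const[OF function_space_Hcirc])
  moreover have "(\<forall>x. h x \<noteq> R) \<longleftrightarrow> (\<forall>x. \<forall>v\<in>h x. (\<Sum>j\<le>2. w 0 j * v j) \<noteq> 0)"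
    if "h \<in> Hcirc_set K" for h
    using off_R_iff[OF K[OF that]] by simp
  then have "points (Hcirc K) \<inter> (\<Inter>x\<in>UNIV. ?U x) = affine_hexads"
    unfolding affine_hexads_def points_Hcirc by blast
  ultimately show ?thesis by simp
qed

lemma affine_hexads_subset: "affine_hexads \<subseteq> points (Hcirc K)"
  unfolding affine_hexads_def points_Hcirc by blast

lemma affine_hexads_param:
  assumes "h \<in> affine_hexads"
  shows "conic_point u (param (h x)) = h x"
proof -
  have "h x \<in> K" "h x \<noteq> R" using assms range_Hcirc unfolding affine_hexads_def by blast+
  then show ?thesis by (rule conic_point_param)
qed

text \<open>Projection from \<open>R\<close> onto the first two coordinates sends the point with
  parameter \<open>t\<close> to [1 : t], so the parameter is a coordinate ratio on the projective
  line.\<close>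

lemma param_regular: "(affine_hexads, \<lambda>h. param (h x)) \<in> Hcirc K"
proof -
  let ?R = "induced (Hcirc K) affine_hexads"
  let ?S = "range (conic_point u)"
  let ?L = "\<lambda>p. linear_map 2 1 w ` p"
  have fR: "function_space ?R" by (rule function_space_induced)
  have lin: "linear_map 2 1 w (cvec u a b c) = vec2 a b" for a b c
  proof
    fix i :: nat
    consider "i = 0" | "i = 1" | "i > 1" by linarith
    then show "linear_map 2 1 w (cvec u a b c) i = vec2 a b i"
      unfolding linear_map_def vec2_def using pairing_basis[of a b c] by cases simp_all
  qed
  have L: "?L (conic_point u t) = hclass (vec2 1 t)" for t
    unfolding conic_point_def cpt_def linear_map_hclass lin ..
  have ev: "morphism ?R (induced (proj_space 2) ?S) (\<lambda>h. h x)"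
  proof (rule morphism_into_induced[OF fR])
    show "morphism ?R (proj_space 2) (\<lambda>h. h x)"
      by (rule morphism_restrict[OF morphism_evaluation[OF K_subset] affine_hexads_subset])
    show "h x \<in> ?S" if "h \<in> points ?R" for h
      using affine_hexads_param[of h x] that by (metis points_induced rangeI)
  qed
  have "morphism (induced (proj_space 2) ?S) (proj_space 1) ?L"
  proof (rule morphism_linear_map)
    show "?S \<subseteq> proj_points 2" using conic_point_in by blast
    fix v assume "hclass v \<in> ?S"
    then obtain t where "hclass v = hclass (cvec u 1 t (t\<^sup>2))"
      unfolding conic_point_def cpt_def by blast
    then obtain k where "k \<noteq> 0" "v = (\<lambda>i. k * cvec u 1 t (t\<^sup>2) i)" unfolding hclass_eq_iff by blast
    then have "linear_map 2 1 w v = (\<lambda>i. k * vec2 1 t i)" by (simp only: linear_map_scale lin)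
    then have "linear_map 2 1 w v 0 \<noteq> 0" using \<open>k \<noteq> 0\<close> by (simp add: vec2_def)
    then show "\<exists>i. linear_map 2 1 w v i \<noteq> 0" ..
  qed
  from morphism_comp[OF ev this] have \<chi>: "morphism ?R (proj_space 1) (\<lambda>h. ?L (h x))" .
  have \<chi>_eq: "?L (h x) = hclass (vec2 1 (param (h x)))" if "h \<in> affine_hexads" for h
    using L[of "param (h x)"] by (simp add: affine_hexads_param[OF that])
  have "({h \<in> points ?R. ?L (h x) \<in> {p \<in> proj_points 1. \<forall>v\<in>p. v 0 \<noteq> 0}}, \<lambda>h. coord_ratio 1 0 (?L (h x))) \<in> ?R"
    by (rule morphism_regular[OF \<chi> coord_ratio_regular]) auto
  moreover have "{h \<in> points ?R. ?L (h x) \<in> {p \<in> proj_points 1. \<forall>v\<in>p. v 0 \<noteq> 0}} = affine_hexads"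
  proof -
    have "?L (h x) \<in> {p \<in> proj_points 1. \<forall>v\<in>p. v 0 \<noteq> 0}" if "h \<in> affine_hexads" for h
      unfolding \<chi>_eq[OF that] mem_Collect_eq hclass_coord_nonzero
      using hclass_vec2_in[of 1 "param (h x)"] by (simp add: vec2_def)
    then show ?thesis unfolding points_induced by blast
  qed
  ultimately have "(affine_hexads, \<lambda>h. coord_ratio 1 0 (?L (h x))) \<in> ?R" by simp
  then have "(affine_hexads, \<lambda>h. param (h x)) \<in> ?R"
  proof (rule regular_cong[OF fR])
    fix h assume "h \<in> affine_hexads"
    then show "param (h x) = coord_ratio 1 0 (?L (h x))"
      unfolding \<chi>_eq[OF \<open>h \<in> affine_hexads\<close>] by (subst coord_ratio_hclass) (simp_all add: vec2_def)
  qed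
  then show ?thesis by (rule regular_induced[OF function_space_Hcirc open_affine_hexads])
qed

section \<open>Equations of the second centre near the hexad\<close>

definition separated_hexads :: "hexad set" where
  "separated_hexads = {h \<in> affine_hexads. separated h}"

lemma open_separated_hexads: "open_in (Hcirc K) separated_hexads"
proof -
  note fH = function_space_Hcirc
  let ?U = "\<lambda>z. {h \<in> affine_hexads. param (h (fst z)) - param (h (snd z)) \<noteq> 0}"
  have "open_in (Hcirc K) (points (Hcirc K) \<inter> (\<Inter>z\<in>separated_pairs. ?U z))"
    by (rule open_in_INT[OF fH finite open_nonzero[OF fH regular_on_diff[OF fH param_regular param_regular]]])
  then have "open_in (Hcirc K) (affine_hexads \<inter> (points (Hcirc K) \<inter> (\<Inter>z\<in>separated_pairs. ?U z)))"
    by (rule open_in_Int[OF fH open_affine_hexads])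
  moreover have "param (h x) = param (h y) \<longleftrightarrow> h x = h y" if "h \<in> affine_hexads" for h x y
    using affine_hexads_param[OF that] by metis
  then have "affine_hexads \<inter> (points (Hcirc K) \<inter> (\<Inter>z\<in>separated_pairs. ?U z)) = separated_hexads"
    unfolding separated_hexads_def separated_iff using affine_hexads_subset by fastforce
  ultimately show ?thesis by simp
qed

lemma separated_hexads_subset: "separated_hexads \<subseteq> affine_hexads"
  unfolding separated_hexads_def by blast

lemma separated_hexadsD:
  assumes "h \<in> separated_hexads"
  shows "separated h" "h \<in> Hcirc_set K" "range h \<subseteq> K" "h x \<noteq> R" "h \<notin> Zcentre K"
  using assms range_Hcirc separated_not_Zcentre
  unfolding separated_hexads_def affine_hexads_def by blast+

lemma separated_hexadsI:
  assumes "\<And>x. h x = conic_point u (t x)" "separated h"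
  shows "h \<in> separated_hexads"
proof -
  have "range h \<subseteq> K" unfolding K_eq using assms(1) by auto
  then show ?thesis
    using separated_Hcirc[OF assms(2), of K] assms conic_point_neq_R
    unfolding separated_hexads_def affine_hexads_def by simp
qed

definition gap1 :: "hexad \<Rightarrow> complex" where
  "gap1 h = param (h LA) - param (h LB)"

definition gap2 :: "hexad \<Rightarrow> complex" where
  "gap2 h = param (h LE) - param (h LF)"

lemma gap_regular: "(separated_hexads, gap1) \<in> Hcirc K" "(separated_hexads, gap2) \<in> Hcirc K"
  unfolding gap1_def[abs_def] gap2_def[abs_def]
  by (intro regular_on_diff[OF function_space_Hcirc]
      regular_restrict_subset[OF function_space_Hcirc param_regular open_separated_hexads separated_hexads_subset])+

lemma Ycentre_iff_gaps:
  assumes "h \<in> separated_hexads"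
  shows "h \<in> Ycentre K \<longleftrightarrow> gap1 h = 0 \<and> gap2 h = 0"
proof -
  have "param (h x) = param (h y) \<longleftrightarrow> h x = h y" for x y
    using affine_hexads_param separated_hexads_subset assms by (metis subsetD)
  then show ?thesis
    using separated_Ycentre[OF separated_hexadsD(1,3)[OF assms]]
    unfolding gap1_def gap2_def by simp
qed

text \<open>Folding retracts onto the centre, where \<open>f\<close> vanishes, so the term of
  \<open>f\<close> after \<sigma> drops out of Hadamard's decomposition and only multiples of the
  two gaps remain.\<close>

lemma Ycentre_local_equations:
  assumes f: "(U, f) \<in> Hcirc K" and h: "h \<in> U" "h \<in> separated_hexads" "h \<in> Ycentre K"
    and zero: "\<And>y. y \<in> U \<inter> separated_hexads \<inter> Ycentre K \<Longrightarrow> f y = 0"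
  shows "\<exists>W c d. h \<in> W \<and> W \<subseteq> U \<inter> separated_hexads \<and> (W, c) \<in> Hcirc K \<and> (W, d) \<in> Hcirc K \<and>
    (\<forall>y\<in>W. f y = gap1 y * c y + gap2 y * d y)"
proof -
  let ?R = "induced (Hcirc K) separated_hexads"
  define \<sigma> where "\<sigma> = (\<lambda>(h :: hexad) x. h (fold_letter x))"
  let ?H = "hadamard_space ?R \<sigma> gap1 gap2"
  note fH = function_space_Hcirc[of K]
  have fR: "function_space ?R" by (rule function_space_induced)
  have sub: "separated_hexads \<subseteq> points (Hcirc K)"
    using separated_hexads_subset affine_hexads_subset by blast
  have fold: "\<sigma> y \<in> separated_hexads" if "y \<in> separated_hexads" for y
    unfolding \<sigma>_def
  proof (rule separated_hexadsI)
    show "separated (\<lambda>x. y (fold_letter x))" by (rule separated_fold[OF separated_hexadsD(1)[OF that]])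
    show "y (fold_letter x) = conic_point u (param (y (fold_letter x)))" for x
      using affine_hexads_param separated_hexads_subset that by (metis subsetD)
  qed
  have ev: "morphism ?R (proj_space 2) (\<lambda>h. h x)" for x
    by (rule morphism_restrict[OF morphism_evaluation[OF K_subset] sub])
  have "morphism ?R (Hcirc K) \<sigma>"
    unfolding \<sigma>_def
    by (rule morphism_into_Hcirc[OF fR ev])
      (use fold separated_hexadsD(2) in \<open>simp add: points_induced \<sigma>_def\<close>)
  then have \<sigma>: "morphism ?R ?R \<sigma>"
    by (rule morphism_into_induced[OF fR]) (use fold in \<open>simp add: points_induced\<close>)
  have fHad: "function_space ?H" by (rule function_space_hadamard_space[OF fR \<sigma>])
  have pHad: "points ?H = separated_hexads"
    unfolding points_hadamard_space[OF fR \<sigma>] by (rule points_induced)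
  have toR: "(W, c) \<in> ?R" if "(W, c) \<in> Hcirc K" "W \<subseteq> separated_hexads" for W c
    using induced_regular[OF that(1), of separated_hexads] that(2) by (simp add: Int_absorb2)
  \<comment> \<open>Folding changes only the parameters of B and F, and these are the parameters of
    A and E minus the respective gap; hence the coefficients \<open>-1\<close>.\<close>
  have coords: "(points ?H, \<lambda>h. param (h x)) \<in> ?H" for x
    unfolding pHad
  proof (rule hadamard_spaceI)
    show "(separated_hexads, \<lambda>h. param (h x)) \<in> ?R"
      by (rule toR[OF regular_restrict_subset[OF fH param_regular open_separated_hexads separated_hexads_subset]]) simp
    fix y assume y: "y \<in> separated_hexads"
    have const: "(separated_hexads, \<lambda>_. k) \<in> ?R" for k
      using regular_const[OF fR, of k] by (simp add: points_induced)
    show "\<exists>W c d. y \<in> W \<and> W \<subseteq> separated_hexads \<and> (\<forall>y\<in>W. \<sigma> y \<in> separated_hexads) \<and>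
        (W, c) \<in> ?R \<and> (W, d) \<in> ?R \<and>
        (\<forall>y\<in>W. param (y x) = param (\<sigma> y x) + gap1 y * c y + gap2 y * d y)"
      using y fold const
      by (intro exI[of _ separated_hexads] exI[of _ "\<lambda>_. if x = LB then -1 else 0"]
          exI[of _ "\<lambda>_. if x = LF then -1 else 0"])
        (auto simp: \<sigma>_def fold_letter_def gap1_def gap2_def)
  qed
  have evH: "morphism ?H (proj_space 2) (\<lambda>h. h x)" for x
    by (rule morphism_cong[OF fHad morphism_conic_point[OF fHad coords, of x]])
      (use affine_hexads_param separated_hexads_subset pHad in \<open>metis subsetD\<close>)
  \<comment> \<open>That the identity is a morphism out of the Hadamard space means that every
    regular function has the decomposition, not just the coordinates.\<close>
  have "morphism ?H (Hcirc K) (\<lambda>h. h)"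
    by (rule morphism_into_Hcirc[OF fHad evH]) (use separated_hexadsD(2) pHad in blast)
  from morphism_regular[OF this f]
  have fHd: "({y \<in> separated_hexads. y \<in> U}, f) \<in> ?H" by (simp add: pHad)
  have "\<sigma> h = h"
    unfolding \<sigma>_def
    by (rule fold_fixed) (use separated_Ycentre[OF separated_hexadsD(1,3)[OF h(2)]] h(3) in auto)
  with hadamard_spaceD(2)[OF fHd, of h] h obtain W c d where W: "h \<in> W" "W \<subseteq> {y \<in> separated_hexads. y \<in> U}"
    "\<forall>y\<in>W. \<sigma> y \<in> {y \<in> separated_hexads. y \<in> U}" "(W, c) \<in> ?R" "(W, d) \<in> ?R"
    "\<forall>y\<in>W. f y = f (\<sigma> y) + gap1 y * c y + gap2 y * d y" by auto
  have "f (\<sigma> y) = 0" if "y \<in> W" for y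
  proof -
    have *: "\<sigma> y \<in> separated_hexads" "\<sigma> y \<in> U" using W(3) that by auto
    have "\<sigma> y \<in> Ycentre K"
      using separated_Ycentre[OF separated_hexadsD(1,3)[OF *(1)]] by (simp add: \<sigma>_def fold_letter_def)
    then show ?thesis using zero * by blast
  qed
  then have "\<forall>y\<in>W. f y = gap1 y * c y + gap2 y * d y" using W(6) by simp
  moreover have "(W, c) \<in> Hcirc K" "(W, d) \<in> Hcirc K"
    using regular_induced[OF fH open_separated_hexads] W(4,5) by blast+
  moreover have "W \<subseteq> U \<inter> separated_hexads" using W(2) by blast
  ultimately show ?thesis using W(1) by (intro exI[of _ W] exI[of _ c] exI[of _ d]) simp
qed

section \<open>Arcs of hexads and their Pascal lines\<close>

definition arc_param ::
    "complex \<Rightarrow> complex \<Rightarrow> complex \<Rightarrow> complex \<Rightarrow> complex \<Rightarrow> complex \<Rightarrow> complex \<Rightarrow> letter \<Rightarrow> complex" where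
  "arc_param m n p q a b t x = (case x of LA \<Rightarrow> m + t * (a + t) | LB \<Rightarrow> m | LC \<Rightarrow> p | LD \<Rightarrow> q
     | LE \<Rightarrow> n + t * (b + t) | LF \<Rightarrow> n)"

definition arc :: "complex \<Rightarrow> complex \<Rightarrow> complex \<Rightarrow> complex \<Rightarrow> complex \<Rightarrow> complex \<Rightarrow> complex \<Rightarrow> hexad" where
  "arc m n p q a b t = (\<lambda>x. conic_point u (arc_param m n p q a b t x))"

definition arc_domain :: "complex \<Rightarrow> complex \<Rightarrow> complex \<Rightarrow> complex \<Rightarrow> complex \<Rightarrow> complex \<Rightarrow> complex set" where
  "arc_domain m n p q a b = {t. separated (arc m n p q a b t)}"

lemma continuous_arc_param: "continuous_on UNIV (\<lambda>t. arc_param m n p q a b t x)"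
  unfolding arc_param_def by (cases x) (auto intro!: continuous_intros)

lemma open_arc_domain: "open (arc_domain m n p q a b)"
proof -
  have "arc_domain m n p q a b = (\<Inter>z\<in>separated_pairs.
      {t. arc_param m n p q a b t (fst z) \<noteq> arc_param m n p q a b t (snd z)})"
    unfolding arc_domain_def separated_iff arc_def conic_point_inject by auto
  then show ?thesis
    by (simp only:) (intro open_INT ballI open_Collect_neq continuous_arc_param finite)
qed

lemma arc_0:
  assumes "distinct [m, n, p, q]"
  shows "0 \<in> arc_domain m n p q a b"
proof -
  have "x = y \<or> {x, y} = {LA, LB} \<or> {x, y} = {LE, LF}"
    if "arc_param m n p q a b 0 x = arc_param m n p q a b 0 y" for x y
    using that assms unfolding arc_param_def by (cases x; cases y) auto
  then show ?thesis unfolding arc_domain_def separated_def arc_def conic_point_inject by blast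
qed

lemma arc_separated: "t \<in> arc_domain m n p q a b \<Longrightarrow> arc m n p q a b t \<in> separated_hexads"
  by (rule separated_hexadsI) (auto simp: arc_def arc_domain_def)

lemma morphism_arc:
  "morphism (continuous_space (arc_domain m n p q a b)) (Hcirc K) (arc m n p q a b)"
proof (rule morphism_into_Hcirc)
  let ?C = "continuous_space (arc_domain m n p q a b)"
  show fC: "function_space ?C" by (rule function_space_continuous_space[OF open_arc_domain])
  show "morphism ?C (proj_space 2) (\<lambda>t. arc m n p q a b t x)" for x
    unfolding arc_def
    by (rule morphism_conic_point[OF fC])
      (auto simp: points_continuous_space[OF open_arc_domain] intro!: continuous_space_regular open_arc_domain
        continuous_on_subset[OF continuous_arc_param])
  show "arc m n p q a b t \<in> Hcirc_set K" if "t \<in> points ?C" for t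
    using separated_hexadsD(2)[OF arc_separated] that by (simp add: points_continuous_space[OF open_arc_domain])
qed

lemma gap_arc: "gap1 (arc m n p q a b t) = t * (a + t)" "gap2 (arc m n p q a b t) = t * (b + t)"
  unfolding gap1_def gap2_def arc_def param_conic_point by (simp_all add: arc_param_def)

text \<open>Both coefficients of the Pascal line carry the factor \<open>- t\<close>, which does not
  change the line. With it removed, the coordinates make sense at \<open>t = 0\<close>, where they
  will give the value of \<open>q\<close> on the fibre.\<close>

lemma pascal_line_arc:
  assumes t: "t \<in> arc_domain m n p q a b" "t \<noteq> 0" "a + t \<noteq> 0" "b + t \<noteq> 0"
  defines "l \<equiv> pascal_coords (a + t) (b + t) (m + t * (a + t)) p q (n + t * (b + t)) n"
  assumes l: "l 0 \<noteq> 0 \<or> l 1 \<noteq> 0 \<or> l 2 \<noteq> 0"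
  shows "inj (arc m n p q a b t)"
    "pascal_line [LA, LB, LC] [LF, LE, LD] (arc m n p q a b t) = cpt w (l 0) (l 1) (l 2)"
proof -
  let ?h = "arc m n p q a b t"
  have sep: "separated ?h" using t(1) unfolding arc_domain_def by simp
  have "?h LA \<noteq> ?h LB" "?h LE \<noteq> ?h LF"
    unfolding arc_def conic_point_inject using t(2-4) by (simp_all add: arc_param_def)
  then have "x = y" if "?h x = ?h y" for x y
    using sep that unfolding separated_def by (metis doubleton_eq_iff)
  then show inj: "inj ?h" by (rule injI)
  have "inj (arc_param m n p q a b t)"
    using inj unfolding arc_def inj_def conic_point_inject .
  then have "distinct (map (arc_param m n p q a b t) [LA, LB, LC, LD, LE, LF])"
    by (simp add: inj_eq)
  then have dist: "distinct [m + t * (a + t), m, p, q, n + t * (b + t), n]"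
    by (simp add: arc_param_def)
  let ?l = "pascal_coords (m - (m + t * (a + t))) (n - (n + t * (b + t))) (m + t * (a + t)) p q (n + t * (b + t)) n"
  have l_eq: "?l i = (- t) * l i" for i
  proof -
    have "m - (m + t * (a + t)) = (- t) * (a + t)" "n - (n + t * (b + t)) = (- t) * (b + t)" by simp_all
    then show ?thesis unfolding l_def by (simp only: pascal_coords_scale)
  qed
  have l': "?l 0 \<noteq> 0 \<or> ?l 1 \<noteq> 0 \<or> ?l 2 \<noteq> 0" unfolding l_eq using l t(2) by simp
  have "pascal_line [LA, LB, LC] [LF, LE, LD] ?h = cpt w (?l 0) (?l 1) (?l 2)"
    by (rule pascal_line_conic[OF _ _ _ _ _ _ dist l']) (simp_all add: arc_def arc_param_def)
  also have "\<dots> = cpt w (l 0) (l 1) (l 2)"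
    unfolding l_eq plane_frame.cpt_eq_iff[OF dual_frame] using t(2) by (intro exI[of _ "- t"]) simp
  finally show "pascal_line [LA, LB, LC] [LF, LE, LD] ?h = cpt w (l 0) (l 1) (l 2)" .
qed

end

text \<open>
  The line with coordinates \<open>l\<close> through \<open>MQ \<inter> NP\<close> is recovered, up to the factor \<open>scale\<close>, from its
  values at \<open>M\<close> and \<open>N\<close>.
\<close>

lemma pascal_coords_inverse:
  fixes m n p q :: complex
  defines "x \<equiv> chord_meet m q p n" and "scale \<equiv> (m - n)\<^sup>2 * (q - n) * (p - m)"
  shows "l 0 * x 0 + l 1 * x 1 + l 2 * x 2 = 0 \<Longrightarrow> i \<le> 2 \<Longrightarrow>
      pascal_coords (l 0 + l 1 * m + l 2 * m\<^sup>2) (- (l 0 + l 1 * n + l 2 * n\<^sup>2)) m p q n n i = scale * l i"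
    and "pascal_coords a b m p q n n 0 * x 0 + pascal_coords a b m p q n n 1 * x 1
      + pascal_coords a b m p q n n 2 * x 2 = 0"
    and "pascal_coords a b m p q n n 0 + pascal_coords a b m p q n n 1 * m
      + pascal_coords a b m p q n n 2 * m\<^sup>2 = scale * a"
    and "- (pascal_coords a b m p q n n 0 + pascal_coords a b m p q n n 1 * n
      + pascal_coords a b m p q n n 2 * n\<^sup>2) = scale * b"
proof -
  note defs = x_def scale_def pascal_coords_def cross3_components chord_meet_def vec3_components
  show "pascal_coords (l 0 + l 1 * m + l 2 * m\<^sup>2) (- (l 0 + l 1 * n + l 2 * n\<^sup>2)) m p q n n i = scale * l i"
    if l: "l 0 * x 0 + l 1 * x 1 + l 2 * x 2 = 0" and "i \<le> 2"
  proof -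
    have "pascal_coords (l 0 + l 1 * m + l 2 * m\<^sup>2) (- (l 0 + l 1 * n + l 2 * n\<^sup>2)) m p q n n 0 = scale * l 0"
      "pascal_coords (l 0 + l 1 * m + l 2 * m\<^sup>2) (- (l 0 + l 1 * n + l 2 * n\<^sup>2)) m p q n n 1 = scale * l 1"
      "pascal_coords (l 0 + l 1 * m + l 2 * m\<^sup>2) (- (l 0 + l 1 * n + l 2 * n\<^sup>2)) m p q n n 2 = scale * l 2"
      using l unfolding defs by algebra+
    then show ?thesis using \<open>i \<le> 2\<close> unfolding nat_le_2_cases by auto
  qed
  show "pascal_coords a b m p q n n 0 * x 0 + pascal_coords a b m p q n n 1 * x 1
      + pascal_coords a b m p q n n 2 * x 2 = 0"
    "pascal_coords a b m p q n n 0 + pascal_coords a b m p q n n 1 * m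
      + pascal_coords a b m p q n n 2 * m\<^sup>2 = scale * a"
    "- (pascal_coords a b m p q n n 0 + pascal_coords a b m p q n n 1 * n
      + pascal_coords a b m p q n n 2 * n\<^sup>2) = scale * b"
    unfolding defs by algebra+
qed

lemma blow_up_function_space: "blow_up B \<beta> R Z \<Longrightarrow> function_space B"
  and blow_up_morphism: "blow_up B \<beta> R Z \<Longrightarrow> morphism B R \<beta>"
  unfolding blow_up_def by (elim conjE, assumption)+

section \<open>The fibre over the hexad and the pencil\<close>

context parametrized_conic
begin

text \<open>The blow-up provides a map \<open>e\<close> from the projective line onto the fibre, and
  \<open>Q\<close> after \<open>e\<close> is linear. The inverse of this linear map sends a line to
  its values at M and, with a minus sign, at N; followed by \<open>e\<close> it is a morphism
  inverse to \<open>Q\<close>.\<close>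

lemma pascal_fibre_isomorphism:
  fixes X' :: "'a fspace" and X :: "'b fspace"
  assumes dist: "distinct [m, n, p, q]" and h: "h = arc m n p q 0 0 0"
    and bu1: "blow_up X' \<beta>\<^sub>1 (Hcirc K) (Zcentre K)"
    and bu2: "blow_up X \<beta>\<^sub>2 X' (proper_transform X' \<beta>\<^sub>1 (Zcentre K) (Ycentre K))"
    and ext: "pascal_extension X (\<beta>\<^sub>1 \<circ> \<beta>\<^sub>2) [LA, LB, LC] [LF, LE, LD] Q"
  defines "x \<equiv> chord_meet m q p n"
  shows "isomorphism (fibre X (\<beta>\<^sub>1 \<circ> \<beta>\<^sub>2) h)
    (induced (proj_space 2) (pencil (cpt u (x 0) (x 1) (x 2)))) Q"
proof -
  interpret d: plane_frame w u by (rule dual_frame)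
  note fH = function_space_Hcirc[of K]
  note fX' = blow_up_function_space[OF bu1] and fX = blow_up_function_space[OF bu2]
  note \<beta>1 = blow_up_morphism[OF bu1] and \<beta>2 = blow_up_morphism[OF bu2]
  let ?Y' = "proper_transform X' \<beta>\<^sub>1 (Zcentre K) (Ycentre K)"
  have arc0: "arc m n p q a b 0 = h" for a b
    unfolding h arc_def arc_param_def by (simp cong: letter.case_cong)
  have h_sep: "h \<in> separated_hexads"
    unfolding h by (rule arc_separated[OF arc_0[OF dist]])
  have h_gap: "gap1 h = 0" "gap2 h = 0" unfolding h gap_arc by simp_all
  have h_Y: "h \<in> Ycentre K" using Ycentre_iff_gaps[OF h_sep] h_gap by simp
  \<comment> \<open>Away from the first centre the first blow-up is undone by a section
    \<open>s\<close>, so the second one can be studied in the coordinates of the hexads.\<close>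
  have "separated_hexads \<inter> Zcentre K = {}" using separated_hexadsD(5) by blast
  from blow_up_off_centre[OF bu1 fH open_separated_hexads this h_sep]
  obtain V s where V: "open_in (Hcirc K) V" "h \<in> V" "V \<subseteq> separated_hexads"
    and s: "morphism (induced (Hcirc K) V) X' s"
      "\<And>y. y \<in> V \<Longrightarrow> \<beta>\<^sub>1 (s y) = y" "\<And>b. b \<in> points X' \<Longrightarrow> \<beta>\<^sub>1 b \<in> V \<Longrightarrow> s (\<beta>\<^sub>1 b) = b"
    by metis
  define x0 where "x0 = s h"
  define N where "N = {x' \<in> points X'. \<beta>\<^sub>1 x' \<in> V}"
  have sN: "s y \<in> N" if "y \<in> V" for y
    using morphism_points[OF s(1), of y] s(2)[OF that] that unfolding N_def by (simp add: points_induced)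
  have x0N: "x0 \<in> N" unfolding x0_def by (rule sN[OF V(2)])
  have g: "(N, \<lambda>x'. gap1 (\<beta>\<^sub>1 x')) \<in> X'" "(N, \<lambda>x'. gap2 (\<beta>\<^sub>1 x')) \<in> X'"
    unfolding N_def
    by (rule morphism_regular[OF \<beta>1 regular_restrict_subset[OF fH gap_regular(1) V(1,3)]])
      (rule morphism_regular[OF \<beta>1 regular_restrict_subset[OF fH gap_regular(2) V(1,3)]])
  \<comment> \<open>Over \<open>V\<close> the first centre is absent and the second one is the
    closed zero set of the two gaps, so taking the closure adds no points to its preimage.\<close>
  have Y': "x' \<in> ?Y' \<longleftrightarrow> gap1 (\<beta>\<^sub>1 x') = 0 \<and> gap2 (\<beta>\<^sub>1 x') = 0" if x': "x' \<in> N" for x'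
  proof
    assume "x' \<in> ?Y'"
    show "gap1 (\<beta>\<^sub>1 x') = 0 \<and> gap2 (\<beta>\<^sub>1 x') = 0"
    proof (rule ccontr)
      assume ne: "\<not> ?thesis"
      let ?O = "{y \<in> N. gap1 (\<beta>\<^sub>1 y) \<noteq> 0} \<union> {y \<in> N. gap2 (\<beta>\<^sub>1 y) \<noteq> 0}"
      have "open_in X' (\<Union>{{y \<in> N. gap1 (\<beta>\<^sub>1 y) \<noteq> 0}, {y \<in> N. gap2 (\<beta>\<^sub>1 y) \<noteq> 0}})"
        by (rule open_in_Union[OF fX']) (use open_nonzero[OF fX'] g in blast)
      then have "open_in X' ?O" by simp
      moreover have "x' \<in> ?O" using x' ne by blast
      ultimately have "?O \<inter> {b \<in> points X'. \<beta>\<^sub>1 b \<in> Ycentre K - Zcentre K} \<noteq> {}"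
        using \<open>x' \<in> ?Y'\<close> unfolding proper_transform_def closure_in_def by blast
      then obtain y where y: "y \<in> ?O" "\<beta>\<^sub>1 y \<in> Ycentre K" by blast
      then have "\<beta>\<^sub>1 y \<in> separated_hexads" using V(3) unfolding N_def by blast
      then show False using Ycentre_iff_gaps y by blast
    qed
  next
    assume z: "gap1 (\<beta>\<^sub>1 x') = 0 \<and> gap2 (\<beta>\<^sub>1 x') = 0"
    have "\<beta>\<^sub>1 x' \<in> separated_hexads" using x' V(3) unfolding N_def by blast
    then have "\<beta>\<^sub>1 x' \<in> Ycentre K - Zcentre K"
      using Ycentre_iff_gaps z separated_hexadsD(5) by blast
    then show "x' \<in> ?Y'"
      using x' closure_in_superset[OF fX', of "{b \<in> points X'. \<beta>\<^sub>1 b \<in> Ycentre K - Zcentre K}"]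
      unfolding proper_transform_def N_def by blast
  qed
  \<comment> \<open>A function on the first blow-up is transported to the hexads by
    \<open>s\<close>, decomposed there, and the coefficients are pulled back along the first
    projection.\<close>
  have ideal: "\<exists>W c d. x0 \<in> W \<and> W \<subseteq> U \<and> (W, c) \<in> X' \<and> (W, d) \<in> X' \<and>
      (\<forall>y\<in>W. f y = gap1 (\<beta>\<^sub>1 y) * c y + gap2 (\<beta>\<^sub>1 y) * d y)"
    if f: "(U, f) \<in> X'" "x0 \<in> U" and zero: "\<And>z. z \<in> U \<inter> ?Y' \<Longrightarrow> f z = 0" for U f
  proof -
    let ?U = "{y \<in> V. s y \<in> U}"
    have fs: "(?U, \<lambda>y. f (s y)) \<in> Hcirc K"
      using regular_induced[OF fH V(1) morphism_regular[OF s(1) f(1)]] by (simp add: points_induced)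
    have "\<exists>W c d. h \<in> W \<and> W \<subseteq> ?U \<inter> separated_hexads \<and> (W, c) \<in> Hcirc K \<and> (W, d) \<in> Hcirc K \<and>
      (\<forall>y\<in>W. f (s y) = gap1 y * c y + gap2 y * d y)"
    proof (rule Ycentre_local_equations[OF fs _ h_sep h_Y])
      show "h \<in> ?U" using V(2) f(2) unfolding x0_def by simp
      fix y assume y: "y \<in> ?U \<inter> separated_hexads \<inter> Ycentre K"
      then have "s y \<in> ?Y'" using Y'[OF sN[of y]] s(2)[of y] Ycentre_iff_gaps by auto
      then show "f (s y) = 0" using zero y by blast
    qed
    then obtain W c d where W: "h \<in> W" "W \<subseteq> ?U \<inter> separated_hexads" "(W, c) \<in> Hcirc K" "(W, d) \<in> Hcirc K"
      "\<forall>y\<in>W. f (s y) = gap1 y * c y + gap2 y * d y" by (elim exE conjE)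
    let ?W = "{x' \<in> points X'. \<beta>\<^sub>1 x' \<in> W}"
    have sW: "s (\<beta>\<^sub>1 y) = y" if "y \<in> ?W" for y using s(3)[of y] that W(2) by blast
    show ?thesis
    proof (intro exI conjI ballI)
      show "x0 \<in> ?W" using x0N s(2)[OF V(2)] W(1) unfolding N_def x0_def by simp
      show "?W \<subseteq> U" using sW W(2) by fastforce
      show "(?W, \<lambda>y. c (\<beta>\<^sub>1 y)) \<in> X'" "(?W, \<lambda>y. d (\<beta>\<^sub>1 y)) \<in> X'"
        using morphism_regular[OF \<beta>1 W(3)] morphism_regular[OF \<beta>1 W(4)] .
      fix y assume y: "y \<in> ?W"
      then have "f (s (\<beta>\<^sub>1 y)) = gap1 (\<beta>\<^sub>1 y) * c (\<beta>\<^sub>1 y) + gap2 (\<beta>\<^sub>1 y) * d (\<beta>\<^sub>1 y)" using W(5) by blast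
      then show "f y = gap1 (\<beta>\<^sub>1 y) * c (\<beta>\<^sub>1 y) + gap2 (\<beta>\<^sub>1 y) * d (\<beta>\<^sub>1 y)" unfolding sW[OF y] .
    qed
  qed
  \<comment> \<open>The parameters for which the arc stays in \<open>V\<close>, where the section is
    available.\<close>
  define D where "D = (\<lambda>a b. {t \<in> arc_domain m n p q a b. arc m n p q a b t \<in> V})"
  have arc: "is_arc X' N (\<lambda>x'. gap1 (\<beta>\<^sub>1 x')) (\<lambda>x'. gap2 (\<beta>\<^sub>1 x')) x0 a b (D a b) (\<lambda>t. s (arc m n p q a b t))" for a b
  proof -
    let ?C = "continuous_space (arc_domain m n p q a b)"
    have "open_in ?C {t \<in> points ?C. arc m n p q a b t \<in> V}" by (rule morphism_open[OF morphism_arc V(1)])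
    then have oD: "open (D a b)"
      unfolding D_def points_continuous_space[OF open_arc_domain] by (rule continuous_space_open)
    have DV: "arc m n p q a b t \<in> V" if "t \<in> D a b" for t using that unfolding D_def by simp
    have "morphism (continuous_space (D a b)) (Hcirc K) (arc m n p q a b)"
      by (rule morphism_continuous_space_subset[OF morphism_arc open_arc_domain oD]) (auto simp: D_def)
    then have "morphism (continuous_space (D a b)) (induced (Hcirc K) V) (arc m n p q a b)"
      by (rule morphism_into_induced[OF function_space_continuous_space[OF oD]])
        (use DV in \<open>simp add: points_continuous_space[OF oD]\<close>)
    from morphism_comp[OF this s(1)]
    have "morphism (continuous_space (D a b)) X' (\<lambda>t. s (arc m n p q a b t))" .
    then show ?thesis
      unfolding is_arc_def using oD sN[OF DV] s(2)[OF DV] arc_0[OF dist] V(2)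
      by (auto simp: gap_arc arc0 x0_def D_def)
  qed
  have "\<exists>e. morphism (proj_space 1) X e \<and> {b \<in> points X. \<beta>\<^sub>2 b = x0} = e ` proj_points 1 \<and>
    (\<forall>a b D \<gamma>. (a \<noteq> 0 \<or> b \<noteq> 0) \<and>
      is_arc X' N (\<lambda>x'. gap1 (\<beta>\<^sub>1 x')) (\<lambda>x'. gap2 (\<beta>\<^sub>1 x')) x0 a b D \<gamma> \<longrightarrow>
      (\<exists>D' \<Gamma>. open D' \<and> 0 \<in> D' \<and> D' \<subseteq> D \<and> morphism (continuous_space D') X \<Gamma> \<and>
        (\<forall>t\<in>D'. \<beta>\<^sub>2 (\<Gamma> t) = \<gamma> t) \<and> \<Gamma> 0 = e (hclass (vec2 a b))))"
  proof (rule blow_up_codim2_fibre[OF bu2 fX' g x0N])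
    show "x' \<in> ?Y' \<longleftrightarrow> gap1 (\<beta>\<^sub>1 x') = 0 \<and> gap2 (\<beta>\<^sub>1 x') = 0" if "x' \<in> N" for x'
      by (rule Y'[OF that])
    show "\<exists>W c d. x0 \<in> W \<and> W \<subseteq> U \<and> (W, c) \<in> X' \<and> (W, d) \<in> X' \<and>
        (\<forall>y\<in>W. f y = gap1 (\<beta>\<^sub>1 y) * c y + gap2 (\<beta>\<^sub>1 y) * d y)"
      if "(U, f) \<in> X'" "x0 \<in> U" "\<And>z. z \<in> U \<inter> ?Y' \<Longrightarrow> f z = 0" for U f
      by (rule ideal[OF that])
    show "\<exists>D \<gamma>. is_arc X' N (\<lambda>x'. gap1 (\<beta>\<^sub>1 x')) (\<lambda>x'. gap2 (\<beta>\<^sub>1 x')) x0 a b D \<gamma>" for a b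
      by (rule exI[of _ "D a b"], rule exI, rule arc)
  qed
  then obtain e where e: "morphism (proj_space 1) X e" "{b \<in> points X. \<beta>\<^sub>2 b = x0} = e ` proj_points 1"
    and lift: "(\<forall>a b D \<gamma>. (a \<noteq> 0 \<or> b \<noteq> 0) \<and>
      is_arc X' N (\<lambda>x'. gap1 (\<beta>\<^sub>1 x')) (\<lambda>x'. gap2 (\<beta>\<^sub>1 x')) x0 a b D \<gamma> \<longrightarrow>
      (\<exists>D' \<Gamma>. open D' \<and> 0 \<in> D' \<and> D' \<subseteq> D \<and> morphism (continuous_space D') X \<Gamma> \<and>
        (\<forall>t\<in>D'. \<beta>\<^sub>2 (\<Gamma> t) = \<gamma> t) \<and> \<Gamma> 0 = e (hclass (vec2 a b))))"
    by (elim exE conjE)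

  have Q: "morphism X (proj_space 2) Q" "\<And>y. y \<in> points X \<Longrightarrow> inj (\<beta>\<^sub>1 (\<beta>\<^sub>2 y)) \<Longrightarrow>
      Q y = pascal_line [LA, LB, LC] [LF, LE, LD] (\<beta>\<^sub>1 (\<beta>\<^sub>2 y))"
    using ext unfolding pascal_extension_def by auto
  \<comment> \<open>The determinant of the coordinate vectors of M, N and the intersection of MQ
    with NP; it is nonzero because this intersection is not on the line MN.\<close>
  define scale where "scale = (m - n)\<^sup>2 * (q - n) * (p - m)"
  have scale: "scale \<noteq> 0" using dist unfolding scale_def by auto
  define L where "L = (\<lambda>a b. pascal_coords a b m p q n n)"
  have L_nonzero: "L a b 0 \<noteq> 0 \<or> L a b 1 \<noteq> 0 \<or> L a b 2 \<noteq> 0" if "a \<noteq> 0 \<or> b \<noteq> 0" for a b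
  proof (rule ccontr)
    assume "\<not> ?thesis"
    then have "scale * a = 0" "scale * b = 0"
      using pascal_coords_inverse(3)[of a b m p q n] pascal_coords_inverse(4)[of a b m p q n]
      unfolding L_def scale_def by simp_all
    then show False using scale that by simp
  qed
  \<comment> \<open>The value is computed as a limit. Along the lifted arc both sides extend over 0,
    and the parameters at which they differ form an open set; if 0 were among them, so would be some
    \<open>t\<close> other than 0, \<open>- a\<close> and \<open>- b\<close>. There the hexad is
    injective, and the hypothesis on \<open>Q\<close> gives equality.\<close>
  have Qe: "Q (e (hclass (vec2 a b))) = cpt w (L a b 0) (L a b 1) (L a b 2)" if ab: "a \<noteq> 0 \<or> b \<noteq> 0" for a b
  proof (rule ccontr)
    assume ne: "Q (e (hclass (vec2 a b))) \<noteq> cpt w (L a b 0) (L a b 1) (L a b 2)"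
    from lift[rule_format, OF conjI[OF ab arc]] obtain D' \<Gamma> where D': "open D'" "0 \<in> D'" "D' \<subseteq> D a b"
      "morphism (continuous_space D') X \<Gamma>" "\<forall>t\<in>D'. \<beta>\<^sub>2 (\<Gamma> t) = s (arc m n p q a b t)"
      "\<Gamma> 0 = e (hclass (vec2 a b))" by (elim exE conjE)
    let ?C = "continuous_space D'"
    have fC: "function_space ?C" by (rule function_space_continuous_space[OF D'(1)])
    define l where "l = (\<lambda>t. pascal_coords (a + t) (b + t) (m + t * (a + t)) p q (n + t * (b + t)) n)"
    have l0: "l 0 = L a b" unfolding l_def L_def by simp
    have cont: "continuous_on A (\<lambda>t. l t i)" for A i
      unfolding l_def pascal_coords_def chord_meet_def cross3_def vec3_def
      by (cases "i = 0"; cases "i = 1"; cases "i = 2") (auto intro!: continuous_intros)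
    obtain k where k: "k \<in> {0, 1, 2}" "l 0 k \<noteq> 0" using L_nonzero[OF ab] l0 by auto
    define W where "W = {t \<in> D'. l t k \<noteq> 0}"
    have lreg: "(D', \<lambda>t. l t i) \<in> ?C" for i by (rule continuous_space_regular[OF D'(1) cont])
    have oW: "open_in ?C W" unfolding W_def by (rule open_nonzero[OF fC lreg])
    have oW': "open W" by (rule continuous_space_open[OF oW])
    have l_nonzero: "l t 0 \<noteq> 0 \<or> l t 1 \<noteq> 0 \<or> l t 2 \<noteq> 0" if "t \<in> W" for t
      using that k(1) unfolding W_def by auto
    let ?w = "\<lambda>t. cvec w (l t 0) (l t 1) (l t 2)"
    have "open_in ?C {t \<in> W. Q (\<Gamma> t) \<noteq> hclass (?w t)}"
    proof (rule open_differs_from_hclass[OF fC morphism_comp[OF D'(4) Q(1)]])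
      fix i
      have "continuous_on W (\<lambda>t. ?w t i)"
        unfolding cvec_def by (intro continuous_intros cont)
      then show "(W, \<lambda>t. ?w t i) \<in> ?C" unfolding continuous_space_def using oW' by (auto simp: W_def)
    qed (use d.cvec_supp d.cvec_nonzero[OF l_nonzero] in auto)
    from continuous_space_open[OF this] have "open {t \<in> W. Q (\<Gamma> t) \<noteq> hclass (?w t)}" .
    moreover have "0 \<in> {t \<in> W. Q (\<Gamma> t) \<noteq> hclass (?w t)}"
      using ne D'(2,6) k(2) by (simp add: W_def l0 cpt_def)
    moreover have "finite {- a, - b}" by simp
    ultimately obtain t where t: "t \<in> {t \<in> W. Q (\<Gamma> t) \<noteq> hclass (?w t)}" "t \<notin> {- a, - b}" "t \<noteq> 0"
      by (rule open_avoid_finite)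
    then have tD: "t \<in> D'" "t \<in> W" "t \<in> D a b" using D'(3) unfolding W_def by auto
    have t': "t \<in> arc_domain m n p q a b" "a + t \<noteq> 0" "b + t \<noteq> 0"
      using tD(3) t(2) unfolding D_def by (auto simp: add_eq_0_iff)
    have "\<beta>\<^sub>1 (\<beta>\<^sub>2 (\<Gamma> t)) = arc m n p q a b t"
      using D'(5) tD(1,3) s(2) unfolding D_def by auto
    moreover have "\<Gamma> t \<in> points X"
      using morphism_points[OF D'(4)] tD(1) by (simp add: points_continuous_space[OF D'(1)])
    ultimately have "Q (\<Gamma> t) = cpt w (l t 0) (l t 1) (l t 2)"
      using Q(2)[of "\<Gamma> t"] pascal_line_arc[OF t'(1) t(3) t'(2,3)] l_nonzero[OF tD(2)]
      unfolding l_def by simp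
    then show False using t(1) by (simp add: cpt_def)
  qed

  let ?T = "cpt u (x 0) (x 1) (x 2)"
  let ?F = "{y \<in> points X. (\<beta>\<^sub>1 \<circ> \<beta>\<^sub>2) y = h}"
  have F: "?F = e ` proj_points 1"
  proof -
    have "\<beta>\<^sub>1 (\<beta>\<^sub>2 y) = h \<longleftrightarrow> \<beta>\<^sub>2 y = x0" if "y \<in> points X" for y
      using s(2)[OF V(2)] s(3)[OF morphism_points[OF \<beta>2 that]] V(2) unfolding x0_def by metis
    then show ?thesis unfolding e(2)[symmetric] by auto
  qed
  \<comment> \<open>Evaluation of a line at the coordinate vectors of M and N. The sign in the
    second row matches the sign in \<open>pascal_coords_inverse\<close>.\<close>
  define A where "A = (\<lambda>i :: nat. if i = 0 then cvec u 1 m (m\<^sup>2) else (\<lambda>j. - cvec u 1 n (n\<^sup>2) j))"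
  have A: "linear_map 2 1 A (cvec w a b c) = vec2 (a + b * m + c * m\<^sup>2) (- (a + b * n + c * n\<^sup>2))" for a b c
  proof
    fix i :: nat
    consider "i = 0" | "i = 1" | "i > 1" by linarith
    then show "linear_map 2 1 A (cvec w a b c) i = vec2 (a + b * m + c * m\<^sup>2) (- (a + b * n + c * n\<^sup>2)) i"
      unfolding linear_map_def vec2_def A_def
      by cases (use pairing[of 1 m "m\<^sup>2" a b c] pairing[of 1 n "n\<^sup>2" a b c] in \<open>simp_all add: sum_negf mult.commute\<close>)
  qed
  define r where "r = (\<lambda>l. e (linear_map 2 1 A ` l))"
  have r_cpt: "r (cpt w a b c) = e (hclass (vec2 (a + b * m + c * m\<^sup>2) (- (a + b * n + c * n\<^sup>2))))" for a b c
    unfolding r_def cpt_def linear_map_hclass A ..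
  have pencilE: "\<exists>k :: nat \<Rightarrow> complex. l = cpt w (k 0) (k 1) (k 2) \<and> (k 0 \<noteq> 0 \<or> k 1 \<noteq> 0 \<or> k 2 \<noteq> 0) \<and>
      k 0 * x 0 + k 1 * x 1 + k 2 * x 2 = 0" if "l \<in> pencil ?T" for l
  proof -
    have l: "l \<in> proj_points 2" "on_line ?T l" using that unfolding pencil_def by auto
    then obtain a b c where "l = cpt w a b c" "a \<noteq> 0 \<or> b \<noteq> 0 \<or> c \<noteq> 0" using d.proj_points_2E by metis
    then show ?thesis using l(2)
      by (intro exI[of _ "vec3 a b c"]) (simp add: vec3_def on_line_cpt mult.commute)
  qed
  \<comment> \<open>A line through the base point of the pencil cannot pass through both M and N:
    its coordinates are recovered from these two values up to the nonzero factor
    \<open>scale\<close>.\<close>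
  have vals: "l 0 + l 1 * m + l 2 * m\<^sup>2 \<noteq> 0 \<or> - (l 0 + l 1 * n + l 2 * n\<^sup>2) \<noteq> 0"
    if nonzero: "l 0 \<noteq> 0 \<or> l 1 \<noteq> 0 \<or> l 2 \<noteq> 0" and on_T: "l 0 * x 0 + l 1 * x 1 + l 2 * x 2 = 0" for l :: "nat \<Rightarrow> complex"
  proof (rule ccontr)
    assume "\<not> ?thesis"
    then have z: "l 0 + l 1 * m + l 2 * m\<^sup>2 = 0" "- (l 0 + l 1 * n + l 2 * n\<^sup>2) = 0" by blast+
    have "scale * l i = 0" if "i \<le> 2" for i
      using pascal_coords_inverse(1)[of l m q p n i, folded x_def scale_def, OF on_T that]
        pascal_coords_scale[of 0 0 0 m p q n n i] unfolding z by simp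
    then show False using scale nonzero by simp
  qed
  have Qr: "Q (r l) = l" and r_F: "r l \<in> ?F" if l: "l \<in> pencil ?T" for l
  proof -
    obtain k :: "nat \<Rightarrow> complex" where k: "l = cpt w (k 0) (k 1) (k 2)" "k 0 \<noteq> 0 \<or> k 1 \<noteq> 0 \<or> k 2 \<noteq> 0"
      "k 0 * x 0 + k 1 * x 1 + k 2 * x 2 = 0" using pencilE[OF l] by blast
    let ?a = "k 0 + k 1 * m + k 2 * m\<^sup>2" and ?b = "- (k 0 + k 1 * n + k 2 * n\<^sup>2)"
    note ab = vals[OF k(2,3)]
    have "L ?a ?b i = scale * k i" if "i \<le> 2" for i
      unfolding L_def scale_def
      by (rule pascal_coords_inverse(1)[OF k(3)[unfolded x_def] that])
    then have "Q (r l) = cpt w (scale * k 0) (scale * k 1) (scale * k 2)"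
      unfolding k(1) r_cpt Qe[OF ab] by simp
    also have "\<dots> = l" unfolding k(1) d.cpt_eq_iff using scale by blast
    finally show "Q (r l) = l" .
    show "r l \<in> ?F" unfolding F k(1) r_cpt using hclass_vec2_in[OF ab] by (rule imageI)
  qed
  have rQ: "r (Q y) = y" and Q_pencil: "Q y \<in> pencil ?T" if y: "y \<in> ?F" for y
  proof -
    obtain P where "P \<in> proj_points 1" "y = e P" using y unfolding F by blast
    then obtain a b where ab: "a \<noteq> 0 \<or> b \<noteq> 0" "y = e (hclass (vec2 a b))"
      using proj_points_1E by metis
    have Qy: "Q y = cpt w (L a b 0) (L a b 1) (L a b 2)" unfolding ab(2) by (rule Qe[OF ab(1)])
    have "r (Q y) = e (hclass (vec2 (scale * a) (scale * b)))"
      unfolding Qy r_cpt unfolding L_def pascal_coords_inverse(3,4) scale_def ..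
    also have "vec2 (scale * a) (scale * b) = (\<lambda>i. scale * vec2 a b i)" unfolding vec2_def by auto
    finally show "r (Q y) = y" unfolding hclass_scale[OF scale] ab(2) .
    show "Q y \<in> pencil ?T"
      unfolding Qy pencil_def using d.cpt_in[OF L_nonzero[OF ab(1)]] pascal_coords_inverse(2)[of a b m p q n]
      by (simp add: on_line_cpt L_def x_def mult.commute)
  qed
  have pF: "points (fibre X (\<beta>\<^sub>1 \<circ> \<beta>\<^sub>2) h) = ?F" unfolding fibre_def by (rule points_induced)
  have fF: "function_space (fibre X (\<beta>\<^sub>1 \<circ> \<beta>\<^sub>2) h)" unfolding fibre_def by (rule function_space_induced)
  let ?P = "induced (proj_space 2) (pencil ?T)"
  have fP: "function_space ?P" by (rule function_space_induced)
  have bij: "bij_betw Q ?F (pencil ?T)"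
    by (rule bij_betw_byWitness[where f' = r]) (use rQ Qr Q_pencil r_F in auto)
  have "morphism (fibre X (\<beta>\<^sub>1 \<circ> \<beta>\<^sub>2) h) (proj_space 2) Q"
    unfolding fibre_def by (rule morphism_restrict[OF Q(1)]) blast
  then have mor: "morphism (fibre X (\<beta>\<^sub>1 \<circ> \<beta>\<^sub>2) h) ?P Q"
    by (rule morphism_into_induced[OF fF]) (use Q_pencil pF in blast)
  have "morphism ?P (proj_space 1) (\<lambda>l. linear_map 2 1 A ` l)"
  proof (rule morphism_linear_map)
    show "pencil ?T \<subseteq> proj_points 2" unfolding pencil_def by blast
    fix v assume v: "hclass v \<in> pencil ?T"
    obtain k :: "nat \<Rightarrow> complex" where k: "hclass v = cpt w (k 0) (k 1) (k 2)" "k 0 \<noteq> 0 \<or> k 1 \<noteq> 0 \<or> k 2 \<noteq> 0"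
      "k 0 * x 0 + k 1 * x 1 + k 2 * x 2 = 0" using pencilE[OF v] by blast
    obtain c where c: "c \<noteq> 0" "v = (\<lambda>i. c * cvec w (k 0) (k 1) (k 2) i)"
      using k(1) unfolding cpt_def hclass_eq_iff by blast
    then have Av: "linear_map 2 1 A v = (\<lambda>i. c * vec2 (k 0 + k 1 * m + k 2 * m\<^sup>2) (- (k 0 + k 1 * n + k 2 * n\<^sup>2)) i)"
      by (simp only: linear_map_scale A)
    have "linear_map 2 1 A v 0 \<noteq> 0 \<or> linear_map 2 1 A v 1 \<noteq> 0"
      unfolding Av using vals[OF k(2,3)] c(1) by (simp add: vec2_def)
    then show "\<exists>i. linear_map 2 1 A v i \<noteq> 0" by blast
  qed
  from morphism_comp[OF this e(1)] have "morphism ?P X r" unfolding r_def .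
  then have "morphism ?P (fibre X (\<beta>\<^sub>1 \<circ> \<beta>\<^sub>2) h) r"
    unfolding fibre_def by (rule morphism_into_induced[OF fP]) (use r_F in \<open>simp add: points_induced\<close>)
  then have inv: "morphism ?P (fibre X (\<beta>\<^sub>1 \<circ> \<beta>\<^sub>2) h) (inv_into ?F Q)"
  proof (rule morphism_cong[OF fP])
    fix l assume "l \<in> points ?P"
    then have l: "l \<in> pencil ?T" by (simp add: points_induced)
    show "inv_into ?F Q l = r l"
      by (rule inv_into_f_eq[OF bij_betw_imp_inj_on[OF bij] r_F[OF l] Qr[OF l]])
  qed
  show ?thesis
    unfolding isomorphism_def pF points_induced using bij mor inv by blast
qed

end

text \<open>Reconciles the chord PN of the Pascal point AD, CF with the order of the points in
  \<open>join N P\<close>.\<close>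

lemma chord_meet_commute: "chord_meet s t s' t' = chord_meet s t t' s'"
  unfolding chord_meet_def by (simp add: add.commute mult.commute)

theorem proposition4p2:
  fixes K :: "ppoint set" and M N P Q :: ppoint and h :: hexad
    and X' :: "'a fspace" and \<beta>\<^sub>1 :: "'a \<Rightarrow> hexad"
    and X :: "'b fspace" and \<beta>\<^sub>2 :: "'b \<Rightarrow> 'a" and q :: "'b \<Rightarrow> pline"
  assumes "nonsingular_conic K"
    and "{M, N, P, Q} \<subseteq> K" and "distinct [M, N, P, Q]"
    and "h LA = M" "h LB = M" "h LE = N" "h LF = N" "h LC = P" "h LD = Q"
    and "blow_up X' \<beta>\<^sub>1 (Hcirc K) (Zcentre K)"
    and "blow_up X \<beta>\<^sub>2 X' (proper_transform X' \<beta>\<^sub>1 (Zcentre K) (Ycentre K))"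
    and "pascal_extension X (\<beta>\<^sub>1 \<circ> \<beta>\<^sub>2) [LA, LB, LC] [LF, LE, LD] q"
  shows "isomorphism (fibre X (\<beta>\<^sub>1 \<circ> \<beta>\<^sub>2) h)
    (induced (proj_space 2) (pencil (meet (join M Q) (join N P)))) q"
proof -
  \<comment> \<open>A fifth point of the conic is needed as the point at infinity. A parametrization
    based at M shows that there are enough points; a second one, based at the new point
    \<open>R\<close>, gives M, N, P, Q finite parameters.\<close>
  have "infinite K"
  proof -
    have "M \<in> K" "N \<in> K" "M \<noteq> N" using assms(2,3) by auto
    from conic_parametrization[OF assms(1) this]
    obtain u w where uw: "plane_frame u w" "K = insert M (range (conic_point u))" .
    have "inj (conic_point u)" by (rule injI) (simp add: plane_frame.conic_point_inject[OF uw(1)])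
    then have "infinite (range (conic_point u))" using infinite_UNIV_char_0 finite_imageD by blast
    then show ?thesis unfolding uw(2) by simp
  qed
  then have "\<not> K \<subseteq> {M, N, P, Q}" using finite_subset by blast
  then obtain R where R: "R \<in> K" "R \<notin> {M, N, P, Q}" by blast
  have "M \<in> K" "R \<noteq> M" using assms(2) R(2) by auto
  from conic_parametrization[OF assms(1) R(1) this]
  obtain u w where uw: "plane_frame u w" "K = insert R (range (conic_point u))" "R = cpt u 0 0 1" .
  interpret parametrized_conic u w K R
    using uw by (simp add: parametrized_conic_def parametrized_conic_axioms_def)
  have "M \<in> range (conic_point u)" "N \<in> range (conic_point u)" "P \<in> range (conic_point u)" "Q \<in> range (conic_point u)"
    using assms(2) R(2) uw(2) by auto
  then obtain a b c d where abcd: "M = conic_point u a" "N = conic_point u b" "P = conic_point u c"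
    "Q = conic_point u d" by blast
  have dist: "distinct [a, b, c, d]" using assms(3) unfolding abcd by auto
  \<comment> \<open>At \<open>t = 0\<close> the arcs of all directions pass through
    \<open>h\<close>, so the arc of direction zero can be used to name it.\<close>
  have "h = arc a b c d 0 0 0"
  proof
    fix x show "h x = arc a b c d 0 0 0 x"
      using assms(4-9) unfolding abcd by (cases x) (simp_all add: arc_def arc_param_def)
  qed
  moreover have "meet (join M Q) (join N P) = cpt u (chord_meet a d c b 0) (chord_meet a d c b 1) (chord_meet a d c b 2)"
    unfolding abcd chord_meet_commute[of a d c b] using dist by (intro meet_conic_chords) auto
  ultimately show ?thesis
    using pascal_fibre_isomorphism[OF dist _ assms(10-12)] by simp
qed

end
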